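(* Let $-\infty<a<b<+\infty$, and let $V,\tilde V\in L_1^1(\mathbb{R})$ be real-valued potentials such that $V(x)=\tilde V(x)$ for a.e. $x\in[a,b]$. Suppose that $V$ is not absolutely continuous on $[a,b]$, i.e. there is no absolutely continuous function on $[a,b]$ that coincides with $V$ a.e. on $[a,b]$. Let $L,R$ and $\tilde L,\tilde R$ denote the left and right reflection coefficients of the Schrödinger operators on the line with potentials $V$ and $\tilde V$, respectively. If either $L(k)=\tilde L(k)$ for all $k\in\mathbb{R}$, or $R(k)=\tilde R(k)$ for all $k\in\mathbb{R}$, then $V=\tilde V$ a.e. on $\mathbb{R}$.
   Context: $L_1^1(\mathbb{R})$ is the class of measurable functions $V$ on $\mathbb{R}$ such that $\int_{-\infty}^{\infty}(1+|x|)\,|V(x)|\,dx<\infty$. For real-valued $V\in L_1^1(\mathbb{R})$, let $H=-\frac{d^2}{dx^2}+V(x)$ be the self-adjoint Schrödinger operator on $L^2(\mathbb{R})$, and consider the equation $$-y''(k,x)+V(x)\,y(k,x)=k^2\,y(k,x),\qquad x\in\mathbb{R},$$ where the prime denotes the derivative with respect to $x$; solutions are understood in the usual sense ($y$ and $y'$ locally absolutely continuous, the equation holding a.e.). For real $k\neq 0$, the Jost solution from the left $f_l(k,x)$ and the Jost solution from the right $f_r(k,x)$ are the solutions satisfying $$f_l(k,x)=e^{ikx}+o(1)\ \ (x\to+\infty),\qquad f_l(k,x)=\frac{e^{ikx}}{T(k)}+\frac{L(k)}{T(k)}e^{-ikx}+o(1)\ \ (x\to-\infty),$$ $$f_r(k,x)=e^{-ikx}+o(1)\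 \ (x\to-\infty),\qquad f_r(k,x)=\frac{e^{-ikx}}{T(k)}+\frac{R(k)}{T(k)}e^{ikx}+o(1)\ \ (x\to+\infty).$$ These relations define the transmission coefficient $T(k)$, the left reflection coefficient $L(k)$ and the right reflection coefficient $R(k)$; the values at $k=0$ are understood by continuity. No information on bound states (their number, energies or norming constants) is assumed to be known or to coincide for the two potentials. *)

theory Defs
  imports "HOL-Analysis.Analysis"
begin

definition L11 :: "(real \<Rightarrow> real) set" where
  "L11 = {V. V \<in> borel_measurable lebesgue \<and> integrable lebesgue (\<lambda>x. (1 + \<bar>x\<bar>) * \<bar>V x\<bar>)}"

text \<open>
  The library's \<open>absolutely_continuous\<close> concerns measures. The pairs in \<open>D\<close> below are the
  end points of a finite family of pairwise disjoint open subintervals of the interval.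
\<close>

definition abs_cont_on :: "real \<Rightarrow> real \<Rightarrow> (real \<Rightarrow> 'a::real_normed_vector) \<Rightarrow> bool" where
  "abs_cont_on a b f \<longleftrightarrow>
     (\<forall>e>0. \<exists>d>0. \<forall>D. finite D \<longrightarrow>
        (\<forall>(u, v)\<in>D. a \<le> u \<and> u < v \<and> v \<le> b) \<longrightarrow>
        pairwise (\<lambda>I J. {fst I<..<snd I} \<inter> {fst J<..<snd J} = {}) D \<longrightarrow>
        (\<Sum>(u, v)\<in>D. v - u) < d \<longrightarrow> (\<Sum>(u, v)\<in>D. norm (f v - f u)) < e)"

definition locally_abs_cont :: "(real \<Rightarrow> 'a::real_normed_vector) \<Rightarrow> bool" where
  "locally_abs_cont f \<longleftrightarrow> (\<forall>a b. a < b \<longrightarrow> abs_cont_on a b f)"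

text \<open>Solutions of \<open>-y'' + V y = k\<^sup>2 y\<close>; \<open>z\<close> and \<open>w\<close> stand for \<open>y'\<close> and \<open>y''(x)\<close>.\<close>

definition schroedinger_solution :: "(real \<Rightarrow> real) \<Rightarrow> real \<Rightarrow> (real \<Rightarrow> complex) \<Rightarrow> bool" where
  "schroedinger_solution V k y \<longleftrightarrow> locally_abs_cont y \<and>
     (\<exists>z. (\<forall>x. (y has_vector_derivative z x) (at x)) \<and> locally_abs_cont z \<and>
       (AE x in lebesgue. \<exists>w. (z has_vector_derivative w) (at x) \<and>
          - w + of_real (V x) * y x = (of_real k)\<^sup>2 * y x))"

definition plane_wave :: "real \<Rightarrow> real \<Rightarrow> complex" where
  "plane_wave k x = exp (\<i> * of_real k * of_real x)"

text \<open>The definite descriptions below are meaningful for \<open>V \<in> L11\<close> and \<open>k \<noteq> 0\<close>.\<close>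

definition jost_left :: "(real \<Rightarrow> real) \<Rightarrow> real \<Rightarrow> real \<Rightarrow> complex" where
  "jost_left V k = (THE f. schroedinger_solution V k f \<and>
     ((\<lambda>x. f x - plane_wave k x) \<longlongrightarrow> 0) at_top)"

definition jost_right :: "(real \<Rightarrow> real) \<Rightarrow> real \<Rightarrow> real \<Rightarrow> complex" where
  "jost_right V k = (THE f. schroedinger_solution V k f \<and>
     ((\<lambda>x. f x - plane_wave (- k) x) \<longlongrightarrow> 0) at_bot)"

text \<open>
  \<open>T \<noteq> 0\<close> is required because \<open>1 / T\<close> occurs in the asymptotics, where HOL has \<open>1 / 0 = 0\<close>.
\<close>

definition scattering_relations ::
  "(real \<Rightarrow> real) \<Rightarrow> real \<Rightarrow> complex \<Rightarrow> complex \<Rightarrow> complex \<Rightarrow> bool" where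
  "scattering_relations V k T L R \<longleftrightarrow> T \<noteq> 0 \<and>
     ((\<lambda>x. jost_left V k x - (plane_wave k x / T + L / T * plane_wave (- k) x)) \<longlongrightarrow> 0) at_bot \<and>
     ((\<lambda>x. jost_right V k x - (plane_wave (- k) x / T + R / T * plane_wave k x)) \<longlongrightarrow> 0) at_top"

definition left_reflection_nonzero :: "(real \<Rightarrow> real) \<Rightarrow> real \<Rightarrow> complex" where
  "left_reflection_nonzero V k = (THE L. \<exists>T R. scattering_relations V k T L R)"

definition right_reflection_nonzero :: "(real \<Rightarrow> real) \<Rightarrow> real \<Rightarrow> complex" where
  "right_reflection_nonzero V k = (THE R. \<exists>T L. scattering_relations V k T L R)"

definition left_reflection :: "(real \<Rightarrow> real) \<Rightarrow> real \<Rightarrow> complex" where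
  "left_reflection V k =
     (if k = 0 then Lim (at 0) (left_reflection_nonzero V) else left_reflection_nonzero V k)"

definition right_reflection :: "(real \<Rightarrow> real) \<Rightarrow> real \<Rightarrow> complex" where
  "right_reflection V k =
     (if k = 0 then Lim (at 0) (right_reflection_nonzero V) else right_reflection_nonzero V k)"

end

theory Submission
  imports Defs "HOL-Complex_Analysis.Complex_Analysis"
begin

text \<open>
  Write \<open>U\<close> for the second potential. For large \<open>k\<close> in the closed upper half plane
  the Jost solutions are given by convergent Neumann series. Let \<open>D(k, x)\<close> be the matrix that
  carries \<open>(T f\<^sub>l, f\<^sub>r)\<close> and its derivative for \<open>V\<close> to the same matrix
  for \<open>U\<close>. If the left reflection coefficients agree, they cancel from \<open>D\<close> on the
  real axis, which makes \<open>D\<close> even there; hence \<open>D\<close> extends to a holomorphic function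
  of \<open>w = 1 / k\<close> near \<open>w = 0\<close>. Neither bound states nor the behaviour at \<open>k =
  0\<close> enter.

  Expanding \<open>\<partial>D/\<partial>x = A\<^sub>U D - D A\<^sub>V\<close>, where \<open>A\<^sub>V\<close>
  is the matrix of the first order system, in powers of \<open>w\<close> yields a recursion in which, on an
  interval where \<open>V = U\<close>, the first nonvanishing coefficient \<open>q\<close> of the upper right
  entry is constant and \<open>q V\<close> is absolutely continuous. As \<open>V\<close> is not, that entry
  vanishes, \<open>D\<close> is scalar there, and \<open>det D = 1\<close> makes it the identity. The
  deviation of \<open>D\<close> from the identity on a circle in the \<open>w\<close>-plane satisfies a linear
  integral inequality in \<open>x\<close>, because \<open>U - V\<close> is itself read off from the expansion
  at \<open>w = 0\<close>; so \<open>D\<close> is the identity for all \<open>x\<close>, and \<open>V =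
  U\<close>. Reflecting \<open>x\<close> exchanges the two reflection coefficients.
\<close>

section \<open>Absolute continuity and indefinite integrals\<close>

text \<open>The obstacle is that a merely integrable potential gives the Jost solutions, in general,
  no expansion in powers of \<open>1 / k\<close> to high order; only the quotient \<open>D\<close>
  of two solution matrices has one. On the real axis \<open>T f_l = f_r(-k) + L f_r(k)\<close>, so
  passing from the columns \<open>(f_r(-k), f_r(k))\<close> to \<open>(T f_l, f_r)\<close> is right
  multiplication by a unipotent matrix depending on \<open>L\<close> alone. With a common
  \<open>L\<close> it drops out of \<open>D\<close>, and what remains is unchanged when the two
  columns are swapped, that is, when \<open>k\<close> becomes \<open>-k\<close>. Hence
  \<open>D(-k)\<close> continues \<open>D(k)\<close> into the lower half plane. In each entry of
  \<open>D\<close> a right solution meets a left one, so the exponentials cancel, \<open>D\<close>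
  is bounded, and infinity is a removable singularity. The condition \<open>32 * A \<le> K\<close>,
  with \<open>A\<close> a bound for both integrals of the absolute values, makes the relative errors
  \<open>4 * A / |k|\<close> at most \<open>1/8\<close>: the Wronskians stay away from 0, and the
  diagonal of \<open>D\<close> stays close enough to 1 to exclude the root \<open>-1\<close> of
  \<open>det D = 1\<close>. The final estimate is made on a circle because one equation contains
  \<open>1 / w^2\<close>.\<close>

lemma abs_cont_on_has_integral:
  fixes F :: "real \<Rightarrow> 'a::euclidean_space"
  assumes "a \<le> b" and ac: "abs_cont_on a b F"
    and deriv: "AE x in lebesgue. x \<in> {a..b} \<longrightarrow> (F has_vector_derivative f x) (at x within {a..b})"
  shows "(f has_integral (F b - F a)) {a..b}"
proof -
  obtain N where N: "N \<in> null_sets lebesgue"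
    and bad: "{x \<in> space lebesgue. \<not> (x \<in> {a..b} \<longrightarrow> (F has_vector_derivative f x) (at x within {a..b}))} \<subseteq> N"
    using deriv by (auto simp: eventually_ae_filter)
  have negN: "negligible N"
    using N negligible_iff_null_sets by blast
  \<comment> \<open>Changing \<open>f\<close> on a null set does not affect the integral; the value
    0 turns the terms with tags in \<open>N\<close> into bare increments of
    \<open>F\<close>.\<close>
  define g where "g x = (if x \<in> N then 0 else f x)" for x
  have "(g has_integral (F b - F a)) {a..b}"
    unfolding has_integral_real
  proof (intro allI impI)
    fix e :: real
    assume "e > 0"
    define e1 where "e1 = e / (2 * (b - a + 1))"
    have "e1 > 0"
      using \<open>e > 0\<close> \<open>a \<le> b\<close> by (simp add: e1_def)
    have e1: "e1 * (b - a) < e / 2"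
      using \<open>e > 0\<close> \<open>a \<le> b\<close> by (simp add: e1_def field_simps)
    have "\<exists>d>0. \<forall>y\<in>{a..b}. \<bar>y - x\<bar> < d \<longrightarrow> norm (F y - F x - (y - x) *\<^sub>R f x) \<le> e1 * \<bar>y - x\<bar>"
      if "x \<in> {a..b}" "x \<notin> N" for x
    proof -
      have "(F has_derivative (\<lambda>h. h *\<^sub>R f x)) (at x within {a..b})"
        using bad that unfolding has_vector_derivative_def by auto
      then show ?thesis
        using \<open>e1 > 0\<close> unfolding has_derivative_within_alt by auto
    qed
    then obtain \<delta> where \<delta>0: "\<And>x. x \<in> {a..b} \<Longrightarrow> x \<notin> N \<Longrightarrow> \<delta> x > 0"
      and \<delta>: "\<And>x y. x \<in> {a..b} \<Longrightarrow> x \<notin> N \<Longrightarrow> y \<in> {a..b} \<Longrightarrow> \<bar>y - x\<bar> < \<delta> x \<Longrightarrow>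
             norm (F y - F x - (y - x) *\<^sub>R f x) \<le> e1 * \<bar>y - x\<bar>"
      by metis
    have "e / 2 > 0" using \<open>e > 0\<close> by simp
    then obtain d where "d > 0"
      and d: "\<And>D. finite D \<Longrightarrow> (\<forall>(u, v)\<in>D. a \<le> u \<and> u < v \<and> v \<le> b) \<Longrightarrow>
        pairwise (\<lambda>I J. {fst I<..<snd I} \<inter> {fst J<..<snd J} = {}) D \<Longrightarrow>
        (\<Sum>(u, v)\<in>D. v - u) < d \<Longrightarrow> (\<Sum>(u, v)\<in>D. norm (F v - F u)) < e / 2"
      using ac unfolding abs_cont_on_def by blast
    have "N \<in> sets lebesgue" using N by auto
    then obtain U where U: "open U" "N \<subseteq> U" "(U - N) \<in> lmeasurable" "emeasure lebesgue (U - N) < ennreal d"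
      using sets_lebesgue_outer_open[of N d] \<open>d > 0\<close> by metis
    have UN: "U = (U - N) \<union> N" using U by auto
    have Um: "U \<in> lmeasurable"
      using U N by (subst UN) (intro fmeasurable.Un, auto intro: fmeasurableI_null_sets)
    have "measure lebesgue U = measure lebesgue (U - N)"
      using N U by (subst UN, intro measure_Un_null_set) auto
    also have "\<dots> < d"
      using U(4) \<open>d > 0\<close> by (simp add: emeasure_eq_measure2 U(3) measure_nonneg ennreal_less_iff)
    finally have Ud: "measure lebesgue U < d" .
    \<comment> \<open>Tags at points of differentiability use the derivative estimate; tags in
      \<open>N\<close> confine their interval to \<open>U\<close>, whose measure is below the
      \<open>d\<close> of absolute continuity.\<close>
    define \<gamma> where "\<gamma> x = (if x \<in> N then U else if x \<in> {a..b} then ball x (\<delta> x) else UNIV)" for x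
    have gg: "gauge \<gamma>"
      using U \<delta>0 by (auto simp: gauge_def \<gamma>_def)
    have fine: "norm ((\<Sum>(x,K)\<in>p. measure lborel K *\<^sub>R g x) - (F b - F a)) < e"
      if p: "p tagged_division_of {a..b}" "\<gamma> fine p" for p
    proof -
      have finp: "finite p" using p by blast
      have pK: "\<exists>u v. K = {u..v} \<and> u \<le> x \<and> x \<le> v \<and> a \<le> u \<and> v \<le> b \<and> {u..v} \<subseteq> \<gamma> x" if xKp: "(x, K) \<in> p" for x K
      proof -
        obtain u v where "K = cbox u v" using tagged_division_ofD(4)[OF p(1) xKp] by blast
        moreover have "x \<in> K" "K \<subseteq> {a..b}" using tagged_division_ofD(2,3)[OF p(1) xKp] by auto
        moreover have "K \<subseteq> \<gamma> x" using p(2) xKp by (auto simp: fine_def)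
        ultimately show ?thesis by (intro exI[of _ u] exI[of _ v]) auto
      qed
      define h where "h = (\<lambda>(x, K). norm (measure lborel K *\<^sub>R g x - (F (Sup K) - F (Inf K))))"
      define p1 where "p1 = {(x, K) \<in> p. x \<notin> N}"
      define p2 where "p2 = {(x, K) \<in> p. x \<in> N}"
      \<comment> \<open>Degenerate intervals contribute nothing and are dropped: absolute continuity
        speaks of \<open>u < v\<close>, and the disjoint interiors of the remaining intervals are
        nonempty, which makes \<open>\<phi>\<close> below injective.\<close>
      define q where "q = {(x, K) \<in> p2. measure lborel K \<noteq> 0}"
      have sub: "p1 \<subseteq> p" "p2 \<subseteq> p" "q \<subseteq> p" by (auto simp: p1_def p2_def q_def)
      have fin: "finite p1" "finite p2" "finite q"
        using sub finp finite_subset by blast+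
      have "norm ((\<Sum>(x,K)\<in>p. measure lborel K *\<^sub>R g x) - (F b - F a)) \<le> sum h p"
      proof -
        have "(\<Sum>(x,K)\<in>p. measure lborel K *\<^sub>R g x) - (F b - F a) =
              (\<Sum>(x,K)\<in>p. measure lborel K *\<^sub>R g x - (F (Sup K) - F (Inf K)))"
          unfolding additive_tagged_division_1[OF \<open>a \<le> b\<close> p(1), of F, symmetric]
          by (simp add: split_def sum_subtractf)
        also have "norm \<dots> \<le> sum h p"
          unfolding h_def split_def by (rule norm_sum)
        finally show ?thesis .
      qed
      also have "sum h p = sum h p1 + sum h p2"
        by (subst sum.union_disjoint[symmetric]) (use fin in \<open>auto simp: p1_def p2_def intro!: sum.cong\<close>)
      also have "sum h p1 \<le> e1 * (b - a)"
      proof -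
        have "sum h p1 \<le> (\<Sum>(x,K)\<in>p1. e1 * measure lborel K)"
        proof (rule sum_mono, clarify)
          fix x K assume "(x, K) \<in> p1"
          then have xK: "(x, K) \<in> p" "x \<notin> N" by (auto simp: p1_def)
          then obtain u v where uv: "K = {u..v}" "u \<le> x" "x \<le> v" "a \<le> u" "v \<le> b" "{u..v} \<subseteq> \<gamma> x"
            using pK by blast
          then have *: "x \<in> {a..b}" "u \<in> {a..b}" "v \<in> {a..b}" by auto
          have "{u..v} \<subseteq> ball x (\<delta> x)" using uv * xK by (simp add: \<gamma>_def)
          moreover have "u \<in> {u..v}" "v \<in> {u..v}" using uv by auto
          ultimately have "u \<in> ball x (\<delta> x)" "v \<in> ball x (\<delta> x)" by blast+
          then have l: "\<bar>u - x\<bar> < \<delta> x" "\<bar>v - x\<bar> < \<delta> x" by (auto simp: dist_real_def)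
          have "norm (measure lborel K *\<^sub>R g x - (F (Sup K) - F (Inf K))) =
                norm ((F u - F x - (u - x) *\<^sub>R f x) - (F v - F x - (v - x) *\<^sub>R f x))"
            using uv xK by (simp add: g_def algebra_simps)
          also have "\<dots> \<le> e1 * \<bar>u - x\<bar> + e1 * \<bar>v - x\<bar>"
            by (intro norm_triangle_le_diff add_mono \<delta> * xK l)
          also have "\<dots> = e1 * measure lborel K"
            using uv by (simp add: algebra_simps)
          finally show "h (x, K) \<le> e1 * measure lborel K" by (simp add: h_def)
        qed
        also have "\<dots> \<le> (\<Sum>(x,K)\<in>p. e1 * measure lborel K)"
          using sub finp \<open>e1 > 0\<close> by (intro sum_mono2) auto
        also have "\<dots> = e1 * (\<Sum>(x,K)\<in>p. measure lborel K)"
          by (simp add: sum_distrib_left split_def)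
        also have "(\<Sum>(x,K)\<in>p. measure lborel K) = b - a"
          using additive_content_tagged_division[of p a b] p(1) \<open>a \<le> b\<close> by simp
        finally show ?thesis .
      qed
      also have "sum h p2 < e / 2"
      proof -
        have "h z = 0" if "z \<in> p2 - q" for z
        proof -
          obtain x K where z: "z = (x, K)" by (cases z)
          then have xK: "(x, K) \<in> p" "measure lborel K = 0" using that by (auto simp: p2_def q_def)
          then obtain u v where "K = {u..v}" "u \<le> v"
            using pK by (metis order_trans)
          with xK show ?thesis by (simp add: h_def z)
        qed
        then have "sum h p2 = sum h q"
          using fin by (intro sum.mono_neutral_right) (auto simp: q_def)
        also have "\<dots> = (\<Sum>z\<in>q. norm (F (Sup (snd z)) - F (Inf (snd z))))"
          by (intro sum.cong) (auto simp: q_def p2_def h_def g_def norm_minus_commute)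
        also have "\<dots> < e / 2"
        proof -
          define \<phi> where "\<phi> z = (Inf (snd z), Sup (snd z))" for z :: "real \<times> real set"
          have qK: "\<exists>u v. snd z = {u..v} \<and> u < v \<and> a \<le> u \<and> v \<le> b \<and> {u..v} \<subseteq> U \<and> \<phi> z = (u, v)" if "z \<in> q" for z
          proof -
            obtain x K where z: "z = (x, K)" by (cases z)
            then have xK: "(x, K) \<in> p" "x \<in> N" "measure lborel K \<noteq> 0" using that by (auto simp: p2_def q_def)
            then obtain u v where uv: "K = {u..v}" "u \<le> x" "x \<le> v" "a \<le> u" "v \<le> b" "{u..v} \<subseteq> \<gamma> x"
              using pK by blast
            moreover have "u < v" using xK uv by (cases "u = v") auto
            ultimately show ?thesis using xK z by (intro exI[of _ u] exI[of _ v]) (auto simp: \<gamma>_def \<phi>_def)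
          qed
          have disj: "interior (snd z) \<inter> interior (snd w) = {}" if "z \<in> q" "w \<in> q" "z \<noteq> w" for z w
            using tagged_division_ofD(5)[OF p(1), of "fst z" "snd z" "fst w" "snd w"] that sub by auto
          have disj': "{fst (\<phi> z)<..<snd (\<phi> z)} \<inter> {fst (\<phi> w)<..<snd (\<phi> w)} = {}" if "z \<in> q" "w \<in> q" "z \<noteq> w" for z w
            using disj[OF that] qK[OF that(1)] qK[OF that(2)] by auto
          have inj: "inj_on \<phi> q"
          proof (rule inj_onI, rule ccontr)
            fix z w assume zw: "z \<in> q" "w \<in> q" "\<phi> z = \<phi> w" "z \<noteq> w"
            then have "{fst (\<phi> z)<..<snd (\<phi> z)} = {}" using disj'[of z w] by auto
            then show False using qK[OF zw(1)] by auto
          qed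
          have "(\<Sum>(u, v)\<in>\<phi> ` q. norm (F v - F u)) < e / 2"
          proof (rule d)
            show "finite (\<phi> ` q)" using fin by simp
            show "\<forall>(u, v)\<in>\<phi> ` q. a \<le> u \<and> u < v \<and> v \<le> b"
            proof
              fix I assume "I \<in> \<phi> ` q"
              then obtain z where z: "z \<in> q" "I = \<phi> z" by blast
              show "case I of (u, v) \<Rightarrow> a \<le> u \<and> u < v \<and> v \<le> b"
                using qK[OF z(1)] unfolding z(2) by auto
            qed
            show "pairwise (\<lambda>I J. {fst I<..<snd I} \<inter> {fst J<..<snd J} = {}) (\<phi> ` q)"
              unfolding pairwise_def using disj' by blast
            have len: "(case \<phi> z of (u, v) \<Rightarrow> v - u) = measure lebesgue {fst (\<phi> z)<..<snd (\<phi> z)}"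
              if "z \<in> q" for z
              using qK[OF that] by auto
            have "(\<Sum>(u, v)\<in>\<phi> ` q. v - u) = (\<Sum>z\<in>q. measure lebesgue {fst (\<phi> z)<..<snd (\<phi> z)})"
              by (simp only: sum.reindex[OF inj] o_def len cong: sum.cong)
            also have "\<dots> = measure lebesgue (\<Union>z\<in>q. {fst (\<phi> z)<..<snd (\<phi> z)})"
            proof (rule measure_finite_Union[symmetric])
              show "disjoint_family_on (\<lambda>z. {fst (\<phi> z)<..<snd (\<phi> z)}) q"
                using disj' unfolding disjoint_family_on_def by blast
              show "emeasure lebesgue {fst (\<phi> z)<..<snd (\<phi> z)} \<noteq> \<infinity>" if "z \<in> q" for z
                using qK[OF that] by auto
            qed (use fin in auto)
            also have "\<dots> \<le> measure lebesgue U"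
            proof (rule measure_mono_fmeasurable)
              show "(\<Union>z\<in>q. {fst (\<phi> z)<..<snd (\<phi> z)}) \<subseteq> U"
              proof (rule UN_least)
                fix z assume z: "z \<in> q"
                show "{fst (\<phi> z)<..<snd (\<phi> z)} \<subseteq> U"
                  using qK[OF z] by auto
              qed
              show "(\<Union>z\<in>q. {fst (\<phi> z)<..<snd (\<phi> z)}) \<in> sets lebesgue"
                by (intro sets.finite_UN fin) auto
            qed (rule Um)
            finally show "(\<Sum>(u, v)\<in>\<phi> ` q. v - u) < d" using Ud by simp
          qed
          then show ?thesis
            unfolding sum.reindex[OF inj] o_def by (simp add: \<phi>_def)
        qed
        finally show ?thesis .
      qed
      finally show ?thesis using e1 by linarith
    qed
    show "\<exists>\<gamma>. gauge \<gamma> \<and> (\<forall>\<D>. \<D> tagged_division_of {a..b} \<and> \<gamma> fine \<D> \<longrightarrow>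
        norm ((\<Sum>(x,k)\<in>\<D>. measure lborel k *\<^sub>R g x) - (F b - F a)) < e)"
      by (intro exI[of _ \<gamma>] conjI allI impI gg) (elim conjE, rule fine)
  qed
  then show ?thesis
    by (rule has_integral_spike[OF negN, rotated]) (simp add: g_def)
qed

text \<open>Lebesgue's differentiation theorem for the gauge integral. A point where differentiation
  fails lies in some \<open>E n\<close>: it is an end point of arbitrarily short intervals whose
  relative defect exceeds \<open>1 / (n + 1)\<close>. Henstock's lemma bounds the total defect of
  disjoint intervals that are fine for a gauge, and Vitali's theorem covers almost all of
  \<open>E n\<close> by such intervals.\<close>

lemma indefinite_integral_ae_vector_derivative:
  fixes f :: "real \<Rightarrow> 'a::euclidean_space"
  assumes int: "\<And>a b. a \<le> b \<Longrightarrow> (f has_integral (F b - F a)) {a..b}"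
  shows "AE x in lebesgue. (F has_vector_derivative f x) (at x)"
proof -
  define E where "E n = {x. \<forall>d>0. \<exists>u v. u < v \<and> (x = u \<or> x = v) \<and> v - u < d \<and>
       (v - u) / real (Suc n) < norm (F v - F u - (v - u) *\<^sub>R f x)}" for n
  have deriv: "(F has_vector_derivative f x) (at x)" if x: "\<And>n. x \<notin> E n" for x
    unfolding has_vector_derivative_def has_derivative_at_alt
  proof (intro conjI allI impI)
    show "bounded_linear (\<lambda>h. h *\<^sub>R f x)" by (rule bounded_linear_scaleR_left)
    fix e :: real
    assume "e > 0"
    then obtain n where n: "1 / real (Suc n) < e" using nat_approx_posE by blast
    obtain d where "d > 0"
      and d: "\<And>u v. u < v \<Longrightarrow> (x = u \<or> x = v) \<Longrightarrow> v - u < d \<Longrightarrow>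
         norm (F v - F u - (v - u) *\<^sub>R f x) \<le> (v - u) / real (Suc n)"
      using x[of n] unfolding E_def mem_Collect_eq by (metis not_less)
    have "norm (F y - F x - (y - x) *\<^sub>R f x) \<le> e * norm (y - x)" if "norm (y - x) < d" for y
    proof -
      have "norm (F y - F x - (y - x) *\<^sub>R f x) \<le> \<bar>y - x\<bar> / real (Suc n)"
      proof (cases x y rule: linorder_cases)
        case less
        with d[of x y] that show ?thesis by auto
      next
        case greater
        have "norm (F y - F x - (y - x) *\<^sub>R f x) = norm (F x - F y - (x - y) *\<^sub>R f x)"
          by (subst norm_minus_cancel[symmetric]) (simp add: algebra_simps)
        with d[of y x] that greater show ?thesis by auto
      qed auto
      also have "\<dots> = \<bar>y - x\<bar> * (1 / real (Suc n))" by simp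
      also have "\<dots> \<le> \<bar>y - x\<bar> * e" using n by (intro mult_left_mono) auto
      finally show ?thesis by (simp add: mult.commute)
    qed
    then show "\<exists>d>0. \<forall>y. norm (y - x) < d \<longrightarrow> norm (F y - F x - (y - x) *\<^sub>R f x) \<le> e * norm (y - x)"
      using \<open>d > 0\<close> by blast
  qed
  have neg: "negligible (E n \<inter> {- real N<..<real N})" for n N
    unfolding negligible_outer_le
  proof (intro allI impI)
    fix e :: real
    assume "e > 0"
    \<comment> \<open>The defects of the chosen intervals will sum to at most \<open>c\<close>, and
      each length is at most \<open>n + 1\<close> times its defect; this value makes the total
      length at most \<open>e\<close>.\<close>
    define c where "c = e / real (Suc n)"
    have "c > 0" using \<open>e > 0\<close> by (simp add: c_def)
    have "f integrable_on cbox (- real N) (real N)"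
      using int[of "- real N" "real N"] by (auto simp: integrable_on_def)
    then obtain \<gamma> where "gauge \<gamma>"
      and \<gamma>: "\<And>p. p tagged_partial_division_of (cbox (- real N) (real N)) \<Longrightarrow> \<gamma> fine p \<Longrightarrow>
             sum (\<lambda>(x,k). norm (measure lborel k *\<^sub>R f x - integral k f)) p < c"
      by (rule Henstock_lemma[OF _ \<open>c > 0\<close>]) (rule that)
    \<comment> \<open>An index keeps its tag \<open>x\<close> with the interval, so that every
      finite disjoint subfamily is a tagged partial division fine for the gauge; \<open>ce\<close>
      and \<open>ra\<close> present the intervals as balls for the covering theorem.\<close>
    define K where "K = {(x, u, v). u < v \<and> (x = u \<or> x = v) \<and> {u..v} \<subseteq> \<gamma> x \<and> {u..v} \<subseteq> {- real N..real N} \<and>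
       (v - u) / real (Suc n) < norm (F v - F u - (v - u) *\<^sub>R f x)}"
    define ce where "ce = (\<lambda>(x::real, u, v). (u + v) / 2 :: real)"
    define ra where "ra = (\<lambda>(x::real, u, v). (v - u) / 2 :: real)"
    have cb: "cball (ce (x, u, v)) (ra (x, u, v)) = {u..v}" for x u v
    proof -
      have "(u + v) / 2 - (v - u) / 2 = u" "(u + v) / 2 + (v - u) / 2 = v" by argo+
      then show ?thesis by (simp add: ce_def ra_def cball_eq_atLeastAtMost)
    qed
    obtain C where C: "countable C" "C \<subseteq> K"
      and disj: "pairwise (\<lambda>i j. disjnt (cball (ce i) (ra i)) (cball (ce j) (ra j))) C"
      and negl: "negligible (E n \<inter> {- real N<..<real N} - (\<Union>i\<in>C. cball (ce i) (ra i)))"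
    proof (rule Vitali_covering_theorem_cballs[of K ra "E n \<inter> {- real N<..<real N}" ce])
      show "0 < ra i" if "i \<in> K" for i
        using that by (auto simp: K_def ra_def)
      fix x d :: real
      assume x: "x \<in> E n \<inter> {- real N<..<real N}" and "0 < d"
      have "open (\<gamma> x \<inter> {- real N<..<real N})" "x \<in> \<gamma> x \<inter> {- real N<..<real N}"
        using \<open>gauge \<gamma>\<close> x by (auto simp: gauge_def)
      then obtain d' where d': "d' > 0" "ball x d' \<subseteq> \<gamma> x \<inter> {- real N<..<real N}"
        by (meson open_contains_ball)
      have "min d d' > 0" using d' \<open>0 < d\<close> by simp
      then obtain u v where uv: "u < v" "x = u \<or> x = v" "v - u < min d d'"
        "(v - u) / real (Suc n) < norm (F v - F u - (v - u) *\<^sub>R f x)"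
        using x unfolding E_def by blast
      have "{u..v} \<subseteq> ball x d'"
        using uv by (auto simp: dist_real_def)
      then have sub: "{u..v} \<subseteq> \<gamma> x" "{u..v} \<subseteq> {- real N<..<real N}" using d'(2) by blast+
      have "{- real N<..<real N} \<subseteq> {- real N..real N}" by auto
      with sub have "{u..v} \<subseteq> {- real N..real N}" by blast
      then have "(x, u, v) \<in> K" using uv sub(1) unfolding K_def by blast
      moreover have "x \<in> cball (ce (x, u, v)) (ra (x, u, v))" using uv by (auto simp: cb)
      moreover have "ra (x, u, v) < d" using uv by (auto simp: ra_def)
      ultimately show "\<exists>i. i \<in> K \<and> x \<in> cball (ce i) (ra i) \<and> ra i < d" by blast
    qed
    have le: "measure lebesgue (\<Union>i\<in>I. cball (ce i) (ra i)) \<le> e" if I: "I \<subseteq> C" "finite I" for I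
    proof -
      define \<phi> where "\<phi> = (\<lambda>(x::real, u::real, v). (x, {u..v}))"
      have IK: "I \<subseteq> K" using I C by blast
      have disjI: "{u..v} \<inter> {u'..v'} = {}" if "(x, u, v) \<in> I" "(x', u', v') \<in> I" "(x, u, v) \<noteq> (x', u', v')" for x u v x' u' v'
      proof -
        have "disjnt (cball (ce (x, u, v)) (ra (x, u, v))) (cball (ce (x', u', v')) (ra (x', u', v')))"
          by (rule pairwiseD[OF disj subsetD[OF I(1) that(1)] subsetD[OF I(1) that(2)] that(3)])
        then show ?thesis by (simp only: cb disjnt_def)
      qed
      have inj: "inj_on \<phi> I"
      proof (rule inj_onI)
        fix i j assume ij: "i \<in> I" "j \<in> I" "\<phi> i = \<phi> j"
        obtain x u v x' u' v' where eq: "i = (x, u, v)" "j = (x', u', v')" by (metis prod_cases3)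
        have "u < v" using ij IK by (auto simp: eq K_def)
        moreover have "{u..v} = {u'..v'}" using ij by (simp add: eq \<phi>_def)
        ultimately have "{u..v} \<inter> {u'..v'} \<noteq> {}" by simp
        then show "i = j" using disjI[of x u v x' u' v'] ij unfolding eq by blast
      qed
      have tag: "\<phi> ` I tagged_partial_division_of cbox (- real N) (real N)"
        unfolding tagged_partial_division_of_def
      proof (intro conjI allI impI)
        show "finite (\<phi> ` I)" using I by simp
      next
        fix x k assume "(x, k) \<in> \<phi> ` I"
        then obtain u v where i: "(x, u, v) \<in> I" "k = {u..v}" by (auto simp: \<phi>_def)
        then have k: "(x, u, v) \<in> K" using IK by blast
        show "x \<in> k" using k i by (auto simp: K_def)
        show "k \<subseteq> cbox (- real N) (real N)" using k i by (simp add: K_def)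
        show "\<exists>a b. k = cbox a b" using i by (metis box_real(2))
      next
        fix x k x' k' assume *: "(x, k) \<in> \<phi> ` I \<and> (x', k') \<in> \<phi> ` I \<and> (x, k) \<noteq> (x', k')"
        obtain u v where i: "(x, u, v) \<in> I" "k = {u..v}" using * by (auto simp: \<phi>_def)
        obtain u' v' where j: "(x', u', v') \<in> I" "k' = {u'..v'}" using * by (auto simp: \<phi>_def)
        have "(x, u, v) \<noteq> (x', u', v')" using * i j by auto
        then have "k \<inter> k' = {}" using disjI[OF i(1) j(1)] i j by simp
        then show "interior k \<inter> interior k' = {}" by (metis interior_Int interior_empty)
      qed
      have "\<gamma> fine \<phi> ` I"
        using IK by (auto simp: fine_def \<phi>_def K_def)
      note small = \<gamma>[OF tag this]
      have "measure lebesgue (\<Union>i\<in>I. cball (ce i) (ra i)) \<le> (\<Sum>i\<in>I. measure lebesgue (cball (ce i) (ra i)))"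
        using I by (intro measure_UNION_le) auto
      also have "\<dots> \<le> (\<Sum>i\<in>I. real (Suc n) * (\<lambda>(x,k). norm (measure lborel k *\<^sub>R f x - integral k f)) (\<phi> i))"
      proof (rule sum_mono)
        fix i assume "i \<in> I"
        obtain x u v where i: "i = (x, u, v)" by (metis prod_cases3)
        with \<open>i \<in> I\<close> IK have k: "(x, u, v) \<in> K" by blast
        then have uv: "u < v" "(v - u) / real (Suc n) < norm (F v - F u - (v - u) *\<^sub>R f x)"
          by (auto simp: K_def)
        have "integral {u..v} f = F v - F u" using int[of u v] uv by (simp add: integral_unique)
        then have "(\<lambda>(x,k). norm (measure lborel k *\<^sub>R f x - integral k f)) (\<phi> i) = norm (F v - F u - (v - u) *\<^sub>R f x)"
          using uv by (simp add: i \<phi>_def norm_minus_commute)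
        moreover have "measure lebesgue (cball (ce i) (ra i)) = v - u"
          using uv by (simp add: i cb)
        moreover have "v - u \<le> real (Suc n) * norm (F v - F u - (v - u) *\<^sub>R f x)"
          using uv by (simp add: divide_less_eq mult.commute)
        ultimately show "measure lebesgue (cball (ce i) (ra i)) \<le>
            real (Suc n) * (\<lambda>(x,k). norm (measure lborel k *\<^sub>R f x - integral k f)) (\<phi> i)" by simp
      qed
      also have "\<dots> = real (Suc n) * sum (\<lambda>(x,k). norm (measure lborel k *\<^sub>R f x - integral k f)) (\<phi> ` I)"
        by (simp only: sum.reindex[OF inj] o_def sum_distrib_left)
      also have "\<dots> \<le> real (Suc n) * c"
        using small by (intro mult_left_mono) auto
      also have "\<dots> = e" by (simp add: c_def)
      finally show ?thesis .
    qed
    have m: "(\<Union>i\<in>C. cball (ce i) (ra i)) \<in> lmeasurable" "measure lebesgue (\<Union>i\<in>C. cball (ce i) (ra i)) \<le> e"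
      using fmeasurable_UN_bound[OF C(1) _ le] measure_UN_bound[OF C(1) _ le] by auto
    let ?Z = "E n \<inter> {- real N<..<real N} - (\<Union>i\<in>C. cball (ce i) (ra i))"
    let ?U = "\<Union>i\<in>C. cball (ce i) (ra i)"
    show "\<exists>T. E n \<inter> {- real N<..<real N} \<subseteq> T \<and> T \<in> lmeasurable \<and> measure lebesgue T \<le> e"
    proof (intro exI conjI)
      show "E n \<inter> {- real N<..<real N} \<subseteq> ?U \<union> ?Z" by blast
      have Z: "?Z \<in> null_sets lebesgue" using negl negligible_iff_null_sets by blast
      then show "?U \<union> ?Z \<in> lmeasurable"
        by (intro fmeasurable.Un[OF m(1)] fmeasurableI_null_sets)
      show "measure lebesgue (?U \<union> ?Z) \<le> e"
        using m measure_Un_null_set[OF _ Z, of ?U] by (simp add: fmeasurableD)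
    qed
  qed
  have "negligible (\<Union>(n, N)\<in>UNIV. E n \<inter> {- real N<..<real N})"
    by (rule negligible_countable_Union) (auto intro: neg)
  moreover have "{x. \<not> (F has_vector_derivative f x) (at x)} \<subseteq> (\<Union>(n, N)\<in>UNIV. E n \<inter> {- real N<..<real N})"
  proof
    fix x assume "x \<in> {x. \<not> (F has_vector_derivative f x) (at x)}"
    then obtain n where "x \<in> E n" using deriv by blast
    moreover obtain N where "\<bar>x\<bar> < real N" using reals_Archimedean2 by blast
    ultimately show "x \<in> (\<Union>(n, N)\<in>UNIV. E n \<inter> {- real N<..<real N})"
      by (intro UN_I[of "(n, N)"]) (auto simp: abs_less_iff)
  qed
  ultimately have "{x. \<not> (F has_vector_derivative f x) (at x)} \<in> null_sets lebesgue"
    using negligible_subset negligible_iff_null_sets by blast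
  then show ?thesis
    by (rule AE_I') auto
qed

lemma sum_integral_disjoint_le:
  fixes h :: "real \<Rightarrow> real"
  assumes h: "h integrable_on {a..b}" "\<And>x. x \<in> {a..b} \<Longrightarrow> 0 \<le> h x"
    and D: "finite D" "\<forall>(u, v)\<in>D. a \<le> u \<and> u < v \<and> v \<le> b"
    "pairwise (\<lambda>I J. {fst I<..<snd I} \<inter> {fst J<..<snd J} = {}) D"
  shows "(\<Sum>(u, v)\<in>D. integral {u..v} h) \<le> integral {a..b} h"
proof -
  have sub: "h integrable_on {u..v}" if "(u, v) \<in> D" for u v
    using D(2) that by (intro integrable_on_subinterval[OF h(1)]) auto
  \<comment> \<open>Open intervals, since the closed ones may share end points: at each point at
    most one summand is then nonzero.\<close>
  have hi: "((\<lambda>x. if x \<in> {fst I<..<snd I} then h x else 0) has_integral integral {fst I..snd I} h) {a..b}" if "I \<in> D" for I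
  proof -
    obtain u v where I: "I = (u, v)" by (cases I)
    have "(h has_integral integral {u..v} h) {u<..<v}"
      using sub that I by (simp add: has_integral_Icc_iff_Ioo[symmetric] integrable_integral)
    moreover have "{u<..<v} \<subseteq> {a..b}" using D(2) that I by auto
    ultimately show ?thesis by (simp only: I fst_conv snd_conv has_integral_restrict)
  qed
  have "(\<Sum>I\<in>D. integral {fst I..snd I} h) = integral {a..b} (\<lambda>x. \<Sum>I\<in>D. if x \<in> {fst I<..<snd I} then h x else 0)"
    by (rule integral_unique[symmetric], rule has_integral_sum[OF D(1) hi])
  also have "\<dots> \<le> integral {a..b} h"
  proof (rule integral_le)
    show "(\<lambda>x. \<Sum>I\<in>D. if x \<in> {fst I<..<snd I} then h x else 0) integrable_on {a..b}"
      by (rule has_integral_integrable, rule has_integral_sum[OF D(1) hi])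
    fix x assume x: "x \<in> {a..b}"
    show "(\<Sum>I\<in>D. if x \<in> {fst I<..<snd I} then h x else 0) \<le> h x"
    proof (cases "\<exists>J\<in>D. x \<in> {fst J<..<snd J}")
      case True
      then obtain J where J: "J \<in> D" "x \<in> {fst J<..<snd J}" by blast
      have "(\<Sum>I\<in>D. if x \<in> {fst I<..<snd I} then h x else 0) = (\<Sum>I\<in>{J}. if x \<in> {fst I<..<snd I} then h x else 0)"
      proof (rule sum.mono_neutral_right[OF D(1)])
        show "\<forall>i\<in>D - {J}. (if x \<in> {fst i<..<snd i} then h x else 0) = 0"
        proof
          fix i assume "i \<in> D - {J}"
          then have "{fst i<..<snd i} \<inter> {fst J<..<snd J} = {}"
            using D(3) J unfolding pairwise_def by blast
          then have "x \<notin> {fst i<..<snd i}" using J by blast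
          then show "(if x \<in> {fst i<..<snd i} then h x else 0) = 0" by presburger
        qed
      qed (use J in auto)
      also have "\<dots> = h x" using J by simp
      finally show ?thesis by simp
    next
      case False
      then have "(\<Sum>I\<in>D. if x \<in> {fst I<..<snd I} then h x else 0) = 0"
        by (intro sum.neutral) auto
      then show ?thesis using h(2)[OF x] by linarith
    qed
  qed (rule h(1))
  finally show ?thesis by (simp add: split_def)
qed

lemma indefinite_integral_abs_cont_on:
  fixes f :: "real \<Rightarrow> 'a::euclidean_space"
  assumes f: "f absolutely_integrable_on {a..b}"
    and F: "\<And>u v. a \<le> u \<Longrightarrow> u \<le> v \<Longrightarrow> v \<le> b \<Longrightarrow> (f has_integral (F v - F u)) {u..v}"
  shows "abs_cont_on a b F"
  unfolding abs_cont_on_def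
proof (intro allI impI)
  fix e :: real
  assume "e > 0"
  define g where "g x = norm (f x)" for x
  \<comment> \<open>Truncation: the integral of \<open>g - t n\<close> is small for large
    \<open>n\<close>, while \<open>t n\<close> contributes at most \<open>n\<close> times the length
    of an interval.\<close>
  define t where "t n x = min (g x) (real n)" for n x
  have g: "g absolutely_integrable_on {a..b}" "g integrable_on {a..b}"
    using f absolutely_integrable_norm[OF f] unfolding g_def absolutely_integrable_on_def by (auto simp: o_def)
  have t: "t n absolutely_integrable_on {a..b}" for n
    unfolding t_def[abs_def]
    using absolutely_integrable_min_1[OF g(1), of "\<lambda>_. real n"]
    by (simp add: absolutely_integrable_on_def integrable_const_ivl)
  have "(\<lambda>n. integral {a..b} (t n)) \<longlonglongrightarrow> integral {a..b} g"
  proof (rule dominated_convergence(2)[OF _ g(2)])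
    show "t n integrable_on {a..b}" for n using t by (simp add: absolutely_integrable_on_def)
    show "norm (t n x) \<le> g x" for n x by (auto simp: t_def g_def)
    show "(\<lambda>n. t n x) \<longlonglongrightarrow> g x" for x
    proof (rule tendsto_eventually)
      obtain m where "g x \<le> real m" using real_arch_simple by blast
      then show "\<forall>\<^sub>F n in sequentially. t n x = g x"
        by (auto simp: t_def eventually_sequentially intro!: exI[of _ m])
    qed
  qed
  then have "eventually (\<lambda>n. dist (integral {a..b} (t n)) (integral {a..b} g) < e / 2) sequentially"
    using \<open>e > 0\<close> by (intro tendstoD) auto
  then obtain n where "dist (integral {a..b} (t n)) (integral {a..b} g) < e / 2"
    by (auto simp: eventually_sequentially)
  then have n: "integral {a..b} (\<lambda>x. g x - t n x) < e / 2"
  proof -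
    have "integral {a..b} (\<lambda>x. g x - t n x) = integral {a..b} g - integral {a..b} (t n)"
      using t g(2) by (intro Henstock_Kurzweil_Integration.integral_diff) (auto simp: absolutely_integrable_on_def)
    with \<open>dist _ _ < e / 2\<close> show ?thesis unfolding dist_real_def by linarith
  qed
  define d where "d = e / (2 * (real n + 1))"
  have "d > 0" using \<open>e > 0\<close> by (simp add: d_def)
  moreover have "(\<Sum>(u, v)\<in>D. norm (F v - F u)) < e"
    if D: "finite D" "\<forall>(u, v)\<in>D. a \<le> u \<and> u < v \<and> v \<le> b"
      "pairwise (\<lambda>I J. {fst I<..<snd I} \<inter> {fst J<..<snd J} = {}) D" "(\<Sum>(u, v)\<in>D. v - u) < d" for D
  proof -
    have "(\<Sum>(u, v)\<in>D. norm (F v - F u)) \<le> (\<Sum>(u, v)\<in>D. integral {u..v} (\<lambda>x. g x - t n x) + real n * (v - u))"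
    proof (rule sum_mono, clarify)
      fix u v assume "(u, v) \<in> D"
      then have uv: "a \<le> u" "u < v" "v \<le> b" using D(2) by auto
      then have sub: "{u..v} \<subseteq> {a..b}" by auto
      have gi: "g integrable_on {u..v}" "f integrable_on {u..v}" "t n integrable_on {u..v}"
        using g f t[of n] sub by (auto simp: absolutely_integrable_on_def intro: integrable_on_subinterval)
      have "norm (F v - F u) = norm (integral {u..v} f)"
        using F[of u v] uv by (simp add: integral_unique)
      also have "\<dots> \<le> integral {u..v} g"
        using gi by (intro integral_norm_bound_integral) (auto simp: g_def)
      also have "\<dots> = integral {u..v} (\<lambda>x. g x - t n x) + integral {u..v} (t n)"
        using gi by (simp add: Henstock_Kurzweil_Integration.integral_diff)
      also have "integral {u..v} (t n) \<le> integral {u..v} (\<lambda>_. real n)"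
        using gi by (intro integral_le) (auto simp: t_def)
      also have "\<dots> = real n * (v - u)" using uv by simp
      finally show "norm (F v - F u) \<le> integral {u..v} (\<lambda>x. g x - t n x) + real n * (v - u)" by simp
    qed
    also have "\<dots> = (\<Sum>(u, v)\<in>D. integral {u..v} (\<lambda>x. g x - t n x)) + real n * (\<Sum>(u, v)\<in>D. v - u)"
      by (simp add: split_def sum.distrib sum_distrib_left)
    also have "(\<Sum>(u, v)\<in>D. integral {u..v} (\<lambda>x. g x - t n x)) \<le> integral {a..b} (\<lambda>x. g x - t n x)"
    proof (rule sum_integral_disjoint_le[OF _ _ D(1-3)])
      show "(\<lambda>x. g x - t n x) integrable_on {a..b}"
        using g t[of n] by (auto simp: absolutely_integrable_on_def intro!: integrable_diff)
      show "0 \<le> g x - t n x" for x by (simp add: t_def)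
    qed
    also have "real n * (\<Sum>(u, v)\<in>D. v - u) \<le> real n * d"
      using D(4) by (intro mult_left_mono) auto
    also have "\<dots> \<le> e / 2" using \<open>e > 0\<close> by (simp add: d_def field_simps)
    finally show ?thesis using n by linarith
  qed
  ultimately show "\<exists>d>0. \<forall>D. finite D \<longrightarrow> (\<forall>(u, v)\<in>D. a \<le> u \<and> u < v \<and> v \<le> b) \<longrightarrow>
      pairwise (\<lambda>I J. {fst I<..<snd I} \<inter> {fst J<..<snd J} = {}) D \<longrightarrow>
      (\<Sum>(u, v)\<in>D. v - u) < d \<longrightarrow> (\<Sum>(u, v)\<in>D. norm (F v - F u)) < e"
    by blast
qed

section \<open>Permanence properties of absolute continuity and calculus of primitives\<close>

lemma abs_cont_onE:
  assumes "abs_cont_on a b f" "0 < e"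
  obtains d where "0 < d" "\<And>D. finite D \<Longrightarrow> \<forall>(u, v)\<in>D. a \<le> u \<and> u < v \<and> v \<le> b \<Longrightarrow>
        pairwise (\<lambda>I J. {fst I<..<snd I} \<inter> {fst J<..<snd J} = {}) D \<Longrightarrow>
        (\<Sum>(u, v)\<in>D. v - u) < d \<Longrightarrow> (\<Sum>(u, v)\<in>D. norm (f v - f u)) < e"
  using assms(1)[unfolded abs_cont_on_def, rule_format, OF assms(2)] that by blast

lemma abs_cont_on_bounded_linear:
  assumes "bounded_linear h" and F: "abs_cont_on a b F"
  shows "abs_cont_on a b (\<lambda>x. h (F x))"
  unfolding abs_cont_on_def
proof (intro allI impI)
  fix e :: real
  assume "e > 0"
  obtain K where K: "K > 0" "\<And>x. norm (h x) \<le> norm x * K"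
    using bounded_linear.pos_bounded[OF assms(1)] by blast
  have "e / K > 0" using \<open>e > 0\<close> K by simp
  obtain d where "d > 0" and d: "\<And>D. finite D \<Longrightarrow> \<forall>(u, v)\<in>D. a \<le> u \<and> u < v \<and> v \<le> b \<Longrightarrow>
        pairwise (\<lambda>I J. {fst I<..<snd I} \<inter> {fst J<..<snd J} = {}) D \<Longrightarrow>
        (\<Sum>(u, v)\<in>D. v - u) < d \<Longrightarrow> (\<Sum>(u, v)\<in>D. norm (F v - F u)) < e / K"
    by (rule abs_cont_onE[OF F \<open>e / K > 0\<close>]) (rule that)
  show "\<exists>d>0. \<forall>D. finite D \<longrightarrow> (\<forall>(u, v)\<in>D. a \<le> u \<and> u < v \<and> v \<le> b) \<longrightarrow>
        pairwise (\<lambda>I J. {fst I<..<snd I} \<inter> {fst J<..<snd J} = {}) D \<longrightarrow>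
        (\<Sum>(u, v)\<in>D. v - u) < d \<longrightarrow> (\<Sum>(u, v)\<in>D. norm (h (F v) - h (F u))) < e"
  proof (intro exI[of _ d] conjI allI impI)
    fix D :: "(real \<times> real) set"
    assume D: "finite D" "\<forall>(u, v)\<in>D. a \<le> u \<and> u < v \<and> v \<le> b"
      "pairwise (\<lambda>I J. {fst I<..<snd I} \<inter> {fst J<..<snd J} = {}) D" "(\<Sum>(u, v)\<in>D. v - u) < d"
    have "(\<Sum>(u, v)\<in>D. norm (h (F v) - h (F u))) \<le> (\<Sum>(u, v)\<in>D. norm (F v - F u) * K)"
      using K(2) by (intro sum_mono) (auto simp: linear_diff[OF bounded_linear.linear[OF assms(1)], symmetric])
    also have "\<dots> = (\<Sum>(u, v)\<in>D. norm (F v - F u)) * K"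
      by (simp add: sum_distrib_right split_def)
    also have "\<dots> < e"
      using d[OF D] K(1) by (simp add: pos_less_divide_eq)
    finally show "(\<Sum>(u, v)\<in>D. norm (h (F v) - h (F u))) < e" .
  qed (rule \<open>d > 0\<close>)
qed

lemma abs_cont_on_mult:
  fixes F G :: "real \<Rightarrow> 'a::real_normed_algebra"
  assumes F: "abs_cont_on a b F" and G: "abs_cont_on a b G"
    and B: "\<And>x. x \<in> {a..b} \<Longrightarrow> norm (F x) \<le> B" "\<And>x. x \<in> {a..b} \<Longrightarrow> norm (G x) \<le> B"
  shows "abs_cont_on a b (\<lambda>x. F x * G x)"
  unfolding abs_cont_on_def
proof (intro allI impI)
  fix e :: real
  assume "e > 0"
  define B' where "B' = max B 0 + 1"
  have B': "B' > 0" "B \<le> B'" by (auto simp: B'_def)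
  have pos: "e / (2 * B') > 0" using \<open>e > 0\<close> B' by simp
  obtain d1 where d1: "d1 > 0" "\<And>D. finite D \<Longrightarrow> \<forall>(u, v)\<in>D. a \<le> u \<and> u < v \<and> v \<le> b \<Longrightarrow>
        pairwise (\<lambda>I J. {fst I<..<snd I} \<inter> {fst J<..<snd J} = {}) D \<Longrightarrow>
        (\<Sum>(u, v)\<in>D. v - u) < d1 \<Longrightarrow> (\<Sum>(u, v)\<in>D. norm (F v - F u)) < e / (2 * B')"
    by (rule abs_cont_onE[OF F pos]) (rule that)
  obtain d2 where d2: "d2 > 0" "\<And>D. finite D \<Longrightarrow> \<forall>(u, v)\<in>D. a \<le> u \<and> u < v \<and> v \<le> b \<Longrightarrow>
        pairwise (\<lambda>I J. {fst I<..<snd I} \<inter> {fst J<..<snd J} = {}) D \<Longrightarrow>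
        (\<Sum>(u, v)\<in>D. v - u) < d2 \<Longrightarrow> (\<Sum>(u, v)\<in>D. norm (G v - G u)) < e / (2 * B')"
    by (rule abs_cont_onE[OF G pos]) (rule that)
  show "\<exists>d>0. \<forall>D. finite D \<longrightarrow> (\<forall>(u, v)\<in>D. a \<le> u \<and> u < v \<and> v \<le> b) \<longrightarrow>
        pairwise (\<lambda>I J. {fst I<..<snd I} \<inter> {fst J<..<snd J} = {}) D \<longrightarrow>
        (\<Sum>(u, v)\<in>D. v - u) < d \<longrightarrow> (\<Sum>(u, v)\<in>D. norm (F v * G v - F u * G u)) < e"
  proof (intro exI[of _ "min d1 d2"] conjI allI impI)
    fix D :: "(real \<times> real) set"
    assume D: "finite D" "\<forall>(u, v)\<in>D. a \<le> u \<and> u < v \<and> v \<le> b"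
      "pairwise (\<lambda>I J. {fst I<..<snd I} \<inter> {fst J<..<snd J} = {}) D" "(\<Sum>(u, v)\<in>D. v - u) < min d1 d2"
    have "(\<Sum>(u, v)\<in>D. norm (F v * G v - F u * G u)) \<le>
      (\<Sum>(u, v)\<in>D. norm (F v - F u) * B' + B' * norm (G v - G u))"
    proof (rule sum_mono, clarify)
      fix u v assume "(u, v) \<in> D"
      then have uv: "u \<in> {a..b}" "v \<in> {a..b}" using D(2) by fastforce+
      have "F v * G v - F u * G u = (F v - F u) * G v + F u * (G v - G u)"
        by (simp add: algebra_simps)
      also have "norm \<dots> \<le> norm (F v - F u) * norm (G v) + norm (F u) * norm (G v - G u)"
        by (intro order_trans[OF norm_triangle_ineq] add_mono norm_mult_ineq)
      also have "\<dots> \<le> norm (F v - F u) * B' + B' * norm (G v - G u)"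
        using B[OF uv(1)] B[OF uv(2)] B' by (intro add_mono mult_left_mono mult_right_mono) auto
      finally show "norm (F v * G v - F u * G u) \<le> norm (F v - F u) * B' + B' * norm (G v - G u)" .
    qed
    also have "\<dots> = (\<Sum>(u, v)\<in>D. norm (F v - F u)) * B' + B' * (\<Sum>(u, v)\<in>D. norm (G v - G u))"
      by (simp add: sum_distrib_left sum_distrib_right split_def sum.distrib)
    also have "\<dots> < e / (2 * B') * B' + B' * (e / (2 * B'))"
      using d1(2)[OF D(1-3)] d2(2)[OF D(1-3)] D(4) B' by (intro add_strict_mono mult_strict_left_mono mult_strict_right_mono) auto
    also have "\<dots> = e" using B' by simp
    finally show "(\<Sum>(u, v)\<in>D. norm (F v * G v - F u * G u)) < e" .
  qed (use d1 d2 in auto)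
qed

text \<open>\<open>F\<close> is an indefinite Lebesgue integral of \<open>f\<close>. The
  differential equations below are kept in this integrated form, which survives products,
  reflection, dominated limits and Taylor expansion in a parameter. Absolute integrability is part
  of it because the gauge integral alone would not make \<open>F\<close> absolutely
  continuous.\<close>

definition primitive :: "(real \<Rightarrow> 'a::euclidean_space) \<Rightarrow> (real \<Rightarrow> 'a) \<Rightarrow> bool" where
  "primitive f F \<longleftrightarrow> (\<forall>a b. a \<le> b \<longrightarrow> f absolutely_integrable_on {a..b} \<and> (f has_integral (F b - F a)) {a..b})"

lemma primitiveI:
  assumes "\<And>a b. a \<le> b \<Longrightarrow> f absolutely_integrable_on {a..b}"
    and "\<And>a b. a \<le> b \<Longrightarrow> (f has_integral (F b - F a)) {a..b}"
  shows "primitive f F"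
  using assms by (auto simp: primitive_def)

lemma primitive_has_integral: "primitive f F \<Longrightarrow> a \<le> b \<Longrightarrow> (f has_integral (F b - F a)) {a..b}"
  by (simp add: primitive_def)

lemma primitive_integral: "primitive f F \<Longrightarrow> a \<le> b \<Longrightarrow> integral {a..b} f = F b - F a"
  by (simp add: primitive_def integral_unique)

lemma primitive_absolutely_integrable: "primitive f F \<Longrightarrow> f absolutely_integrable_on {a..b}"
  by (cases "a \<le> b") (simp_all add: primitive_def)

lemma primitive_locally_abs_cont: "primitive f F \<Longrightarrow> locally_abs_cont F"
  unfolding locally_abs_cont_def
  by (intro allI impI indefinite_integral_abs_cont_on primitive_absolutely_integrable primitive_has_integral)

lemma primitive_ae_vector_derivative:
  "primitive f F \<Longrightarrow> AE x in lebesgue. (F has_vector_derivative f x) (at x)"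
  by (intro indefinite_integral_ae_vector_derivative primitive_has_integral)

lemma locally_abs_cont_primitive:
  assumes F: "locally_abs_cont F" and deriv: "AE x in lebesgue. (F has_vector_derivative f x) (at x)"
    and f: "\<And>a b. f absolutely_integrable_on {a..b}"
  shows "primitive f F"
proof (rule primitiveI[OF f])
  fix a b :: real
  assume "a \<le> b"
  show "(f has_integral (F b - F a)) {a..b}"
  proof (cases "a = b")
    case False
    show ?thesis
    proof (rule abs_cont_on_has_integral[OF \<open>a \<le> b\<close>])
      show "abs_cont_on a b F" using F False \<open>a \<le> b\<close> by (auto simp: locally_abs_cont_def)
      show "AE x in lebesgue. x \<in> {a..b} \<longrightarrow> (F has_vector_derivative f x) (at x within {a..b})"
        using deriv by eventually_elim (auto intro: has_vector_derivative_at_within)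
    qed
  qed auto
qed

lemma primitive_continuous:
  assumes "primitive f F" shows "continuous_on S F"
proof -
  have "isCont F x" for x
  proof -
    have "continuous_on {x - 1..x + 1} (\<lambda>y. F (x - 1) + integral {x - 1..y} f)"
      using primitive_absolutely_integrable[OF assms]
      by (intro continuous_intros indefinite_integral_continuous_1) (simp add: absolutely_integrable_on_def)
    moreover have "F (x - 1) + integral {x - 1..y} f = F y" if "y \<in> {x - 1..x + 1}" for y
      using primitive_integral[OF assms, of "x - 1" y] that by simp
    ultimately have "continuous_on {x - 1..x + 1} F" by (rule continuous_on_eq)
    then show ?thesis by (rule continuous_on_interior) (simp add: interior_atLeastAtMost_real)
  qed
  then show ?thesis by (simp add: continuous_at_imp_continuous_on)
qed

lemma primitive_add:
  assumes "primitive f F" "primitive g G"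
  shows "primitive (\<lambda>x. f x + g x) (\<lambda>x. F x + G x)"
proof (rule primitiveI)
  fix a b :: real
  assume "a \<le> b"
  show "(\<lambda>x. f x + g x) absolutely_integrable_on {a..b}"
    by (intro set_integral_add(1) assms[THEN primitive_absolutely_integrable])
  show "((\<lambda>x. f x + g x) has_integral (F b + G b - (F a + G a))) {a..b}"
    using has_integral_add[OF assms[THEN primitive_has_integral, OF \<open>a \<le> b\<close>]]
    by (simp add: algebra_simps)
qed

lemma primitive_diff:
  assumes "primitive f F" "primitive g G"
  shows "primitive (\<lambda>x. f x - g x) (\<lambda>x. F x - G x)"
proof (rule primitiveI)
  fix a b :: real
  assume "a \<le> b"
  show "(\<lambda>x. f x - g x) absolutely_integrable_on {a..b}"
    by (intro set_integral_diff(1) assms[THEN primitive_absolutely_integrable])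
  show "((\<lambda>x. f x - g x) has_integral (F b - G b - (F a - G a))) {a..b}"
    using has_integral_diff[OF assms[THEN primitive_has_integral, OF \<open>a \<le> b\<close>]]
    by (simp add: algebra_simps)
qed

lemma primitive_const: "primitive (\<lambda>_. 0) (\<lambda>_. c)"
  by (intro primitiveI) auto

lemma absolutely_integrable_continuous_mult:
  fixes f G :: "real \<Rightarrow> 'a::{euclidean_space, real_normed_algebra}"
  assumes "f absolutely_integrable_on {a..b}" "continuous_on {a..b} G"
  shows "(\<lambda>x. G x * f x) absolutely_integrable_on {a..b}" "(\<lambda>x. f x * G x) absolutely_integrable_on {a..b}"
proof -
  have G: "G \<in> borel_measurable (lebesgue_on {a..b})"
    using assms(2) by (intro continuous_imp_measurable_on_sets_lebesgue) auto
  have bG: "bounded (G ` {a..b})"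
    using compact_continuous_image[OF assms(2)] compact_imp_bounded by blast
  show "(\<lambda>x. G x * f x) absolutely_integrable_on {a..b}"
    by (rule absolutely_integrable_bounded_measurable_product[OF bilinear_times G _ bG assms(1)]) auto
  have "bilinear (\<lambda>x y::'a. y * x)"
    unfolding bilinear_def using bilinear_times by (auto simp: bilinear_def)
  from absolutely_integrable_bounded_measurable_product[OF this G _ bG assms(1)]
  show "(\<lambda>x. f x * G x) absolutely_integrable_on {a..b}" by auto
qed

lemma continuous_on_Icc_bounded:
  fixes F :: "real \<Rightarrow> 'a::real_normed_vector"
  assumes "continuous_on {a..b} F"
  shows "\<exists>B. \<forall>x\<in>{a..b}. norm (F x) \<le> B"
  using compact_imp_bounded[OF compact_continuous_image[OF assms compact_Icc]]
  unfolding bounded_iff ball_simps .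

text \<open>Integration by parts: the product is absolutely continuous, its derivative exists almost
  everywhere by the pointwise product rule, and the fundamental theorem for absolutely continuous
  functions leads back to the integral.\<close>

lemma primitive_mult:
  fixes f F g G :: "real \<Rightarrow> 'a::{euclidean_space, real_normed_algebra}"
  assumes F: "primitive f F" and G: "primitive g G"
  shows "primitive (\<lambda>x. F x * g x + f x * G x) (\<lambda>x. F x * G x)"
proof (rule locally_abs_cont_primitive)
  show "locally_abs_cont (\<lambda>x. F x * G x)"
    unfolding locally_abs_cont_def
  proof (intro allI impI)
    fix a b :: real
    assume "a < b"
    obtain B1 where B1: "\<And>x. x \<in> {a..b} \<Longrightarrow> norm (F x) \<le> B1"
      using continuous_on_Icc_bounded[OF primitive_continuous[OF F]] by blast
    obtain B2 where B2: "\<And>x. x \<in> {a..b} \<Longrightarrow> norm (G x) \<le> B2"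
      using continuous_on_Icc_bounded[OF primitive_continuous[OF G]] by blast
    show "abs_cont_on a b (\<lambda>x. F x * G x)"
    proof (rule abs_cont_on_mult)
      show "abs_cont_on a b F" "abs_cont_on a b G"
        using primitive_locally_abs_cont[OF F] primitive_locally_abs_cont[OF G] \<open>a < b\<close>
        by (auto simp: locally_abs_cont_def)
      show "norm (F x) \<le> max B1 B2" "norm (G x) \<le> max B1 B2" if "x \<in> {a..b}" for x
        using B1[OF that] B2[OF that] by auto
    qed
  qed
  show "AE x in lebesgue. ((\<lambda>x. F x * G x) has_vector_derivative F x * g x + f x * G x) (at x)"
    using primitive_ae_vector_derivative[OF F] primitive_ae_vector_derivative[OF G]
    by eventually_elim (rule has_vector_derivative_mult)
  show "(\<lambda>x. F x * g x + f x * G x) absolutely_integrable_on {a..b}" for a b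
    by (rule set_integral_add(1)[OF
          absolutely_integrable_continuous_mult(1)[OF primitive_absolutely_integrable[OF G] primitive_continuous[OF F]]
          absolutely_integrable_continuous_mult(2)[OF primitive_absolutely_integrable[OF F] primitive_continuous[OF G]]])
qed

lemma primitive_vector_derivative:
  assumes "\<And>x. (F has_vector_derivative f x) (at x)" and f: "continuous_on UNIV f"
  shows "primitive f F"
proof (rule primitiveI)
  fix a b :: real
  assume "a \<le> b"
  show "f absolutely_integrable_on {a..b}"
    by (intro absolutely_integrable_continuous_real continuous_on_subset[OF f]) simp
  show "(f has_integral (F b - F a)) {a..b}"
    by (rule fundamental_theorem_of_calculus[OF \<open>a \<le> b\<close>]) (rule has_vector_derivative_at_within[OF assms(1)])
qed

lemma primitive_cmult:
  fixes c :: "'a::{euclidean_space, real_normed_algebra}"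
  assumes "primitive f F" shows "primitive (\<lambda>x. c * f x) (\<lambda>x. c * F x)"
  using primitive_mult[OF primitive_const[of c] assms] by simp

text \<open>A continuous density is a derivative at every point. The definition of a solution
  demands this of \<open>y\<close>, whereas \<open>y'\<close> need only be differentiable almost
  everywhere.\<close>

lemma primitive_has_vector_derivative:
  assumes F: "primitive f F" and f: "continuous_on UNIV f"
  shows "(F has_vector_derivative f x) (at x)"
proof -
  have "((\<lambda>y. F (x - 1) + integral {x - 1..y} f) has_vector_derivative f x) (at x within {x - 1..x + 1})"
    using integral_has_vector_derivative[OF continuous_on_subset[OF f], of "x - 1" "x + 1" x]
    by (auto intro!: derivative_eq_intros)
  then have "(F has_vector_derivative f x) (at x within {x - 1..x + 1})"
    by (rule has_vector_derivative_transform[rotated 2]) (use primitive_integral[OF F, of "x - 1"] in auto)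
  then show ?thesis
    by (simp add: at_within_Icc_at)
qed

lemma primitive_zero_constant: "primitive (\<lambda>_. 0) F \<Longrightarrow> F x = F y"
  using primitive_integral[of "\<lambda>_. 0" F x y] primitive_integral[of "\<lambda>_. 0" F y x]
  by (cases "x \<le> y") auto

lemma primitive_unique:
  assumes "primitive f F" "primitive g F"
  shows "AE x in lebesgue. f x = g x"
  using assms[THEN primitive_ae_vector_derivative]
  by eventually_elim (rule vector_derivative_unique_at)

lemma primitive_cong:
  assumes "primitive f F" "\<And>x. f x = g x" "\<And>x. F x = G x"
  shows "primitive g G"
proof -
  have "f = g" "F = G" using assms(2,3) by (simp_all add: fun_eq_iff)
  with assms(1) show ?thesis by simp
qed

lemma primitive_reflect:
  fixes f F :: "real \<Rightarrow> 'a::euclidean_space"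
  assumes "primitive f F"
  shows "primitive (\<lambda>x. - f (- x)) (\<lambda>x. F (- x))"
proof (rule primitiveI)
  fix a b :: real
  assume "a \<le> b"
  have "(f has_integral (F (- a) - F (- b))) {- b..- a}"
    using \<open>a \<le> b\<close> by (intro primitive_has_integral[OF assms]) auto
  then have "((\<lambda>x. f (- x)) has_integral (F (- a) - F (- b))) {a..b}"
    using has_integral_reflect_real[where f=f and i="F (- a) - F (- b)" and a="- b" and b="- a"] by simp
  then have "((\<lambda>x. - f (- x)) has_integral - (F (- a) - F (- b))) {a..b}"
    by (rule has_integral_neg)
  then show "((\<lambda>x. - f (- x)) has_integral (F (- b) - F (- a))) {a..b}"
    by simp
  have "(\<lambda>x. f (- x)) absolutely_integrable_on {a..b}"
    using absolutely_integrable_reflect_real[where f=f and a="- b" and b="- a"]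
      primitive_absolutely_integrable[OF assms, of "- b" "- a"] by simp
  then have "(\<lambda>x. (- 1) *\<^sub>R f (- x)) absolutely_integrable_on {a..b}"
    by (rule absolutely_integrable_scaleR_left)
  then show "(\<lambda>x. - f (- x)) absolutely_integrable_on {a..b}" by simp
qed

section \<open>Integrals depending holomorphically on a parameter\<close>

text \<open>Identifies series that arise by integrating term by term with Taylor series.\<close>

lemma power_series_higher_deriv:
  fixes f :: "complex \<Rightarrow> complex"
  assumes "0 < r" and sums: "\<And>w. w \<in> ball 0 r \<Longrightarrow> (\<lambda>n. a n * w ^ n) sums f w"
  shows "(deriv ^^ n) f 0 / fact n = a n"
proof -
  have "f has_fps_expansion Abs_fps a"
    unfolding has_fps_expansion_def
  proof
    have "conv_radius a \<ge> norm (of_real (r / 2) :: complex)"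
    proof (rule conv_radius_geI)
      show "summable (\<lambda>n. a n * (of_real (r / 2)) ^ n)"
        using sums[of "of_real (r / 2)"] \<open>0 < r\<close> by (auto simp: sums_iff)
    qed
    moreover have "0 < ereal (norm (of_real (r / 2) :: complex))"
      using \<open>0 < r\<close> by simp
    ultimately have "0 < conv_radius a" by (rule less_le_trans[rotated])
    then show "0 < fps_conv_radius (Abs_fps a)"
      by (simp add: fps_conv_radius_def)
    have "eventually (\<lambda>w. w \<in> ball 0 r) (nhds (0::complex))"
      using \<open>0 < r\<close> by (intro eventually_nhds_in_open) auto
    then show "\<forall>\<^sub>F w in nhds 0. eval_fps (Abs_fps a) w = f w"
      by eventually_elim (use sums in \<open>auto simp: eval_fps_def sums_iff\<close>)
  qed
  then show ?thesis using fps_nth_fps_expansion[of f "Abs_fps a" n] by simp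
qed

text \<open>One integrable function dominates the family for all parameters; by Cauchy's inequality
  it then controls every parameter derivative, which justifies integrating Taylor series term by
  term.\<close>

locale holomorphic_family =
  fixes M :: "'b measure" and g :: "complex \<Rightarrow> 'b \<Rightarrow> complex" and S :: "complex set" and h :: "'b \<Rightarrow> real"
  assumes open_S: "open S"
    and hol: "\<And>t. t \<in> space M \<Longrightarrow> (\<lambda>w. g w t) holomorphic_on S"
    and meas: "\<And>w. w \<in> S \<Longrightarrow> g w \<in> borel_measurable M"
    and bound: "\<And>w t. w \<in> S \<Longrightarrow> t \<in> space M \<Longrightarrow> norm (g w t) \<le> h t"
    and h: "integrable M h"
begin

lemma measurable_higher_deriv:
  "w \<in> S \<Longrightarrow> (\<lambda>t. (deriv ^^ n) (\<lambda>w. g w t) w) \<in> borel_measurable M"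
proof (induction n arbitrary: w)
  case 0
  then show ?case using meas by simp
next
  case (Suc n)
  obtain e where "e > 0" and e: "ball w e \<subseteq> S"
    using open_S Suc.prems by (meson open_contains_ball)
  \<comment> \<open>The next derivative is a limit of difference quotients along one sequence, hence
    measurable in \<open>t\<close>; the factor \<open>e / 2\<close> keeps \<open>w + s m\<close>
    inside the ball of radius \<open>e\<close>.\<close>
  define s :: "nat \<Rightarrow> complex" where "s m = of_real (e / 2 * inverse (real (Suc m)))" for m
  have s0: "s m \<noteq> 0" for m using \<open>e > 0\<close> by (simp add: s_def del: of_nat_Suc)
  have "s \<longlonglongrightarrow> of_real (e / 2 * 0)"
    unfolding s_def by (intro tendsto_intros LIMSEQ_inverse_real_of_nat)
  then have lim: "filterlim s (at 0) sequentially"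
    using s0 by (intro filterlim_atI) auto
  have sS: "w + s m \<in> S" for m
  proof -
    have "inverse (real (Suc m)) \<le> 1" by (rule inverse_le_1_iff[THEN iffD2]) simp
    then have "e / 2 * inverse (real (Suc m)) \<le> e / 2 * 1"
      using \<open>e > 0\<close> by (intro mult_left_mono) auto
    then have "e / 2 * inverse (real (Suc m)) < e" using \<open>e > 0\<close> by linarith
    then have "w + s m \<in> ball w e"
      using \<open>e > 0\<close> by (simp add: s_def dist_norm norm_mult norm_divide norm_inverse del: of_nat_Suc of_real_mult of_real_inverse)
    then show ?thesis using e by blast
  qed
  show ?case
  proof (rule borel_measurable_LIMSEQ_metric)
    show "(\<lambda>t. ((deriv ^^ n) (\<lambda>w. g w t) (w + s m) - (deriv ^^ n) (\<lambda>w. g w t) w) / s m) \<in> borel_measurable M" for m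
      using Suc.IH[OF sS[of m]] Suc.IH[OF Suc.prems] by measurable
    fix t assume t: "t \<in> space M"
    have "((deriv ^^ n) (\<lambda>w. g w t) has_field_derivative (deriv ^^ Suc n) (\<lambda>w. g w t) w) (at w)"
      using holomorphic_derivI[OF holomorphic_higher_deriv[OF hol[OF t] open_S] open_S Suc.prems] by simp
    then show "(\<lambda>m. ((deriv ^^ n) (\<lambda>w. g w t) (w + s m) - (deriv ^^ n) (\<lambda>w. g w t) w) / s m)
        \<longlonglongrightarrow> (deriv ^^ Suc n) (\<lambda>w. g w t) w"
      unfolding DERIV_def by (rule filterlim_compose[OF _ lim])
  qed
qed

lemma norm_higher_deriv_le:
  assumes "t \<in> space M" "0 < r" "cball z r \<subseteq> S"
  shows "norm ((deriv ^^ n) (\<lambda>w. g w t) z) \<le> fact n * h t / r ^ n"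
proof (rule Cauchy_inequality)
  show "(\<lambda>w. g w t) holomorphic_on ball z r"
    by (rule holomorphic_on_subset[OF hol[OF assms(1)]]) (use assms(3) ball_subset_cball in blast)
  show "continuous_on (cball z r) (\<lambda>w. g w t)"
    by (rule continuous_on_subset[OF holomorphic_on_imp_continuous_on[OF hol[OF assms(1)]] assms(3)])
  show "norm (g x t) \<le> h t" if "norm (z - x) = r" for x
    by (rule bound[OF subsetD[OF assms(3)] assms(1)]) (use that in \<open>simp add: dist_norm\<close>)
qed (rule assms(2))

lemma integrable_higher_deriv:
  assumes "z \<in> S" shows "integrable M (\<lambda>t. (deriv ^^ n) (\<lambda>w. g w t) z)"
proof -
  obtain e where e: "e > 0" "cball z e \<subseteq> S"
    using open_S assms by (meson open_contains_cball)
  show ?thesis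
  proof (rule Bochner_Integration.integrable_bound)
    show "integrable M (\<lambda>t. fact n * h t / e ^ n)" using h by simp
    show "AE t in M. norm ((deriv ^^ n) (\<lambda>w. g w t) z) \<le> norm (fact n * h t / e ^ n)"
      by (intro AE_I2 order_trans[OF norm_higher_deriv_le[OF _ e]]) (simp_all only: real_norm_def abs_ge_self)
  qed (rule measurable_higher_deriv[OF assms])
qed

lemma integral_taylor_sums:
  assumes sub: "ball z r \<subseteq> S" and w: "w \<in> ball z r"
  shows "(\<lambda>n. (\<integral>t. (deriv ^^ n) (\<lambda>w. g w t) z \<partial>M) / fact n * (w - z) ^ n) sums (\<integral>t. g w t \<partial>M)"
proof -
  \<comment> \<open>A radius strictly between \<open>norm (w - z)\<close> and \<open>r\<close>:
    Cauchy's inequality on the disc of this radius dominates the terms by a geometric series of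
    ratio \<open>q < 1\<close>.\<close>
  define r' where "r' = (norm (w - z) + r) / 2"
  have "norm (w - z) < r" using w by (simp add: dist_norm norm_minus_commute)
  then have r': "0 < r'" "norm (w - z) < r'" "r' < r"
    using norm_ge_zero[of "w - z"] by (simp_all add: r'_def del: norm_ge_zero)
  have "cball z r' \<subseteq> ball z r" using r' by auto
  then have cb: "cball z r' \<subseteq> S" using sub by blast
  then have z: "z \<in> S" using r' by auto
  define u where "u n t = (deriv ^^ n) (\<lambda>w. g w t) z / fact n * (w - z) ^ n" for n t
  have ui: "integrable M (u n)" for n
    unfolding u_def using integrable_higher_deriv[OF z, of n] by simp
  define q where "q = norm (w - z) / r'"
  have q: "0 \<le> q" "q < 1" using r' by (auto simp: q_def)
  have sq: "summable (\<lambda>n. C * q ^ n)" for C :: real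
    using q by (intro summable_mult summable_geometric) auto
  have ub: "norm (u n t) \<le> h t * q ^ n" if t: "t \<in> space M" for n t
  proof -
    have "norm (u n t) = norm ((deriv ^^ n) (\<lambda>w. g w t) z) / fact n * norm (w - z) ^ n"
      by (simp add: u_def norm_mult norm_divide norm_power)
    also have "\<dots> \<le> (fact n * h t / r' ^ n) / fact n * norm (w - z) ^ n"
      by (intro mult_right_mono divide_right_mono norm_higher_deriv_le[OF t r'(1) cb]) auto
    also have "\<dots> = h t * q ^ n" by (simp add: q_def power_divide)
    finally show ?thesis .
  qed
  have "(\<lambda>n. integral\<^sup>L M (u n)) sums (\<integral>t. (\<Sum>n. u n t) \<partial>M)"
  proof (rule sums_integral[OF ui])
    show "AE t in M. summable (\<lambda>n. norm (u n t))"
    proof (rule AE_I2)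
      fix t assume "t \<in> space M"
      show "summable (\<lambda>n. norm (u n t))"
        by (rule summable_comparison_test'[OF sq, of 0]) (use ub[OF \<open>t \<in> space M\<close>] in simp)
    qed
    have "norm (\<integral>t. norm (u n t) \<partial>M) \<le> integral\<^sup>L M h * q ^ n" for n
    proof -
      have "(\<integral>t. norm (u n t) \<partial>M) \<le> (\<integral>t. h t * q ^ n \<partial>M)"
        using h ui[of n] by (intro integral_mono ub) auto
      then show ?thesis by simp
    qed
    then show "summable (\<lambda>n. \<integral>t. norm (u n t) \<partial>M)"
      by (intro summable_comparison_test'[OF sq, of 0])
  qed
  also have "(\<integral>t. (\<Sum>n. u n t) \<partial>M) = (\<integral>t. g w t \<partial>M)"
  proof (rule Bochner_Integration.integral_cong[OF refl])
    fix t assume "t \<in> space M"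
    show "(\<Sum>n. u n t) = g w t"
      using holomorphic_power_series[OF holomorphic_on_subset[OF hol[OF \<open>t \<in> space M\<close>] sub] w]
      by (simp add: u_def sums_iff)
  qed
  finally show ?thesis by (simp add: u_def)
qed

lemma holomorphic_on_integral: "(\<lambda>w. \<integral>t. g w t \<partial>M) holomorphic_on S"
proof (rule holomorphic_onI)
  fix z assume z: "z \<in> S"
  then obtain e where e: "e > 0" "ball z e \<subseteq> S"
    using open_S by (meson open_contains_ball)
  have "(\<lambda>w. \<integral>t. g w t \<partial>M) holomorphic_on ball z e"
    by (rule power_series_holomorphic[OF integral_taylor_sums[OF e(2)]])
  then have "(\<lambda>w. \<integral>t. g w t \<partial>M) field_differentiable at z"
    using e by (intro holomorphic_on_imp_differentiable_at[of _ "ball z e"]) auto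
  then show "(\<lambda>w. \<integral>t. g w t \<partial>M) field_differentiable at z within S"
    by (rule field_differentiable_at_within)
qed

end

lemma continuous_on_integral_dominated:
  fixes g :: "'a::{metric_space, first_countable_topology} \<Rightarrow> 'b \<Rightarrow> complex"
  assumes cont: "\<And>t. t \<in> space M \<Longrightarrow> continuous_on S (\<lambda>w. g w t)"
    and meas: "\<And>w. w \<in> S \<Longrightarrow> g w \<in> borel_measurable M"
    and bound: "\<And>w t. w \<in> S \<Longrightarrow> t \<in> space M \<Longrightarrow> norm (g w t) \<le> h t"
    and h: "integrable M h"
  shows "continuous_on S (\<lambda>w. \<integral>t. g w t \<partial>M)"
  unfolding continuous_on_sequentially
proof (intro allI ballI impI)
  fix a :: "nat \<Rightarrow> 'a" and x
  assume "x \<in> S" and a: "(\<forall>n. a n \<in> S) \<and> a \<longlonglongrightarrow> x"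
  show "((\<lambda>w. \<integral>t. g w t \<partial>M) \<circ> a) \<longlonglongrightarrow> (\<integral>t. g x t \<partial>M)"
    unfolding o_def
  proof (rule integral_dominated_convergence[OF _ _ h])
    show "AE t in M. (\<lambda>n. g (a n) t) \<longlonglongrightarrow> g x t"
    proof (rule AE_I2)
      fix t assume "t \<in> space M"
      from cont[OF this] \<open>x \<in> S\<close> a show "(\<lambda>n. g (a n) t) \<longlonglongrightarrow> g x t"
        unfolding continuous_on_sequentially o_def by blast
    qed
    show "AE t in M. norm (g (a n) t) \<le> h t" for n
      using a bound by (intro AE_I2) auto
  qed (use meas a \<open>x \<in> S\<close> in auto)
qed

text \<open>An equation in the real variable that holds for every \<open>w\<close> holds order by
  order in \<open>w\<close>: integrate the Taylor series of \<open>g\<close> term by term and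
  compare it with that of \<open>G\<close>. The majorant \<open>h\<close> is uniform in
  \<open>w\<close>.\<close>

lemma primitive_taylor_coeff:
  fixes g G :: "complex \<Rightarrow> real \<Rightarrow> complex"
  assumes "0 < r"
    and holg: "\<And>t. (\<lambda>w. g w t) holomorphic_on ball 0 r"
    and holG: "\<And>t. (\<lambda>w. G w t) holomorphic_on ball 0 r"
    and prim: "\<And>w. w \<in> ball 0 r \<Longrightarrow> primitive (g w) (G w)"
    and bound: "\<And>w t. w \<in> ball 0 r \<Longrightarrow> norm (g w t) \<le> h t"
    and h: "\<And>a b. h absolutely_integrable_on {a..b}"
  shows "primitive (\<lambda>t. (deriv ^^ n) (\<lambda>w. g w t) 0 / fact n) (\<lambda>x. (deriv ^^ n) (\<lambda>w. G w x) 0 / fact n)"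
proof -
  have main: "(\<lambda>t. (deriv ^^ n) (\<lambda>w. g w t) 0 / fact n) absolutely_integrable_on {a..b} \<and>
      ((\<lambda>t. (deriv ^^ n) (\<lambda>w. g w t) 0 / fact n) has_integral
        ((deriv ^^ n) (\<lambda>w. G w b) 0 / fact n - (deriv ^^ n) (\<lambda>w. G w a) 0 / fact n)) {a..b}"
    if "a \<le> b" for a b
  proof -
    let ?M = "lebesgue_on {a..b}"
    have ig: "integrable ?M (g w)" if "w \<in> ball 0 r" for w
      by (rule absolutely_integrable_imp_integrable[OF primitive_absolutely_integrable[OF prim[OF that]]]) auto
    interpret holomorphic_family ?M g "ball 0 r" h
    proof
      show "integrable ?M h" by (rule absolutely_integrable_imp_integrable[OF h]) auto
      show "g w \<in> borel_measurable ?M" if "w \<in> ball 0 r" for w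
        using ig[OF that] by (rule borel_measurable_integrable)
    qed (use holg bound in auto)
    let ?D = "\<lambda>t. (deriv ^^ n) (\<lambda>w. g w t) 0 / fact n"
    have z: "(0::complex) \<in> ball 0 r" using \<open>0 < r\<close> by simp
    have iD: "integrable ?M ?D" using integrable_higher_deriv[OF z, of n] by simp
    have aD: "?D absolutely_integrable_on {a..b}"
      using iD by (simp add: set_integrable_def integrable_restrict_space)
    have "(deriv ^^ n) (\<lambda>w. G w b - G w a) 0 / fact n = (\<integral>t. (deriv ^^ n) (\<lambda>w. g w t) 0 \<partial>?M) / fact n"
    proof (rule power_series_higher_deriv[OF \<open>0 < r\<close>])
      fix w :: complex assume w: "w \<in> ball 0 r"
      have "(\<integral>t. g w t \<partial>?M) = integral {a..b} (g w)"
        by (rule lebesgue_integral_eq_integral[OF ig[OF w]]) auto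
      also have "\<dots> = G w b - G w a"
        by (rule primitive_integral[OF prim[OF w] \<open>a \<le> b\<close>])
      finally show "(\<lambda>n. (\<integral>t. (deriv ^^ n) (\<lambda>w. g w t) 0 \<partial>?M) / fact n * w ^ n) sums (G w b - G w a)"
        using integral_taylor_sums[OF subset_refl w] by simp
    qed
    also have "(deriv ^^ n) (\<lambda>w. G w b - G w a) 0 = (deriv ^^ n) (\<lambda>w. G w b) 0 - (deriv ^^ n) (\<lambda>w. G w a) 0"
      by (rule higher_deriv_diff[OF holG holG _ z]) auto
    also have "(\<integral>t. (deriv ^^ n) (\<lambda>w. g w t) 0 \<partial>?M) / fact n = (\<integral>t. ?D t \<partial>?M)" by simp
    also have "\<dots> = integral {a..b} ?D"
      by (rule lebesgue_integral_eq_integral[OF iD]) auto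
    finally have "integral {a..b} ?D = (deriv ^^ n) (\<lambda>w. G w b) 0 / fact n - (deriv ^^ n) (\<lambda>w. G w a) 0 / fact n"
      by (simp add: diff_divide_distrib)
    moreover have "?D integrable_on {a..b}" using aD by (simp add: absolutely_integrable_on_def)
    ultimately show ?thesis using aD by (simp add: has_integral_iff)
  qed
  show ?thesis unfolding primitive_def using main by blast
qed

section \<open>Jost solutions\<close>

text \<open>The region in which the Neumann series will converge. It contains the real
  \<open>k\<close> with \<open>K \<le> |k|\<close>, for which the reflection coefficients are
  compared.\<close>

definition upper_closed :: "real \<Rightarrow> complex set" where
  "upper_closed K = {k. 0 \<le> Im k \<and> K \<le> norm k}"

definition upper_open :: "real \<Rightarrow> complex set" where
  "upper_open K = {k. 0 < Im k \<and> K < norm k}"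

lemma upper_open_subset: "upper_open K \<subseteq> upper_closed K"
  by (auto simp: upper_open_def upper_closed_def)

lemma open_upper_open: "open (upper_open K)"
  unfolding upper_open_def by (intro open_Collect_conj open_Collect_less continuous_intros)

lemma continuous_measurable_lebesgue:
  "continuous_on UNIV f \<Longrightarrow> f \<in> borel_measurable (lebesgue :: real measure)"
  using continuous_imp_measurable_on_sets_lebesgue[of UNIV f] by (simp add: lebesgue_on_UNIV_eq)

lemma ae_neq_lebesgue: "AE t in lebesgue. t \<noteq> (x::real)"
proof -
  have "{x} \<in> null_sets lebesgue" using negligible_sing negligible_iff_null_sets by blast
  then show ?thesis by (rule AE_I') auto
qed

section \<open>Integrals over half lines and integral operators depending on the spectral
  parameter\<close>

lemma primitive_integral_atMost:
  fixes f :: "real \<Rightarrow> 'a::euclidean_space"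
  assumes f: "\<And>x. f absolutely_integrable_on {..x}"
  shows "primitive f (\<lambda>x. LINT t:{..x}|lebesgue. f t)"
proof (rule primitiveI)
  fix a b :: real
  assume "a \<le> b"
  show ab: "f absolutely_integrable_on {a..b}"
    by (rule set_integrable_subset[OF f[of b]]) auto
  have eq: "(LINT t:{..x}|lebesgue. f t) = integral {..x} f" for x
    by (rule set_lebesgue_integral_eq_integral[OF f])
  have int: "f integrable_on {a..b}" "f integrable_on {..a}"
    using ab f by (auto intro: set_lebesgue_integral_eq_integral(1))
  have "(f has_integral (integral {..a} f + integral {a..b} f)) ({..a} \<union> {a..b})"
  proof (rule has_integral_Un)
    have "{..a} \<inter> {a..b} \<subseteq> {a}" by auto
    then show "negligible ({..a} \<inter> {a..b})" by (rule negligible_subset[OF negligible_sing])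
  qed (use int in \<open>auto intro: integrable_integral\<close>)
  moreover have "{..a} \<union> {a..b} = {..b}" using \<open>a \<le> b\<close> by auto
  ultimately have "integral {..b} f = integral {..a} f + integral {a..b} f"
    by (simp add: integral_unique)
  then show "(f has_integral (LINT t:{..b}|lebesgue. f t) - (LINT t:{..a}|lebesgue. f t)) {a..b}"
    using integrable_integral[OF int(1)] by (simp add: eq)
qed

lemma tendsto_integral_atMost_at_bot:
  fixes f :: "real \<Rightarrow> real"
  assumes "integrable lebesgue f"
  shows "((\<lambda>x. LINT t:{..x}|lebesgue. f t) \<longlongrightarrow> 0) at_bot"
proof -
  have "((\<lambda>x. \<integral>t. indicator {..- x} t *\<^sub>R f t \<partial>lebesgue) \<longlongrightarrow> (\<integral>t. 0 \<partial>(lebesgue :: real measure))) at_top"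
  proof (rule integral_dominated_convergence_at_top)
    show "integrable lebesgue (\<lambda>t. norm (f t))" using assms by simp
    show "(\<lambda>t. indicator {..- x} t *\<^sub>R f t) \<in> borel_measurable lebesgue" for x
      using assms by (intro borel_measurable_scaleR borel_measurable_indicator borel_measurable_integrable) auto
    show "AE t in lebesgue. ((\<lambda>x. indicator {..- x} t *\<^sub>R f t) \<longlongrightarrow> 0) at_top"
    proof (rule AE_I2)
      fix t :: real
      have "eventually (\<lambda>x. - t < x) at_top" by (rule eventually_gt_at_top)
      then show "((\<lambda>x. indicator {..- x} t *\<^sub>R f t) \<longlongrightarrow> 0) at_top"
        by (intro tendsto_eventually, elim eventually_mono) (simp add: indicator_def)
    qed
  qed (auto simp: indicator_def)
  then show ?thesis
    unfolding filterlim_at_bot_mirror set_lebesgue_integral_def by simp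
qed

text \<open>The properties preserved by the Volterra iteration: holomorphy inside the region and
  continuity up to the real axis.\<close>

definition upper_family :: "real \<Rightarrow> real \<Rightarrow> (complex \<Rightarrow> real \<Rightarrow> complex) \<Rightarrow> bool" where
  "upper_family K B w \<longleftrightarrow>
     (\<forall>k\<in>upper_closed K. w k \<in> borel_measurable lebesgue \<and> (\<forall>t. norm (w k t) \<le> B)) \<and>
     (\<forall>t. continuous_on (upper_closed K) (\<lambda>k. w k t) \<and> (\<lambda>k. w k t) holomorphic_on upper_open K)"

text \<open>One step of an iteration: multiply by \<open>V\<close> and by a kernel bounded by
  \<open>C\<close> for \<open>t \<le> x\<close>, then integrate. It serves for the Volterra kernel,
  for the exponential that is its derivative in \<open>x\<close>, and for the constant 1.\<close>

locale family_integral =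
  fixes V :: "real \<Rightarrow> real" and K B C :: real and w \<phi> :: "complex \<Rightarrow> real \<Rightarrow> complex" and x :: real
  assumes V: "integrable lebesgue V"
    and w: "upper_family K B w"
    and \<phi>m: "\<And>k. k \<in> upper_closed K \<Longrightarrow> continuous_on UNIV (\<phi> k)"
    and \<phi>b: "\<And>k t. k \<in> upper_closed K \<Longrightarrow> t \<le> x \<Longrightarrow> norm (\<phi> k t) \<le> C"
    and \<phi>c: "\<And>t. continuous_on (upper_closed K) (\<lambda>k. \<phi> k t)"
    and \<phi>h: "\<And>t. (\<lambda>k. \<phi> k t) holomorphic_on upper_open K"
    and C: "0 \<le> C" and B: "0 \<le> B"
begin

definition "G k t = indicator {..x} t *\<^sub>R (\<phi> k t * (of_real (V t) * w k t))"

lemma meas: "k \<in> upper_closed K \<Longrightarrow> G k \<in> borel_measurable lebesgue"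
proof -
  assume k: "k \<in> upper_closed K"
  have [measurable]: "V \<in> borel_measurable lebesgue" "w k \<in> borel_measurable lebesgue" "\<phi> k \<in> borel_measurable lebesgue"
    "(\<lambda>t. indicator {..x} t :: real) \<in> borel_measurable lebesgue"
    using V w k \<phi>m[OF k] by (auto simp: upper_family_def intro: continuous_measurable_lebesgue borel_measurable_indicator)
  show ?thesis unfolding G_def by measurable
qed

lemma G_bound: "k \<in> upper_closed K \<Longrightarrow> norm (G k t) \<le> indicator {..x} t * (C * B * \<bar>V t\<bar>)"
proof -
  assume k: "k \<in> upper_closed K"
  have "norm (\<phi> k t * (of_real (V t) * w k t)) \<le> C * (\<bar>V t\<bar> * B)" if "t \<le> x"
    unfolding norm_mult norm_of_real
    using \<phi>b[OF k that] w k C B by (intro mult_mono) (auto simp: upper_family_def)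
  then show ?thesis by (auto simp: G_def indicator_def mult_ac)
qed

lemma indV: "integrable lebesgue (\<lambda>t. indicator {..x} t * (C * B * \<bar>V t\<bar>))"
proof -
  have "integrable lebesgue (\<lambda>t. indicator {..x} t *\<^sub>R (C * B * \<bar>V t\<bar>))"
    by (rule integrable_mult_indicator) (use V in auto)
  then show ?thesis by simp
qed

lemma integrable_G: "k \<in> upper_closed K \<Longrightarrow> integrable lebesgue (G k)"
  by (rule Bochner_Integration.integrable_bound[OF indV meas])
     (auto intro!: AE_I2 order_trans[OF G_bound])

lemma absolutely_integrable:
  "k \<in> upper_closed K \<Longrightarrow> (\<lambda>t. \<phi> k t * (of_real (V t) * w k t)) absolutely_integrable_on {..x}"
  using integrable_G unfolding set_integrable_def G_def[abs_def] .

lemma norm_integral_le: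
  "k \<in> upper_closed K \<Longrightarrow> norm (LINT t:{..x}|lebesgue. \<phi> k t * (of_real (V t) * w k t))
     \<le> C * B * (LINT t:{..x}|lebesgue. \<bar>V t\<bar>)"
proof -
  assume k: "k \<in> upper_closed K"
  have "norm (\<integral>t. G k t \<partial>lebesgue) \<le> (\<integral>t. indicator {..x} t * (C * B * \<bar>V t\<bar>) \<partial>lebesgue)"
    by (rule Bochner_Integration.integral_norm_bound_integral[OF integrable_G[OF k] indV]) (rule G_bound[OF k])
  also have "\<dots> = (\<integral>t. (C * B) * (indicator {..x} t * \<bar>V t\<bar>) \<partial>lebesgue)" by (simp add: mult_ac)
  finally show ?thesis by (simp add: G_def set_lebesgue_integral_def)
qed

lemma continuous: "continuous_on (upper_closed K) (\<lambda>k. LINT t:{..x}|lebesgue. \<phi> k t * (of_real (V t) * w k t))"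
  unfolding set_lebesgue_integral_def G_def[symmetric]
proof (rule continuous_on_integral_dominated[OF _ meas G_bound indV])
  show "continuous_on (upper_closed K) (\<lambda>k. G k t)" for t
    unfolding G_def using w \<phi>c[of t] by (intro continuous_intros) (auto simp: upper_family_def)
qed

lemma holomorphic: "(\<lambda>k. LINT t:{..x}|lebesgue. \<phi> k t * (of_real (V t) * w k t)) holomorphic_on upper_open K"
proof -
  interpret holomorphic_family lebesgue G "upper_open K" "\<lambda>t. indicator {..x} t * (C * B * \<bar>V t\<bar>)"
  proof
    show "(\<lambda>k. G k t) holomorphic_on upper_open K" for t
      unfolding G_def scaleR_conv_of_real using w \<phi>h[of t]
      by (intro holomorphic_intros) (auto simp: upper_family_def)
    show "k \<in> upper_open K \<Longrightarrow> G k \<in> borel_measurable lebesgue" for k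
      using meas upper_open_subset by blast
    show "k \<in> upper_open K \<Longrightarrow> norm (G k t) \<le> indicator {..x} t * (C * B * \<bar>V t\<bar>)" for k t
      using G_bound upper_open_subset by blast
  qed (rule open_upper_open indV)+
  show ?thesis
    using holomorphic_on_integral unfolding set_lebesgue_integral_def G_def .
qed

end

text \<open>
  The kernel \<open>(exp (2 i k (x - t)) - 1) / (2 i k)\<close> is that of the Volterra equation for
  \<open>m = exp (i k x) f\<close>, where \<open>f\<close> is the Jost solution from the right.
\<close>

definition volterra_kernel :: "complex \<Rightarrow> real \<Rightarrow> real \<Rightarrow> complex" where
  "volterra_kernel k x t = (exp (2 * \<i> * k * of_real (x - t)) - 1) / (2 * \<i> * k)"

primrec neumann :: "(real \<Rightarrow> real) \<Rightarrow> nat \<Rightarrow> complex \<Rightarrow> real \<Rightarrow> complex" where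
  "neumann V 0 k x = 1"
| "neumann V (Suc n) k x = (LINT t:{..x}|lebesgue. volterra_kernel k x t * (of_real (V t) * neumann V n k t))"

definition jost_m :: "(real \<Rightarrow> real) \<Rightarrow> complex \<Rightarrow> real \<Rightarrow> complex" where
  "jost_m V k x = (\<Sum>n. neumann V n k x)"

text \<open>The derivative of \<open>jost_m\<close>: the kernel of the Volterra equation vanishes at
  \<open>t = x\<close>, so differentiating in \<open>x\<close> leaves only the integral with the
  differentiated kernel.\<close>

definition jost_m' :: "(real \<Rightarrow> real) \<Rightarrow> complex \<Rightarrow> real \<Rightarrow> complex" where
  "jost_m' V k x = (LINT t:{..x}|lebesgue. exp (2 * \<i> * k * of_real (x - t)) * (of_real (V t) * jost_m V k t))"

lemma norm_exp_upper_le: "0 \<le> Im k \<Longrightarrow> t \<le> x \<Longrightarrow> norm (exp (2 * \<i> * k * of_real (x - t))) \<le> 1"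
  by (simp add: mult_nonneg_nonneg)

text \<open>The exponential has modulus at most 1 in the upper half plane, so the numerator is at
  most 2. All decay in \<open>k\<close> originates here.\<close>

lemma norm_volterra_kernel_le:
  assumes "k \<in> upper_closed K" "0 < K" "t \<le> x"
  shows "norm (volterra_kernel k x t) \<le> 1 / norm k"
proof -
  have k: "0 \<le> Im k" "0 < norm k" using assms by (auto simp: upper_closed_def)
  have "norm (exp (2 * \<i> * k * of_real (x - t)) - 1) \<le> 1 + 1"
    by (rule order_trans[OF norm_triangle_ineq4]) (use norm_exp_upper_le[OF k(1) assms(3)] in simp)
  then show ?thesis
    using k by (simp add: volterra_kernel_def norm_divide norm_mult field_simps)
qed

text \<open>\<open>K\<close> is at least twice the integral of \<open>|V|\<close>, so that a Neumann
  step, whose kernel is bounded by \<open>1 / K\<close>, halves the bound.\<close>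

locale jost_setup =
  fixes V :: "real \<Rightarrow> real" and K :: real
  assumes V: "integrable lebesgue V" and K: "0 < K" "2 * (\<integral>t. \<bar>V t\<bar> \<partial>lebesgue) \<le> K"
begin

abbreviation "A \<equiv> \<integral>t. \<bar>V t\<bar> \<partial>lebesgue"

lemma A_nonneg: "0 \<le> A" by simp

lemma atMost_le_A: "(LINT t:{..x}|lebesgue. \<bar>V t\<bar>) \<le> A"
  unfolding set_lebesgue_integral_def
proof (rule integral_mono)
  show "integrable lebesgue (\<lambda>t. indicator {..x} t *\<^sub>R \<bar>V t\<bar>)"
    by (rule integrable_mult_indicator) (use V in auto)
qed (use V in \<open>auto simp: indicator_def\<close>)

lemma k_nz: "k \<in> upper_closed K \<Longrightarrow> k \<noteq> 0" "k \<in> upper_open K \<Longrightarrow> k \<noteq> 0"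
  using K by (auto simp: upper_closed_def upper_open_def)

lemma kernel_family:
  assumes "upper_family K B w" "0 \<le> B"
  shows "family_integral V K B (1 / K) w (\<lambda>k t. volterra_kernel k x t) x"
proof
  show "norm (volterra_kernel k x t) \<le> 1 / K" if "k \<in> upper_closed K" "t \<le> x" for k t
    using norm_volterra_kernel_le[OF that(1) K(1) that(2)] that(1) K(1)
    by (elim order_trans) (auto simp: upper_closed_def intro!: frac_le)
qed (use assms K V k_nz in \<open>auto simp: volterra_kernel_def intro!: continuous_intros holomorphic_intros\<close>)

lemma exp_family:
  assumes "upper_family K B w" "0 \<le> B"
  shows "family_integral V K B 1 w (\<lambda>k t. exp (2 * \<i> * k * of_real (x - t))) x"
proof
  show "norm (exp (2 * \<i> * k * of_real (x - t))) \<le> 1" if "k \<in> upper_closed K" "t \<le> x" for k t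
    using norm_exp_upper_le[of k t x] that by (auto simp: upper_closed_def)
qed (use assms V in \<open>auto intro!: continuous_intros holomorphic_intros\<close>)

lemma one_family:
  assumes "upper_family K B w" "0 \<le> B"
  shows "family_integral V K B 1 w (\<lambda>k t. 1) x"
  by standard (use assms V in \<open>auto intro!: continuous_intros holomorphic_intros\<close>)

text \<open>The exponential kernel splits: \<open>E x\<close> is \<open>exp (2 i k x)\<close> times
  an integral whose integrand does not contain \<open>x\<close>, and the product rule gives its
  derivative. The Volterra integral is \<open>(E - S) / (2 i k)\<close> with \<open>S\<close> the
  integral of \<open>V w\<close>, so the terms \<open>V w\<close> cancel when it is
  differentiated.\<close>

lemma kernel_primitives:
  assumes w: "upper_family K B w" "0 \<le> B" and k: "k \<in> upper_closed K"
  defines "E \<equiv> \<lambda>x. LINT t:{..x}|lebesgue. exp (2 * \<i> * k * of_real (x - t)) * (of_real (V t) * w k t)"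
  shows "primitive E (\<lambda>x. LINT t:{..x}|lebesgue. volterra_kernel k x t * (of_real (V t) * w k t))"
    and "primitive (\<lambda>x. of_real (V x) * w k x + 2 * \<i> * k * E x) E"
proof -
  define g where "g t = of_real (V t) * w k t" for t
  define S where "S x = (LINT t:{..x}|lebesgue. g t)" for x
  define P where "P x = (LINT t:{..x}|lebesgue. exp (- (2 * \<i> * k * of_real t)) * g t)" for x
  have k0: "k \<noteq> 0" using k_nz(1)[OF k] .
  have ig: "g absolutely_integrable_on {..x}" for x
  proof -
    interpret family_integral V K B 1 w "\<lambda>k t. 1" x by (rule one_family[OF w])
    show ?thesis using absolutely_integrable[OF k] by (simp add: g_def[abs_def])
  qed
  have ie: "(\<lambda>t. exp (2 * \<i> * k * of_real (x - t)) * g t) absolutely_integrable_on {..x}" for x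
  proof -
    interpret family_integral V K B 1 w "\<lambda>k t. exp (2 * \<i> * k * of_real (x - t))" x by (rule exp_family[OF w])
    show ?thesis using absolutely_integrable[OF k] by (simp add: g_def[abs_def])
  qed
  have exp_split: "exp (2 * \<i> * k * of_real (x - t)) = exp (2 * \<i> * k * of_real x) * exp (- (2 * \<i> * k * of_real t))" for x t :: real
    by (simp add: exp_add[symmetric] algebra_simps)
  have iP: "(\<lambda>t. exp (- (2 * \<i> * k * of_real t)) * g t) absolutely_integrable_on {..x}" for x
  proof -
    have "(\<lambda>t. exp (- (2 * \<i> * k * of_real x)) * (exp (2 * \<i> * k * of_real (x - t)) * g t)) absolutely_integrable_on {..x}"
      using ie[of x] by (rule set_integrable_mult_right)
    moreover have "exp (- (2 * \<i> * k * of_real x)) * exp (2 * \<i> * k * of_real (x - t)) = exp (- (2 * \<i> * k * of_real t))" for t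
      by (simp add: exp_add[symmetric] algebra_simps)
    ultimately show ?thesis by (simp only: mult.assoc[symmetric])
  qed
  have pS: "primitive g S" unfolding S_def by (rule primitive_integral_atMost[OF ig])
  have pP: "primitive (\<lambda>t. exp (- (2 * \<i> * k * of_real t)) * g t) P"
    unfolding P_def by (rule primitive_integral_atMost[OF iP])
  have EP: "E x = exp (2 * \<i> * k * of_real x) * P x" for x
  proof -
    have "exp (2 * \<i> * k * of_real (x - t)) * g t = exp (2 * \<i> * k * of_real x) * (exp (- (2 * \<i> * k * of_real t)) * g t)" for t
      by (subst exp_split) (rule mult.assoc)
    then show ?thesis unfolding E_def P_def g_def[symmetric] by (simp only: set_integral_mult_right)
  qed
  have pe: "primitive (\<lambda>x. 2 * \<i> * k * exp (2 * \<i> * k * of_real x)) (\<lambda>x. exp (2 * \<i> * k * of_real x))"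
  proof (rule primitive_vector_derivative)
    show "((\<lambda>x. exp (2 * \<i> * k * of_real x)) has_vector_derivative 2 * \<i> * k * exp (2 * \<i> * k * of_real x)) (at x)" for x :: real
      by (rule has_vector_derivative_real_field) (auto intro!: derivative_eq_intros)
  qed (intro continuous_intros)
  show pE: "primitive (\<lambda>x. of_real (V x) * w k x + 2 * \<i> * k * E x) E"
    using primitive_mult[OF pe pP]
    by (rule primitive_cong) (simp_all add: EP g_def mult.assoc[symmetric] exp_add[symmetric])
  have "(LINT t:{..x}|lebesgue. volterra_kernel k x t * (of_real (V t) * w k t)) = (1 / (2 * \<i> * k)) * (E x - S x)" for x
  proof -
    have "(LINT t:{..x}|lebesgue. volterra_kernel k x t * g t) =
      (LINT t:{..x}|lebesgue. (1 / (2 * \<i> * k)) * (exp (2 * \<i> * k * of_real (x - t)) * g t - g t))"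
      by (simp add: volterra_kernel_def algebra_simps diff_divide_distrib)
    also have "\<dots> = (1 / (2 * \<i> * k)) * (E x - S x)"
      unfolding set_integral_mult_right set_integral_diff(2)[OF ie ig] by (simp add: E_def S_def g_def[abs_def])
    finally show ?thesis by (simp add: g_def)
  qed
  moreover have "primitive E (\<lambda>x. (1 / (2 * \<i> * k)) * (E x - S x))"
    using primitive_cmult[OF primitive_diff[OF pE pS], of "1 / (2 * \<i> * k)"]
    by (rule primitive_cong) (use k0 in \<open>simp_all add: g_def\<close>)
  ultimately show "primitive E (\<lambda>x. LINT t:{..x}|lebesgue. volterra_kernel k x t * (of_real (V t) * w k t))"
    by simp
qed

lemma neumann_family: "upper_family K ((1 / 2) ^ n) (neumann V n)"
proof (induction n)
  case 0
  show ?case by (simp add: upper_family_def)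
next
  case (Suc n)
  have f: "family_integral V K ((1 / 2) ^ n) (1 / K) (neumann V n) (\<lambda>k t. volterra_kernel k x t) x" for x
    by (rule kernel_family[OF Suc]) simp
  have "neumann V (Suc n) k \<in> borel_measurable lebesgue" if "k \<in> upper_closed K" for k
    using primitive_continuous[OF kernel_primitives(1)[OF Suc _ that]]
    by (intro continuous_measurable_lebesgue) (simp add: fun_eq_iff)
  moreover have "norm (neumann V (Suc n) k x) \<le> (1 / 2) ^ Suc n" if "k \<in> upper_closed K" for k x
  proof -
    have "norm (neumann V (Suc n) k x) \<le> 1 / K * (1 / 2) ^ n * (LINT t:{..x}|lebesgue. \<bar>V t\<bar>)"
      using family_integral.norm_integral_le[OF f that] by simp
    also have "\<dots> \<le> 1 / K * (1 / 2) ^ n * A"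
      using K atMost_le_A by (intro mult_left_mono) auto
    also have "\<dots> \<le> (1 / 2) ^ Suc n"
      using K by (simp add: field_simps)
    finally show ?thesis .
  qed
  ultimately show ?case
    using family_integral.continuous[OF f] family_integral.holomorphic[OF f]
    unfolding upper_family_def neumann.simps(2) by blast
qed

lemma neumann_uniform: "uniform_limit (upper_closed K) (\<lambda>N k. \<Sum>n<N. neumann V n k x) (\<lambda>k. jost_m V k x) sequentially"
  unfolding jost_m_def
proof (rule Weierstrass_m_test)
  show "norm (neumann V n k x) \<le> (1 / 2) ^ n" if "k \<in> upper_closed K" for n k
    using neumann_family[of n] that by (auto simp: upper_family_def)
qed (auto intro: summable_geometric)

lemma neumann_sums: "k \<in> upper_closed K \<Longrightarrow> (\<lambda>n. neumann V n k x) sums jost_m V k x"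
  unfolding sums_def by (rule tendsto_uniform_limitI[OF neumann_uniform])

text \<open>The uniform limit inherits continuity and holomorphy from the partial sums; the bound 2
  is the sum of the geometric majorant.\<close>

lemma jost_m_family: "upper_family K 2 (jost_m V)"
  unfolding upper_family_def
proof (intro conjI ballI allI)
  fix k assume k: "k \<in> upper_closed K"
  show "jost_m V k \<in> borel_measurable lebesgue"
  proof (rule borel_measurable_LIMSEQ_metric)
    show "(\<lambda>x. \<Sum>n<N. neumann V n k x) \<in> borel_measurable lebesgue" for N
      using neumann_family k by (intro borel_measurable_sum) (auto simp: upper_family_def)
    show "(\<lambda>N. \<Sum>n<N. neumann V n k x) \<longlonglongrightarrow> jost_m V k x" for x
      using neumann_sums[OF k] by (simp add: sums_def)
  qed
  fix t
  have s: "(\<lambda>n. (1 / 2 :: real) ^ n) sums 2" using geometric_sums[of "1 / 2 :: real"] by simp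
  show "norm (jost_m V k t) \<le> 2"
  proof (rule norm_sums_le[OF neumann_sums[OF k] s])
    show "norm (neumann V n k t) \<le> (1 / 2) ^ n" for n
      using neumann_family[of n] k by (auto simp: upper_family_def)
  qed
next
  fix t
  show "continuous_on (upper_closed K) (\<lambda>k. jost_m V k t)"
    by (rule uniform_limit_theorem[OF _ neumann_uniform])
       (use neumann_family in \<open>auto simp: upper_family_def intro!: always_eventually continuous_on_sum\<close>)
  show "(\<lambda>k. jost_m V k t) holomorphic_on upper_open K"
  proof (rule holomorphic_uniform_sequence[OF open_upper_open])
    show "(\<lambda>k. \<Sum>n<N. neumann V n k t) holomorphic_on upper_open K" for N
      using neumann_family by (intro holomorphic_on_sum) (auto simp: upper_family_def)
    fix k assume "k \<in> upper_open K"
    then obtain d where d: "d > 0" "cball k d \<subseteq> upper_open K"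
      using open_upper_open by (meson open_contains_cball)
    have "uniform_limit (cball k d) (\<lambda>N k. \<Sum>n<N. neumann V n k t) (\<lambda>k. jost_m V k t) sequentially"
      by (rule uniform_limit_on_subset[OF neumann_uniform]) (use d(2) upper_open_subset in blast)
    with d show "\<exists>d>0. cball k d \<subseteq> upper_open K \<and>
        uniform_limit (cball k d) (\<lambda>N k. \<Sum>n<N. neumann V n k t) (\<lambda>k. jost_m V k t) sequentially"
      by blast
  qed
qed

text \<open>Sum the recursion of the Neumann terms; their geometric decay permits exchanging sum and
  integral, and the missing term of index 0 is the summand 1.\<close>

lemma jost_m_volterra:
  assumes k: "k \<in> upper_closed K"
  shows "jost_m V k x = 1 + (LINT t:{..x}|lebesgue. volterra_kernel k x t * (of_real (V t) * jost_m V k t))"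
proof -
  define f where "f n t = indicator {..x} t *\<^sub>R (volterra_kernel k x t * (of_real (V t) * neumann V n k t))" for n t
  have F: "family_integral V K ((1 / 2) ^ n) (1 / K) (neumann V n) (\<lambda>k t. volterra_kernel k x t) x" for n
    by (rule kernel_family[OF neumann_family]) simp
  have fi: "integrable lebesgue (f n)" for n
    using family_integral.integrable_G[OF F k, of n] unfolding f_def[abs_def] family_integral.G_def[OF F, abs_def] .
  have fb: "norm (f n t) \<le> indicator {..x} t * (1 / K * \<bar>V t\<bar>) * (1 / 2) ^ n" for n t
    using family_integral.G_bound[OF F k, of n t] unfolding f_def family_integral.G_def[OF F] by (simp add: mult_ac)
  have geo: "summable (\<lambda>n. c * (1 / 2) ^ n)" for c :: real
    by (intro summable_mult summable_geometric) simp
  have sp: "(\<lambda>n. f n t) sums (indicator {..x} t *\<^sub>R (volterra_kernel k x t * (of_real (V t) * jost_m V k t)))" for t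
    unfolding f_def by (intro sums_scaleR_right sums_mult neumann_sums[OF k])
  have "(\<lambda>n. integral\<^sup>L lebesgue (f n)) sums (\<integral>t. (\<Sum>n. f n t) \<partial>lebesgue)"
  proof (rule sums_integral[OF fi])
    show "AE t in lebesgue. summable (\<lambda>n. norm (f n t))"
    proof (rule AE_I2)
      fix t
      show "summable (\<lambda>n. norm (f n t))"
        by (rule summable_comparison_test'[OF geo[of "indicator {..x} t * (1 / K * \<bar>V t\<bar>)"], of 0])
           (use fb[of _ t] in simp)
    qed
    have "norm (\<integral>t. norm (f n t) \<partial>lebesgue) \<le> (\<integral>t. indicator {..x} t * (1 / K * \<bar>V t\<bar>) \<partial>lebesgue) * (1 / 2) ^ n" for n
    proof -
      interpret f0: family_integral V K "(1 / 2) ^ 0" "1 / K" "neumann V 0" "\<lambda>k t. volterra_kernel k x t" x by (rule F)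
      have "integrable lebesgue (\<lambda>t. indicator {..x} t * (1 / K * \<bar>V t\<bar>))" using f0.indV by simp
      then have "integrable lebesgue (\<lambda>t. indicator {..x} t * (1 / K * \<bar>V t\<bar>) * (1 / 2) ^ n)"
        by (rule integrable_mult_left)
      then have "(\<integral>t. norm (f n t) \<partial>lebesgue) \<le> (\<integral>t. indicator {..x} t * (1 / K * \<bar>V t\<bar>) * (1 / 2) ^ n \<partial>lebesgue)"
        by (rule integral_mono[OF integrable_norm[OF fi] _ fb])
      then show ?thesis by simp
    qed
    then show "summable (\<lambda>n. \<integral>t. norm (f n t) \<partial>lebesgue)"
      by (intro summable_comparison_test'[OF geo, of 0])
  qed
  also have "(\<lambda>t. \<Sum>n. f n t) = (\<lambda>t. indicator {..x} t *\<^sub>R (volterra_kernel k x t * (of_real (V t) * jost_m V k t)))"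
    using sp by (simp add: sums_iff)
  also have "(\<lambda>n. integral\<^sup>L lebesgue (f n)) = (\<lambda>n. neumann V (Suc n) k x)"
    by (simp add: f_def[abs_def] set_lebesgue_integral_def)
  finally have "(\<lambda>n. neumann V (Suc n) k x) sums (LINT t:{..x}|lebesgue. volterra_kernel k x t * (of_real (V t) * jost_m V k t))"
    by (simp add: set_lebesgue_integral_def)
  moreover have "(\<lambda>n. neumann V (Suc n) k x) sums (jost_m V k x - 1)"
    using neumann_sums[OF k, of x] by (subst sums_Suc_iff) simp
  ultimately show ?thesis by (auto dest: sums_unique2)
qed

lemma jost_m_primitive:
  assumes k: "k \<in> upper_closed K"
  shows "primitive (jost_m' V k) (jost_m V k)"
    and "primitive (\<lambda>x. of_real (V x) * jost_m V k x + 2 * \<i> * k * jost_m' V k x) (jost_m' V k)"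
proof -
  note * = kernel_primitives[OF jost_m_family _ k, unfolded jost_m'_def[symmetric]]
  have "primitive (jost_m' V k)
      (\<lambda>x. 1 + (LINT t:{..x}|lebesgue. volterra_kernel k x t * (of_real (V t) * jost_m V k t)))"
    using primitive_add[OF primitive_const[of 1] *(1)] by (rule primitive_cong) simp_all
  then show "primitive (jost_m' V k) (jost_m V k)"
    by (rule primitive_cong) (simp_all add: jost_m_volterra[OF k, symmetric])
  show "primitive (\<lambda>x. of_real (V x) * jost_m V k x + 2 * \<i> * k * jost_m' V k x) (jost_m' V k)"
    using *(2) by (rule primitive_cong) simp_all
qed

lemma norm_jost_m'_le:
  "k \<in> upper_closed K \<Longrightarrow> norm (jost_m' V k x) \<le> 2 * (LINT t:{..x}|lebesgue. \<bar>V t\<bar>)"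
  using family_integral.norm_integral_le[OF exp_family[OF jost_m_family, of x], of k]
  by (simp add: jost_m'_def)

lemma jost_m'_continuous: "continuous_on (upper_closed K) (\<lambda>k. jost_m' V k x)"
  unfolding jost_m'_def by (rule family_integral.continuous[OF exp_family[OF jost_m_family]]) simp

lemma jost_m'_holomorphic: "(\<lambda>k. jost_m' V k x) holomorphic_on upper_open K"
  unfolding jost_m'_def by (rule family_integral.holomorphic[OF exp_family[OF jost_m_family]]) simp

lemma norm_jost_m_minus_1_le:
  assumes k: "k \<in> upper_closed K"
  shows "norm (jost_m V k x - 1) \<le> 2 / norm k * (LINT t:{..x}|lebesgue. \<bar>V t\<bar>)"
proof -
  \<comment> \<open>With \<open>norm k\<close> in the place of \<open>K\<close> the kernel bound
    becomes \<open>1 / norm k\<close>, which turns boundedness into decay.\<close>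
  interpret s: jost_setup V "norm k"
    by unfold_locales (use k V K in \<open>auto simp: upper_closed_def\<close>)
  have k': "k \<in> upper_closed (norm k)" using k by (simp add: upper_closed_def)
  have "norm (jost_m V k x - 1) = norm (LINT t:{..x}|lebesgue. volterra_kernel k x t * (of_real (V t) * jost_m V k t))"
    by (subst jost_m_volterra[OF k]) simp
  also have "\<dots> \<le> 1 / norm k * 2 * (LINT t:{..x}|lebesgue. \<bar>V t\<bar>)"
    by (rule family_integral.norm_integral_le[OF s.kernel_family[OF s.jost_m_family] k']) simp
  finally show ?thesis by simp
qed

end

text \<open>Here \<open>k\<close> is complex, and \<open>z\<close> stands for \<open>y'\<close>.\<close>

definition solves :: "(real \<Rightarrow> real) \<Rightarrow> complex \<Rightarrow> (real \<Rightarrow> complex) \<Rightarrow> (real \<Rightarrow> complex) \<Rightarrow> bool" where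
  "solves V k y z \<longleftrightarrow> primitive z y \<and> primitive (\<lambda>x. (of_real (V x) - k\<^sup>2) * y x) z"

section \<open>Jost solutions from both ends\<close>

definition right_jost :: "(real \<Rightarrow> real) \<Rightarrow> complex \<Rightarrow> real \<Rightarrow> complex" where
  "right_jost V k x = exp (- (\<i> * k * of_real x)) * jost_m V k x"

definition right_jost' :: "(real \<Rightarrow> real) \<Rightarrow> complex \<Rightarrow> real \<Rightarrow> complex" where
  "right_jost' V k x = exp (- (\<i> * k * of_real x)) * (jost_m' V k x - \<i> * k * jost_m V k x)"

text \<open>Reflecting the potential exchanges the two ends of the line: the right solution of
  \<open>V (- x)\<close> behaves like \<open>exp (- i k x)\<close> at minus infinity, so its
  reflection solves the equation for \<open>V\<close> and behaves like \<open>exp (i k x)\<close> at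
  plus infinity.\<close>

definition left_jost :: "(real \<Rightarrow> real) \<Rightarrow> complex \<Rightarrow> real \<Rightarrow> complex" where
  "left_jost V k x = right_jost (\<lambda>x. V (- x)) k (- x)"

definition left_jost' :: "(real \<Rightarrow> real) \<Rightarrow> complex \<Rightarrow> real \<Rightarrow> complex" where
  "left_jost' V k x = - right_jost' (\<lambda>x. V (- x)) k (- x)"

lemma primitive_exp: "primitive (\<lambda>x. - (\<i> * k) * exp (- (\<i> * k * of_real x))) (\<lambda>x. exp (- (\<i> * k * of_real x)))"
proof (rule primitive_vector_derivative)
  show "((\<lambda>x. exp (- (\<i> * k * of_real x))) has_vector_derivative - (\<i> * k) * exp (- (\<i> * k * of_real x))) (at x)" for x :: real
    by (rule has_vector_derivative_real_field) (auto intro!: derivative_eq_intros)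
qed (intro continuous_intros)

lemma solves_reflect:
  assumes "solves (\<lambda>x. V (- x)) k y z" shows "solves V k (\<lambda>x. y (- x)) (\<lambda>x. - z (- x))"
  unfolding solves_def
proof
  show "primitive (\<lambda>x. - z (- x)) (\<lambda>x. y (- x))"
    using assms unfolding solves_def by (blast intro: primitive_reflect)
  have "primitive (\<lambda>x. (of_real (V (- x)) - k\<^sup>2) * y x) z"
    using assms by (simp add: solves_def)
  from primitive_cmult[OF primitive_reflect[OF this], of "- 1"]
  show "primitive (\<lambda>x. (of_real (V x) - k\<^sup>2) * y (- x)) (\<lambda>x. - z (- x))"
    by (rule primitive_cong) simp_all
qed

context jost_setup
begin

lemma right_jost_solves:
  assumes k: "k \<in> upper_closed K"
  shows "solves V k (right_jost V k) (right_jost' V k)"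
  unfolding solves_def
proof
  note p = jost_m_primitive[OF k]
  show "primitive (right_jost' V k) (right_jost V k)"
    using primitive_mult[OF primitive_exp[of k] p(1)]
    by (rule primitive_cong) (simp_all add: right_jost_def right_jost'_def algebra_simps)
  show "primitive (\<lambda>x. (of_real (V x) - k\<^sup>2) * right_jost V k x) (right_jost' V k)"
    using primitive_mult[OF primitive_exp[of k] primitive_diff[OF p(2) primitive_cmult[OF p(1), of "\<i> * k"]]]
    by (rule primitive_cong) (simp_all add: right_jost_def right_jost'_def algebra_simps power2_eq_square)
qed

text \<open>The normalised deviations are \<open>m - 1\<close> and
  \<open>(m - 1) + i m' / k\<close>, and each of \<open>m - 1\<close> and \<open>m' / k\<close> is
  at most \<open>2 / norm k\<close> times the integral of \<open>|V|\<close> up to \<open>x\<close>.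
  These integrals also give the limits at minus infinity.\<close>

lemma right_jost_bounds:
  assumes k: "k \<in> upper_closed K"
  shows "norm (exp (\<i> * k * of_real x) * right_jost V k x - 1) \<le> 4 * (LINT t:{..x}|lebesgue. \<bar>V t\<bar>) / norm k"
    and "norm (exp (\<i> * k * of_real x) * right_jost' V k x / (- (\<i> * k)) - 1) \<le> 4 * (LINT t:{..x}|lebesgue. \<bar>V t\<bar>) / norm k"
proof -
  define a where "a = (LINT t:{..x}|lebesgue. \<bar>V t\<bar>)"
  have k0: "k \<noteq> 0" using k_nz k by blast
  have a0: "0 \<le> a" unfolding a_def set_lebesgue_integral_def by (intro integral_nonneg_AE) simp
  have e: "exp (\<i> * k * of_real x) * exp (- (\<i> * k * of_real x)) = 1"
    by (simp add: exp_add[symmetric])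
  have m: "norm (jost_m V k x - 1) \<le> 2 * a / norm k"
    using norm_jost_m_minus_1_le[OF k, of x] by (simp add: a_def)
  have m': "norm (jost_m' V k x / k) \<le> 2 * a / norm k"
    using norm_jost_m'_le[OF k, of x] k0 by (simp add: a_def norm_divide divide_right_mono)
  have "2 * a / norm k \<le> 4 * a / norm k" using a0 by (intro divide_right_mono) auto
  then show "norm (exp (\<i> * k * of_real x) * right_jost V k x - 1) \<le> 4 * (LINT t:{..x}|lebesgue. \<bar>V t\<bar>) / norm k"
    using m by (simp add: right_jost_def mult.assoc[symmetric] e a_def)
  have "exp (\<i> * k * of_real x) * right_jost' V k x / (- (\<i> * k)) - 1 = (jost_m V k x - 1) + \<i> * (jost_m' V k x / k)"
  proof -
    have "exp (\<i> * k * of_real x) * right_jost' V k x = jost_m' V k x - \<i> * k * jost_m V k x"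
      by (simp only: right_jost'_def mult.assoc[symmetric] e mult_1)
    moreover have "(p - \<i> * k * m) / (- (\<i> * k)) - 1 = (m - 1) + \<i> * (p / k)" for m p :: complex
      using k0 by (simp add: field_simps)
    ultimately show ?thesis by simp
  qed
  also have "norm \<dots> \<le> 2 * a / norm k + 2 * a / norm k"
    using m m' by (intro order_trans[OF norm_triangle_ineq] add_mono) (simp_all add: norm_mult norm_divide)
  finally show "norm (exp (\<i> * k * of_real x) * right_jost' V k x / (- (\<i> * k)) - 1) \<le> 4 * (LINT t:{..x}|lebesgue. \<bar>V t\<bar>) / norm k"
    by (simp add: a_def)
qed

lemma right_jost_continuous:
  "continuous_on (upper_closed K) (\<lambda>k. right_jost V k x)" "continuous_on (upper_closed K) (\<lambda>k. right_jost' V k x)"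
  using jost_m_family jost_m'_continuous[of x] unfolding right_jost_def right_jost'_def upper_family_def
  by (auto intro!: continuous_intros)

lemma right_jost_holomorphic:
  "(\<lambda>k. right_jost V k x) holomorphic_on upper_open K" "(\<lambda>k. right_jost' V k x) holomorphic_on upper_open K"
  using jost_m_family jost_m'_holomorphic[of x] unfolding right_jost_def right_jost'_def upper_family_def
  by (auto intro!: holomorphic_intros)

lemma right_jost_limits:
  assumes k: "k \<in> upper_closed K"
  shows "((\<lambda>x. exp (\<i> * k * of_real x) * right_jost V k x) \<longlongrightarrow> 1) at_bot"
    and "((\<lambda>x. exp (\<i> * k * of_real x) * right_jost' V k x) \<longlongrightarrow> - (\<i> * k)) at_bot"
proof -
  have k0: "k \<noteq> 0" using k_nz k by blast
  have lim: "((\<lambda>x. 4 * (LINT t:{..x}|lebesgue. \<bar>V t\<bar>) / norm k) \<longlongrightarrow> 4 * 0 / norm k) at_bot"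
    using V k0 by (intro tendsto_intros tendsto_integral_atMost_at_bot) auto
  then have lim: "((\<lambda>x. 4 * (LINT t:{..x}|lebesgue. \<bar>V t\<bar>) / norm k) \<longlongrightarrow> 0) at_bot" by simp
  have "((\<lambda>x. exp (\<i> * k * of_real x) * right_jost V k x - 1) \<longlongrightarrow> 0) at_bot"
    by (rule Lim_null_comparison[OF _ lim]) (use right_jost_bounds[OF k] in \<open>auto intro: always_eventually\<close>)
  then show "((\<lambda>x. exp (\<i> * k * of_real x) * right_jost V k x) \<longlongrightarrow> 1) at_bot"
    by (rule LIM_zero_cancel)
  have "((\<lambda>x. exp (\<i> * k * of_real x) * right_jost' V k x / (- (\<i> * k)) - 1) \<longlongrightarrow> 0) at_bot"
    by (rule Lim_null_comparison[OF _ lim]) (use right_jost_bounds[OF k] in \<open>auto intro: always_eventually\<close>)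
  then have "((\<lambda>x. exp (\<i> * k * of_real x) * right_jost' V k x / (- (\<i> * k))) \<longlongrightarrow> 1) at_bot"
    by (rule LIM_zero_cancel)
  from tendsto_mult[OF this tendsto_const[of "- (\<i> * k)"]]
  show "((\<lambda>x. exp (\<i> * k * of_real x) * right_jost' V k x) \<longlongrightarrow> - (\<i> * k)) at_bot"
    using k0 by simp
qed

end

section \<open>Scattering coefficients\<close>

lemma has_bochner_integral_lebesgue_reflect:
  fixes f :: "real \<Rightarrow> real"
  assumes "integrable lebesgue f"
  shows "has_bochner_integral lebesgue (\<lambda>x. f (- x)) (\<integral>x. f x \<partial>lebesgue)"
  using has_bochner_integral_integrable[OF assms]
    has_bochner_integral_lebesgue_real_affine_iff[of "- 1" f "\<integral>x. f x \<partial>lebesgue" 0] by simp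

definition wronskian :: "(real \<Rightarrow> complex) \<Rightarrow> (real \<Rightarrow> complex) \<Rightarrow> (real \<Rightarrow> complex) \<Rightarrow> (real \<Rightarrow> complex) \<Rightarrow> real \<Rightarrow> complex" where
  "wronskian y y' z z' x = y x * z' x - y' x * z x"

definition jost_W :: "(real \<Rightarrow> real) \<Rightarrow> complex \<Rightarrow> complex" where
  "jost_W V k = wronskian (right_jost V k) (right_jost' V k) (left_jost V k) (left_jost' V k) 0"

lemma wronskian_constant:
  assumes y: "solves V k y y'" and z: "solves V k z z'"
  shows "wronskian y y' z z' x = wronskian y y' z z' x0"
proof -
  note p = y[unfolded solves_def] z[unfolded solves_def]
  have "primitive (\<lambda>_. 0) (wronskian y y' z z')"
    using primitive_diff[OF primitive_mult[OF conjunct1[OF p(1)] conjunct2[OF p(2)]]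
        primitive_mult[OF conjunct2[OF p(1)] conjunct1[OF p(2)]]]
    by (rule primitive_cong) (simp_all add: wronskian_def algebra_simps)
  then show ?thesis by (rule primitive_zero_constant)
qed

lemma solves_uminus: "solves V (- k) = solves V k"
  by (simp add: solves_def fun_eq_iff)

text \<open>Bridge between the pointwise notion of solution and the integrated one. The equation
  forces the second derivative to be \<open>(V - k^2) y\<close>, which is locally integrable because
  \<open>y\<close> is continuous.\<close>

lemma schroedinger_solution_iff_solves:
  assumes V: "integrable lebesgue V"
  shows "schroedinger_solution V k y \<longleftrightarrow> (\<exists>z. solves V (of_real k) y z)"
proof
  assume "schroedinger_solution V k y"
  then obtain z where yac: "locally_abs_cont y" and yz: "\<And>x. (y has_vector_derivative z x) (at x)"
    and z: "locally_abs_cont z"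
    and ae: "AE x in lebesgue. \<exists>w. (z has_vector_derivative w) (at x) \<and> - w + of_real (V x) * y x = (of_real k)\<^sup>2 * y x"
    unfolding schroedinger_solution_def by blast
  have y: "continuous_on S y" for S
    using yz by (auto intro!: continuous_at_imp_continuous_on has_vector_derivative_continuous)
  have zV: "primitive (\<lambda>x. (of_real (V x) - (of_real k)\<^sup>2) * y x) z"
  proof (rule locally_abs_cont_primitive[OF z])
    show "AE x in lebesgue. (z has_vector_derivative (of_real (V x) - (of_real k)\<^sup>2) * y x) (at x)"
      using ae
    proof eventually_elim
      case (elim x)
      then obtain w where "(z has_vector_derivative w) (at x)" "- w + of_real (V x) * y x = (of_real k)\<^sup>2 * y x"
        by blast
      moreover from this(2) have "w = (of_real (V x) - (of_real k)\<^sup>2) * y x"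
        by (simp add: algebra_simps add_eq_0_iff2 minus_equation_iff[of w])
      ultimately show ?case by simp
    qed
    fix a b :: real
    have "V absolutely_integrable_on {a..b}"
      using integrable_mult_indicator[OF _ V, of "{a..b}"] by (simp add: set_integrable_def)
    then have "(\<lambda>x. of_real (V x) :: complex) absolutely_integrable_on {a..b}"
      by (rule absolutely_integrable_linear[OF _ bounded_linear_of_real, unfolded o_def])
    then have "(\<lambda>x. of_real (V x) - (of_real k)\<^sup>2 :: complex) absolutely_integrable_on {a..b}"
      by (intro set_integral_diff(1) absolutely_integrable_on_const) auto
    then show "(\<lambda>x. (of_real (V x) - (of_real k)\<^sup>2) * y x) absolutely_integrable_on {a..b}"
      by (rule absolutely_integrable_continuous_mult(2)[OF _ y])
  qed
  have "primitive z y"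
    by (rule primitive_vector_derivative[OF yz primitive_continuous[OF zV]])
  with zV show "\<exists>z. solves V (of_real k) y z" unfolding solves_def by blast
next
  assume "\<exists>z. solves V (of_real k) y z"
  then obtain z where zy: "primitive z y" and zV: "primitive (\<lambda>x. (of_real (V x) - (of_real k)\<^sup>2) * y x) z"
    unfolding solves_def by blast
  show "schroedinger_solution V k y"
    unfolding schroedinger_solution_def
  proof (intro conjI exI[of _ z] allI primitive_locally_abs_cont[OF zy] primitive_locally_abs_cont[OF zV]
      primitive_has_vector_derivative[OF zy primitive_continuous[OF zV]])
    show "AE x in lebesgue. \<exists>w. (z has_vector_derivative w) (at x) \<and> - w + of_real (V x) * y x = (of_real k)\<^sup>2 * y x"
      using primitive_ae_vector_derivative[OF zV]
      by eventually_elim (auto simp: algebra_simps)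
  qed
qed

text \<open>Translation by a quarter period \<open>s\<close> multiplies the two waves by
  \<open>i\<close> and \<open>- i\<close>. Adding the translated combination to \<open>i\<close>
  times the original one, or subtracting it, isolates a single wave; its modulus is constant, so it
  tends to 0 only if its coefficient vanishes.\<close>

lemma plane_wave_combination_tendsto_0:
  assumes "k \<noteq> 0" and lim: "((\<lambda>x. c * plane_wave k x + d * plane_wave (- k) x) \<longlongrightarrow> 0) at_bot"
  shows "c = 0" "d = 0"
proof -
  define s where "s = pi / (2 * k)"
  have h: "exp (\<i> * of_real (pi / 2)) = \<i>"
    by (metis cis_conv_exp cis_pi_half)
  have e1: "plane_wave k (x + s) = \<i> * plane_wave k x" for x
  proof -
    have "\<i> * of_real k * of_real (x + s) = \<i> * of_real k * of_real x + \<i> * of_real (pi / 2)"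
      using assms(1) by (simp add: s_def field_simps)
    then show ?thesis by (simp only: plane_wave_def exp_add h mult.commute)
  qed
  have e2: "plane_wave (- k) (x + s) = - \<i> * plane_wave (- k) x" for x
  proof -
    have "\<i> * of_real (- k) * of_real (x + s) = \<i> * of_real (- k) * of_real x - \<i> * of_real (pi / 2)"
      using assms(1) by (simp add: s_def field_simps)
    then have "plane_wave (- k) (x + s) = plane_wave (- k) x / \<i>"
      by (simp only: plane_wave_def exp_diff h)
    then show ?thesis by (simp add: field_simps)
  qed
  have sh: "filterlim (\<lambda>x. x + s) at_bot at_bot"
    unfolding filterlim_at_bot
  proof
    fix Z
    show "eventually (\<lambda>x. x + s \<le> Z) at_bot"
      using eventually_le_at_bot[of "Z - s"] by eventually_elim simp
  qed
  have lim': "((\<lambda>x. \<i> * c * plane_wave k x - \<i> * d * plane_wave (- k) x) \<longlongrightarrow> 0) at_bot"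
    using filterlim_compose[OF lim sh] by (simp add: e1 e2 mult_ac)
  have n: "norm (plane_wave j x) = 1" for j x by (simp add: plane_wave_def)
  have "((\<lambda>x. \<i> * (c * plane_wave k x + d * plane_wave (- k) x) + (\<i> * c * plane_wave k x - \<i> * d * plane_wave (- k) x)) \<longlongrightarrow> \<i> * 0 + 0) at_bot"
    by (intro tendsto_add tendsto_mult_left lim lim')
  then have "((\<lambda>x. norm (2 * \<i> * c * plane_wave k x)) \<longlongrightarrow> norm (0::complex)) at_bot"
    by (intro tendsto_norm) (simp add: algebra_simps)
  then have "((\<lambda>x::real. 2 * norm c) \<longlongrightarrow> 0) at_bot" by (simp add: norm_mult n)
  from tendsto_unique[OF _ this tendsto_const] show "c = 0" by simp
  have "((\<lambda>x. \<i> * (c * plane_wave k x + d * plane_wave (- k) x) - (\<i> * c * plane_wave k x - \<i> * d * plane_wave (- k) x)) \<longlongrightarrow> \<i> * 0 - 0) at_bot"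
    by (intro tendsto_diff tendsto_mult_left lim lim')
  then have "((\<lambda>x. norm (2 * \<i> * d * plane_wave (- k) x)) \<longlongrightarrow> norm (0::complex)) at_bot"
    by (intro tendsto_norm) (simp add: algebra_simps)
  then have "((\<lambda>x::real. 2 * norm d) \<longlongrightarrow> 0) at_bot" by (simp add: norm_mult n)
  from tendsto_unique[OF _ this tendsto_const] show "d = 0" by simp
qed

lemma plane_wave_reflect: "plane_wave k (- x) = plane_wave (- k) x"
  by (simp add: plane_wave_def)

lemma plane_wave_combination_tendsto_0_at_top:
  assumes "k \<noteq> 0" and lim: "((\<lambda>x. c * plane_wave k x + d * plane_wave (- k) x) \<longlongrightarrow> 0) at_top"
  shows "c = 0" "d = 0"
proof -
  have "((\<lambda>x. d * plane_wave k x + c * plane_wave (- k) x) \<longlongrightarrow> 0) at_bot"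
    using lim unfolding filterlim_at_bot_mirror by (simp add: plane_wave_reflect add.commute)
  then show "c = 0" "d = 0" using plane_wave_combination_tendsto_0[OF assms(1)] by blast+
qed

context jost_setup
begin

lemma reflect: "jost_setup (\<lambda>x. V (- x)) K"
proof
  show "integrable lebesgue (\<lambda>x. V (- x))"
    using has_bochner_integral_lebesgue_reflect[OF V] by (rule integrable.intros)
  have "integrable lebesgue (\<lambda>x. \<bar>V x\<bar>)" using V by simp
  from has_bochner_integral_integral_eq[OF has_bochner_integral_lebesgue_reflect[OF this]]
  show "2 * (\<integral>t. \<bar>V (- t)\<bar> \<partial>lebesgue) \<le> K" using K by simp
qed (rule K)

lemma A_reflect: "(\<integral>t. \<bar>V (- t)\<bar> \<partial>lebesgue) = A"
proof -
  have "integrable lebesgue (\<lambda>x. \<bar>V x\<bar>)" using V by simp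
  from has_bochner_integral_integral_eq[OF has_bochner_integral_lebesgue_reflect[OF this]]
  show ?thesis .
qed

lemma left_jost_solves:
  assumes k: "k \<in> upper_closed K"
  shows "solves V k (left_jost V k) (left_jost' V k)"
  using solves_reflect[OF jost_setup.right_jost_solves[OF reflect k]]
  by (simp add: left_jost_def[abs_def] left_jost'_def[abs_def])

lemma right_jost_le:
  assumes k: "k \<in> upper_closed K"
  shows "norm (exp (\<i> * k * of_real x) * right_jost V k x - 1) \<le> 4 * A / norm k"
    and "norm (exp (\<i> * k * of_real x) * right_jost' V k x / (- (\<i> * k)) - 1) \<le> 4 * A / norm k"
proof -
  have "4 * (LINT t:{..x}|lebesgue. \<bar>V t\<bar>) / norm k \<le> 4 * A / norm k"
    using atMost_le_A by (intro divide_right_mono mult_left_mono) auto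
  then show "norm (exp (\<i> * k * of_real x) * right_jost V k x - 1) \<le> 4 * A / norm k"
    "norm (exp (\<i> * k * of_real x) * right_jost' V k x / (- (\<i> * k)) - 1) \<le> 4 * A / norm k"
    using right_jost_bounds[OF k, of x] by linarith+
qed

lemma left_jost_le:
  assumes k: "k \<in> upper_closed K"
  shows "norm (exp (- (\<i> * k * of_real x)) * left_jost V k x - 1) \<le> 4 * A / norm k"
    and "norm (exp (- (\<i> * k * of_real x)) * left_jost' V k x / (\<i> * k) - 1) \<le> 4 * A / norm k"
  using jost_setup.right_jost_le[OF reflect k, of "- x"]
  by (simp_all add: left_jost_def left_jost'_def A_reflect)

lemma left_jost_continuous:
  "continuous_on (upper_closed K) (\<lambda>k. left_jost V k x)" "continuous_on (upper_closed K) (\<lambda>k. left_jost' V k x)"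
  unfolding left_jost_def left_jost'_def
  by (intro continuous_on_minus jost_setup.right_jost_continuous[OF reflect])+

lemma left_jost_holomorphic:
  "(\<lambda>k. left_jost V k x) holomorphic_on upper_open K" "(\<lambda>k. left_jost' V k x) holomorphic_on upper_open K"
  unfolding left_jost_def left_jost'_def
  by (intro holomorphic_on_minus jost_setup.right_jost_holomorphic[OF reflect])+

lemma real_upper_closed:
  fixes k :: real assumes "K \<le> \<bar>k\<bar>"
  shows "of_real k \<in> upper_closed K" "- of_real k \<in> upper_closed K"
  using assms by (auto simp: upper_closed_def)

lemma jost_W_eq:
  "k \<in> upper_closed K \<Longrightarrow> wronskian (right_jost V k) (right_jost' V k) (left_jost V k) (left_jost' V k) x = jost_W V k"
  unfolding jost_W_def by (rule wronskian_constant[OF right_jost_solves left_jost_solves])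

text \<open>The free Wronskian is \<open>2 i k\<close>. Four relative errors of size
  \<open>\<delta>\<close> change the quotient by at most \<open>2 \<delta> + \<delta>^2\<close>, and
  \<open>32 * A \<le> K\<close> gives \<open>\<delta> \<le> 1/8\<close>, hence the bound
  \<open>3 \<delta>\<close>.\<close>

lemma jost_W_estimate:
  assumes k: "k \<in> upper_closed K" and A: "32 * A \<le> K"
  shows "norm (jost_W V k / (2 * \<i> * k) - 1) \<le> 12 * A / norm k"
proof -
  have k0: "k \<noteq> 0" using k_nz k by blast
  define \<delta> where "\<delta> = 4 * A / norm k"
  have \<delta>: "0 \<le> \<delta>" "\<delta> \<le> 1 / 8"
  proof -
    have "0 < norm k" "32 * A \<le> norm k" using A k K by (auto simp: upper_closed_def)
    then show "0 \<le> \<delta>" "\<delta> \<le> 1 / 8" by (simp_all add: \<delta>_def pos_divide_le_eq)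
  qed
  define a where "a = right_jost V k 0 - 1"
  define b where "b = right_jost' V k 0 / (- (\<i> * k)) - 1"
  define c where "c = left_jost V k 0 - 1"
  define d where "d = left_jost' V k 0 / (\<i> * k) - 1"
  have n: "norm a \<le> \<delta>" "norm b \<le> \<delta>" "norm c \<le> \<delta>" "norm d \<le> \<delta>"
    using right_jost_le[OF k, of 0] left_jost_le[OF k, of 0] by (simp_all add: a_def b_def c_def d_def \<delta>_def)
  have "jost_W V k / (2 * \<i> * k) - 1 = (a + b + c + d + a * d + b * c) / 2"
    using k0 by (simp add: jost_W_def wronskian_def a_def b_def c_def d_def field_simps)
  also have "norm \<dots> \<le> (\<delta> + \<delta> + \<delta> + \<delta> + \<delta> * \<delta> + \<delta> * \<delta>) / 2"
    using n \<delta> unfolding norm_divide norm_numeral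
    by (intro divide_right_mono order_trans[OF norm_triangle_ineq] add_mono order_trans[OF norm_mult_ineq] mult_mono) auto
  also have "\<dots> \<le> 3 * \<delta>"
    using \<delta> mult_right_mono[OF \<delta>(2) \<delta>(1)] by simp
  finally show ?thesis by (simp add: \<delta>_def)
qed

lemma right_jost_asymptotic:
  fixes j :: real
  assumes j: "K \<le> \<bar>j\<bar>"
  shows "((\<lambda>x. right_jost V (of_real j) x - plane_wave (- j) x) \<longlongrightarrow> 0) at_bot"
proof (rule Lim_null_comparison[OF always_eventually[OF allI]])
  fix x
  have "norm (right_jost V (of_real j) x - plane_wave (- j) x) =
    norm (exp (- (\<i> * j * x)) * (exp (\<i> * j * x) * right_jost V (of_real j) x - 1))"
    by (simp add: plane_wave_def right_diff_distrib mult.assoc[symmetric] exp_add[symmetric])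
  then show "norm (right_jost V (of_real j) x - plane_wave (- j) x) \<le>
      norm (exp (\<i> * j * x) * right_jost V (of_real j) x - 1)"
    by (simp add: norm_mult)
next
  have "((\<lambda>x. exp (\<i> * j * x) * right_jost V (of_real j) x - 1) \<longlongrightarrow> 1 - 1) at_bot"
    by (intro tendsto_diff right_jost_limits(1)[OF real_upper_closed(1)[OF j]] tendsto_const)
  then show "((\<lambda>x. norm (exp (\<i> * j * x) * right_jost V (of_real j) x - 1)) \<longlongrightarrow> 0) at_bot"
    by (auto intro: tendsto_norm_zero)
qed

text \<open>For real \<open>k\<close> both \<open>k\<close> and \<open>- k\<close> belong to the
  region, and the two right solutions form a basis of the solution space; Cramer's rule expresses
  the coefficients by Wronskians.\<close>

lemma right_jost_basis:
  fixes k :: real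
  assumes k: "K \<le> \<bar>k\<bar>" and u: "solves V (of_real k) u u'"
  defines "c \<equiv> wronskian (right_jost V k) (right_jost' V k) u u' 0 / (2 * \<i> * k)"
    and "d \<equiv> wronskian u u' (right_jost V (- k)) (right_jost' V (- k)) 0 / (2 * \<i> * k)"
  shows "u x = c * right_jost V (- k) x + d * right_jost V k x"
    and "u' x = c * right_jost' V (- k) x + d * right_jost' V k x"
    and "((\<lambda>x. u x - (c * plane_wave k x + d * plane_wave (- k) x)) \<longlongrightarrow> 0) at_bot"
proof -
  let ?f = "right_jost V k" let ?f' = "right_jost' V k" let ?h = "right_jost V (- k)" let ?h' = "right_jost' V (- k)"
  note kc = real_upper_closed[OF k]
  have k0: "complex_of_real k \<noteq> 0" using k K by auto
  have sf: "solves V (of_real k) ?f ?f'" by (rule right_jost_solves[OF kc(1)])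
  have sh: "solves V (of_real k) ?h ?h'" using right_jost_solves[OF kc(2)] by (simp add: solves_uminus)
  have e: "exp (\<i> * k * of_real x) * exp (\<i> * (- k) * of_real x) = 1" for x :: real
    by (simp add: exp_add[symmetric])
  \<comment> \<open>The Wronskian of the basis is constant and is evaluated at minus infinity. The
    exponential factors make each solution converge there, and their product is 1.\<close>
  have "((\<lambda>x. (exp (\<i> * k * of_real x) * ?f x) * (exp (\<i> * (- k) * of_real x) * ?h' x)
      - (exp (\<i> * k * of_real x) * ?f' x) * (exp (\<i> * (- k) * of_real x) * ?h x)) \<longlongrightarrow>
      1 * - (\<i> * (- k)) - - (\<i> * k) * 1) at_bot"
    using right_jost_limits[OF kc(1)] right_jost_limits[OF kc(2)] by (intro tendsto_intros) auto
  moreover have "(exp (\<i> * k * of_real x) * ?f x) * (exp (\<i> * (- k) * of_real x) * ?h' x)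
      - (exp (\<i> * k * of_real x) * ?f' x) * (exp (\<i> * (- k) * of_real x) * ?h x) = wronskian ?f ?f' ?h ?h' 0" for x
  proof -
    have "(exp (\<i> * k * of_real x) * ?f x) * (exp (\<i> * (- k) * of_real x) * ?h' x)
      - (exp (\<i> * k * of_real x) * ?f' x) * (exp (\<i> * (- k) * of_real x) * ?h x) =
      (exp (\<i> * k * of_real x) * exp (\<i> * (- k) * of_real x)) * wronskian ?f ?f' ?h ?h' x"
      by (simp only: wronskian_def algebra_simps)
    then show ?thesis unfolding e using wronskian_constant[OF sf sh, of x 0] by simp
  qed
  ultimately have "((\<lambda>x::real. wronskian ?f ?f' ?h ?h' 0) \<longlongrightarrow> 2 * \<i> * k) at_bot"
    by (simp add: mult.assoc)
  from tendsto_unique[OF _ tendsto_const this]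
  have W: "?f x * ?h' x - ?f' x * ?h x = 2 * \<i> * k" for x
    using wronskian_constant[OF sf sh, of x 0] by (simp add: wronskian_def)
  have c: "c * (2 * \<i> * k) = ?f x * u' x - ?f' x * u x" for x
    unfolding c_def using k0 wronskian_constant[OF sf u, of x 0] by (simp add: wronskian_def)
  have d: "d * (2 * \<i> * k) = u x * ?h' x - u' x * ?h x" for x
    unfolding d_def using k0 wronskian_constant[OF u sh, of x 0] by (simp add: wronskian_def)
  show ux: "u x = c * ?h x + d * ?f x" for x
  proof -
    have "(2 * \<i> * k) * u x = (?f x * ?h' x - ?f' x * ?h x) * u x" by (simp only: W)
    also have "\<dots> = (?f x * u' x - ?f' x * u x) * ?h x + (u x * ?h' x - u' x * ?h x) * ?f x"
      by (simp only: algebra_simps)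
    also have "\<dots> = (c * (2 * \<i> * k)) * ?h x + (d * (2 * \<i> * k)) * ?f x" by (simp only: c[of x] d[of x])
    also have "\<dots> = (2 * \<i> * k) * (c * ?h x + d * ?f x)" by (simp only: algebra_simps)
    finally show ?thesis using k0 by simp
  qed
  show "u' x = c * ?h' x + d * ?f' x"
  proof -
    have "(2 * \<i> * k) * u' x = (?f x * ?h' x - ?f' x * ?h x) * u' x" by (simp only: W)
    also have "\<dots> = (?f x * u' x - ?f' x * u x) * ?h' x + (u x * ?h' x - u' x * ?h x) * ?f' x"
      by (simp only: algebra_simps)
    also have "\<dots> = (c * (2 * \<i> * k)) * ?h' x + (d * (2 * \<i> * k)) * ?f' x" by (simp only: c[of x] d[of x])
    also have "\<dots> = (2 * \<i> * k) * (c * ?h' x + d * ?f' x)" by (simp only: algebra_simps)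
    finally show ?thesis using k0 by simp
  qed
  have k': "K \<le> \<bar>- k\<bar>" using k by simp
  have "((\<lambda>x. c * (?h x - plane_wave k x) + d * (?f x - plane_wave (- k) x)) \<longlongrightarrow> c * 0 + d * 0) at_bot"
    using right_jost_asymptotic[OF k] right_jost_asymptotic[OF k'] by (intro tendsto_intros) auto
  then show "((\<lambda>x. u x - (c * plane_wave k x + d * plane_wave (- k) x)) \<longlongrightarrow> 0) at_bot"
    unfolding ux by (simp add: algebra_simps)
qed

lemma left_jost_asymptotic:
  fixes k :: real
  assumes k: "K \<le> \<bar>k\<bar>"
  shows "((\<lambda>x. left_jost V (of_real k) x - plane_wave k x) \<longlongrightarrow> 0) at_top"
  using jost_setup.right_jost_asymptotic[OF reflect k]
  unfolding filterlim_at_bot_mirror by (simp add: left_jost_def plane_wave_reflect)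

lemma left_jost_basis:
  fixes k :: real
  assumes k: "K \<le> \<bar>k\<bar>" and u: "solves V (of_real k) u u'"
  defines "c \<equiv> wronskian u u' (left_jost V k) (left_jost' V k) 0 / (2 * \<i> * k)"
    and "d \<equiv> wronskian (left_jost V (- k)) (left_jost' V (- k)) u u' 0 / (2 * \<i> * k)"
  shows "u x = c * left_jost V (- k) x + d * left_jost V k x"
    and "((\<lambda>x. u x - (c * plane_wave (- k) x + d * plane_wave k x)) \<longlongrightarrow> 0) at_top"
proof -
  interpret R: jost_setup "\<lambda>x. V (- x)" K by (rule reflect)
  have u': "solves (\<lambda>x. V (- x)) (of_real k) (\<lambda>x. u (- x)) (\<lambda>x. - u' (- x))"
    using u by (intro solves_reflect) simp
  have c: "wronskian (right_jost (\<lambda>x. V (- x)) k) (right_jost' (\<lambda>x. V (- x)) k) (\<lambda>x. u (- x)) (\<lambda>x. - u' (- x)) 0 / (2 * \<i> * k) = c"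
    and d: "wronskian (\<lambda>x. u (- x)) (\<lambda>x. - u' (- x)) (right_jost (\<lambda>x. V (- x)) (- k)) (right_jost' (\<lambda>x. V (- x)) (- k)) 0 / (2 * \<i> * k) = d"
    by (simp_all add: c_def d_def wronskian_def left_jost_def left_jost'_def algebra_simps)
  show "u x = c * left_jost V (- k) x + d * left_jost V k x"
    using R.right_jost_basis(1)[OF k u', unfolded c d, of "- x"] by (simp add: left_jost_def)
  show "((\<lambda>x. u x - (c * plane_wave (- k) x + d * plane_wave k x)) \<longlongrightarrow> 0) at_top"
    using R.right_jost_basis(3)[OF k u', unfolded c d]
    unfolding filterlim_at_bot_mirror by (simp add: plane_wave_reflect)
qed

text \<open>In the basis of left solutions the prescribed behaviour at plus infinity determines both
  coefficients, so the definite description denotes the function built from the Neumann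
  series.\<close>

lemma jost_left_eq:
  fixes k :: real
  assumes k: "K \<le> \<bar>k\<bar>"
  shows "jost_left V k = left_jost V k"
  unfolding jost_left_def
proof (rule the_equality)
  show "schroedinger_solution V k (left_jost V k) \<and> ((\<lambda>x. left_jost V k x - plane_wave k x) \<longlongrightarrow> 0) at_top"
    using left_jost_solves[OF real_upper_closed(1)[OF k]] left_jost_asymptotic[OF k]
    by (auto simp: schroedinger_solution_iff_solves[OF V])
next
  fix f assume f: "schroedinger_solution V k f \<and> ((\<lambda>x. f x - plane_wave k x) \<longlongrightarrow> 0) at_top"
  then obtain f' where s: "solves V k f f'" by (auto simp: schroedinger_solution_iff_solves[OF V])
  obtain c d where e: "\<And>x. f x = c * left_jost V (- k) x + d * left_jost V k x"
    and lim: "((\<lambda>x. f x - (c * plane_wave (- k) x + d * plane_wave k x)) \<longlongrightarrow> 0) at_top"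
    using left_jost_basis[OF k s] by blast
  have "((\<lambda>x. (f x - plane_wave k x) - (f x - (c * plane_wave (- k) x + d * plane_wave k x))) \<longlongrightarrow> 0 - 0) at_top"
    using f by (intro tendsto_diff lim) auto
  then have "((\<lambda>x. (d - 1) * plane_wave k x + c * plane_wave (- k) x) \<longlongrightarrow> 0) at_top"
    by (simp add: algebra_simps)
  from plane_wave_combination_tendsto_0_at_top[OF _ this] have "d = 1" "c = 0" using k K by auto
  then show "f = left_jost V k" using e by auto
qed

lemma jost_right_eq:
  fixes k :: real
  assumes k: "K \<le> \<bar>k\<bar>"
  shows "jost_right V k = right_jost V k"
  unfolding jost_right_def
proof (rule the_equality)
  show "schroedinger_solution V k (right_jost V k) \<and> ((\<lambda>x. right_jost V k x - plane_wave (- k) x) \<longlongrightarrow> 0) at_bot"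
    using right_jost_solves[OF real_upper_closed(1)[OF k]] right_jost_asymptotic[OF k]
    by (auto simp: schroedinger_solution_iff_solves[OF V])
next
  fix f assume f: "schroedinger_solution V k f \<and> ((\<lambda>x. f x - plane_wave (- k) x) \<longlongrightarrow> 0) at_bot"
  then obtain f' where s: "solves V k f f'" by (auto simp: schroedinger_solution_iff_solves[OF V])
  obtain c d where e: "\<And>x. f x = c * right_jost V (- k) x + d * right_jost V k x"
    and lim: "((\<lambda>x. f x - (c * plane_wave k x + d * plane_wave (- k) x)) \<longlongrightarrow> 0) at_bot"
    using right_jost_basis[OF k s] by blast
  have "((\<lambda>x. (f x - plane_wave (- k) x) - (f x - (c * plane_wave k x + d * plane_wave (- k) x))) \<longlongrightarrow> 0 - 0) at_bot"
    using f by (intro tendsto_diff lim) auto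
  then have "((\<lambda>x. c * plane_wave k x + (d - 1) * plane_wave (- k) x) \<longlongrightarrow> 0) at_bot"
    by (simp add: algebra_simps)
  from plane_wave_combination_tendsto_0[OF _ this] have "d = 1" "c = 0" using k K by auto
  then show "f = right_jost V k" using e by auto
qed

lemma jost_W_nonzero:
  assumes k: "k \<in> upper_closed K" and A: "32 * A \<le> K"
  shows "jost_W V k \<noteq> 0"
proof
  assume "jost_W V k = 0"
  then have "1 \<le> 12 * A / norm k" using jost_W_estimate[OF assms] by simp
  moreover have "12 * A / norm k < 1"
  proof -
    have "0 < norm k" "32 * A \<le> norm k" using assms K by (auto simp: upper_closed_def)
    moreover from this have "12 * A < norm k" using A_nonneg by linarith
    ultimately show ?thesis by (simp add: pos_divide_less_eq)
  qed
  ultimately show False by simp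
qed

text \<open>The coefficients of each Jost solution in the basis from the other end are Wronskians
  over \<open>2 i k\<close>. Both expansions share the coefficient \<open>c = 1 / T\<close>, so
  \<open>2 i k\<close> cancels in the quotients \<open>L\<close> and \<open>R\<close>; uniqueness of
  plane wave combinations makes the definite descriptions denote these quotients.\<close>

lemma reflection_formulas:
  fixes k :: real
  assumes k: "K \<le> \<bar>k\<bar>" and A: "32 * A \<le> K"
  shows "left_reflection V k = wronskian (left_jost V k) (left_jost' V k) (right_jost V (- k)) (right_jost' V (- k)) 0 / jost_W V k"
    and "right_reflection V k = wronskian (left_jost V (- k)) (left_jost' V (- k)) (right_jost V k) (right_jost' V k) 0 / jost_W V k"
proof -
  note kc = real_upper_closed[OF k]
  have k0: "k \<noteq> 0" using k K by auto
  define c where "c = jost_W V k / (2 * \<i> * k)"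
  define d where "d = wronskian (left_jost V k) (left_jost' V k) (right_jost V (- k)) (right_jost' V (- k)) 0 / (2 * \<i> * k)"
  define d' where "d' = wronskian (left_jost V (- k)) (left_jost' V (- k)) (right_jost V k) (right_jost' V k) 0 / (2 * \<i> * k)"
  have c0: "c \<noteq> 0" using jost_W_nonzero[OF kc(1) A] k0 by (simp add: c_def)
  have lim1: "((\<lambda>x. jost_left V k x - (c * plane_wave k x + d * plane_wave (- k) x)) \<longlongrightarrow> 0) at_bot"
    using right_jost_basis(3)[OF k left_jost_solves[OF kc(1)]] by (simp add: jost_left_eq[OF k] c_def d_def jost_W_def)
  have lim2: "((\<lambda>x. jost_right V k x - (c * plane_wave (- k) x + d' * plane_wave k x)) \<longlongrightarrow> 0) at_top"
    using left_jost_basis(2)[OF k right_jost_solves[OF kc(1)]] by (simp add: jost_right_eq[OF k] c_def d'_def jost_W_def)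
  have ex: "scattering_relations V k (1 / c) (d / c) (d' / c)"
    unfolding scattering_relations_def using lim1 lim2 c0 by (simp add: mult.commute)
  have uniq: "L = d / c \<and> R = d' / c" if s: "scattering_relations V k T L R" for T L R
  proof -
    have T: "T \<noteq> 0" using s by (simp add: scattering_relations_def)
    have "((\<lambda>x. (jost_left V k x - (c * plane_wave k x + d * plane_wave (- k) x)) -
      (jost_left V k x - (plane_wave k x / T + L / T * plane_wave (- k) x))) \<longlongrightarrow> 0 - 0) at_bot"
      using s by (intro tendsto_diff lim1) (auto simp: scattering_relations_def)
    then have "((\<lambda>x. (1 / T - c) * plane_wave k x + (L / T - d) * plane_wave (- k) x) \<longlongrightarrow> 0) at_bot"
      by (simp add: algebra_simps)
    from plane_wave_combination_tendsto_0[OF k0 this] have 1: "1 / T = c" "L / T = d" by auto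
    have "((\<lambda>x. (jost_right V k x - (c * plane_wave (- k) x + d' * plane_wave k x)) -
      (jost_right V k x - (plane_wave (- k) x / T + R / T * plane_wave k x))) \<longlongrightarrow> 0 - 0) at_top"
      using s by (intro tendsto_diff lim2) (auto simp: scattering_relations_def)
    then have "((\<lambda>x. (R / T - d') * plane_wave k x + (1 / T - c) * plane_wave (- k) x) \<longlongrightarrow> 0) at_top"
      by (simp add: algebra_simps)
    from plane_wave_combination_tendsto_0_at_top[OF k0 this] have 2: "R / T = d'" by auto
    show ?thesis using T by (simp add: 1(1)[symmetric] 1(2)[symmetric] 2[symmetric])
  qed
  have "left_reflection V k = d / c"
  proof -
    have "(THE L. \<exists>T R. scattering_relations V k T L R) = d / c"
      by (rule the_equality) (use ex uniq in blast)+
    then show ?thesis using k0 by (simp add: left_reflection_def left_reflection_nonzero_def)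
  qed
  then show "left_reflection V k = wronskian (left_jost V k) (left_jost' V k) (right_jost V (- k)) (right_jost' V (- k)) 0 / jost_W V k"
    using k0 by (simp add: c_def d_def)
  have "right_reflection V k = d' / c"
  proof -
    have "(THE R. \<exists>T L. scattering_relations V k T L R) = d' / c"
      by (rule the_equality) (use ex uniq in blast)+
    then show ?thesis using k0 by (simp add: right_reflection_def right_reflection_nonzero_def)
  qed
  then show "right_reflection V k = wronskian (left_jost V (- k)) (left_jost' V (- k)) (right_jost V k) (right_jost' V k) 0 / jost_W V k"
    using k0 by (simp add: c_def d'_def)
qed

lemma left_reflection_reflect:
  fixes k :: real
  assumes k: "K \<le> \<bar>k\<bar>" and A: "32 * A \<le> K"
  shows "left_reflection (\<lambda>x. V (- x)) k = right_reflection V k"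
proof -
  interpret R: jost_setup "\<lambda>x. V (- x)" K by (rule reflect)
  have A': "32 * R.A \<le> K" using A by (simp add: A_reflect)
  show ?thesis
    unfolding R.reflection_formulas(1)[OF k A'] reflection_formulas(2)[OF k A]
    by (simp add: jost_W_def wronskian_def left_jost_def left_jost'_def algebra_simps)
qed

text \<open>This is \<open>T f_l = f_r(-k) + L f_r(k)\<close> with \<open>T = 2 i k / W\<close>, the
  relation through which the reflection coefficient enters the transition matrix.\<close>

lemma left_jost_expansion:
  fixes k :: real
  assumes k: "K \<le> \<bar>k\<bar>" and A: "32 * A \<le> K"
  shows "left_jost V k x / jost_W V k = (right_jost V (- k) x + left_reflection V k * right_jost V k x) / (2 * \<i> * k)"
    and "left_jost' V k x / jost_W V k = (right_jost' V (- k) x + left_reflection V k * right_jost' V k x) / (2 * \<i> * k)"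
proof -
  note kc = real_upper_closed[OF k]
  have k0: "complex_of_real k \<noteq> 0" using k K by auto
  note W0 = jost_W_nonzero[OF kc(1) A]
  note b = right_jost_basis[OF k left_jost_solves[OF kc(1)], folded jost_W_def]
  show "left_jost V k x / jost_W V k = (right_jost V (- k) x + left_reflection V k * right_jost V k x) / (2 * \<i> * k)"
    by (subst b(1)) (use k0 W0 in \<open>simp add: reflection_formulas(1)[OF k A] field_simps\<close>)
  show "left_jost' V k x / jost_W V k = (right_jost' V (- k) x + left_reflection V k * right_jost' V k x) / (2 * \<i> * k)"
    by (subst b(2)) (use k0 W0 in \<open>simp add: reflection_formulas(1)[OF k A] field_simps\<close>)
qed

end

section \<open>The transition matrix between two potentials\<close>

text \<open>Each entry of the transition matrix is a difference of products of a solution for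
  \<open>U\<close> and a solution for \<open>V\<close>.\<close>

lemma solves_product_primitives:
  assumes y: "solves U k y y'" and z: "solves V k z z'"
  shows "primitive (\<lambda>x. y' x * z x + y x * z' x) (\<lambda>x. y x * z x)"
    and "primitive (\<lambda>x. y' x * z' x + (of_real (V x) - k\<^sup>2) * (y x * z x)) (\<lambda>x. y x * z' x)"
    and "primitive (\<lambda>x. (of_real (U x) - k\<^sup>2) * (y x * z x) + y' x * z' x) (\<lambda>x. y' x * z x)"
    and "primitive (\<lambda>x. (of_real (U x) - k\<^sup>2) * (y x * z' x) + (of_real (V x) - k\<^sup>2) * (y' x * z x)) (\<lambda>x. y' x * z' x)"
proof -
  note p = y[unfolded solves_def, THEN conjunct1] y[unfolded solves_def, THEN conjunct2]
    z[unfolded solves_def, THEN conjunct1] z[unfolded solves_def, THEN conjunct2]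
  show "primitive (\<lambda>x. y' x * z x + y x * z' x) (\<lambda>x. y x * z x)"
    by (rule primitive_cong[OF primitive_mult[OF p(1) p(3)]]) (simp_all add: algebra_simps)
  show "primitive (\<lambda>x. y' x * z' x + (of_real (V x) - k\<^sup>2) * (y x * z x)) (\<lambda>x. y x * z' x)"
    by (rule primitive_cong[OF primitive_mult[OF p(1) p(4)]]) (simp_all add: algebra_simps)
  show "primitive (\<lambda>x. (of_real (U x) - k\<^sup>2) * (y x * z x) + y' x * z' x) (\<lambda>x. y' x * z x)"
    by (rule primitive_cong[OF primitive_mult[OF p(2) p(3)]]) (simp_all add: algebra_simps)
  show "primitive (\<lambda>x. (of_real (U x) - k\<^sup>2) * (y x * z' x) + (of_real (V x) - k\<^sup>2) * (y' x * z x)) (\<lambda>x. y' x * z' x)"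
    by (rule primitive_cong[OF primitive_mult[OF p(2) p(4)]]) (simp_all add: algebra_simps)
qed

text \<open>The numerator of the difference is \<open>a + b + a b - e\<close>, at most
  \<open>5 \<delta> + \<delta>^2\<close>, and \<open>|1 + e|\<close> is at least \<open>5/8\<close>
  since \<open>3 \<delta> \<le> 3/8\<close>.\<close>

lemma norm_quotient_minus_1_le:
  fixes a b e :: complex
  assumes "norm a \<le> \<delta>" "norm b \<le> \<delta>" "norm e \<le> 3 * \<delta>" "\<delta> \<le> 1 / 8"
  shows "norm ((1 + a) * (1 + b) / (1 + e) - 1) \<le> 10 * \<delta>"
proof -
  have \<delta>: "0 \<le> \<delta>" using assms(1) norm_ge_zero order_trans by blast
  have e: "5 / 8 \<le> norm (1 + e)"
    using norm_triangle_ineq4[of "1 + e" e] assms(3,4) by simp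
  then have e0: "1 + e \<noteq> 0" by auto
  have "(1 + a) * (1 + b) / (1 + e) - 1 = (a + b + a * b - e) / (1 + e)"
    using e0 by (simp add: field_simps)
  also have "norm \<dots> \<le> (\<delta> + \<delta> + \<delta> * \<delta> + 3 * \<delta>) / norm (1 + e)"
    unfolding norm_divide using assms \<delta>
    by (intro divide_right_mono order_trans[OF norm_triangle_ineq4] order_trans[OF norm_triangle_ineq] add_mono
        order_trans[OF norm_mult_ineq] mult_mono) auto
  also have "\<dots> \<le> (\<delta> + \<delta> + \<delta> * \<delta> + 3 * \<delta>) / (5 / 8)"
    using e \<delta> by (intro divide_left_mono mult_pos_pos) auto
  also have "\<dots> \<le> 10 * \<delta>"
    using mult_right_mono[OF assms(4) \<delta>] \<delta> by simp
  finally show ?thesis .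
qed

text \<open>By evenness on the real axis \<open>F (- k)\<close> continues \<open>F\<close> into the
  lower half plane. The glued function is continuous across the axis and holomorphic off it, hence
  holomorphic outside a disc; in the variable \<open>w = 1 / k\<close> it is bounded, so the
  singularity at 0 is removable.\<close>

lemma even_extension_at_infinity:
  fixes F :: "complex \<Rightarrow> complex"
  assumes "0 < K" and cont: "continuous_on (upper_closed K) F" and hol: "F holomorphic_on upper_open K"
    and bound: "\<And>k. k \<in> upper_closed K \<Longrightarrow> norm (F k) \<le> B"
    and even: "\<And>k::real. K \<le> \<bar>k\<bar> \<Longrightarrow> F (- of_real k) = F (of_real k)"
  obtains \<Phi> where "\<Phi> holomorphic_on ball 0 (1 / K)" "\<And>w. w \<in> ball 0 (1 / K) \<Longrightarrow> norm (\<Phi> w) \<le> B"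
    "\<And>k. k \<in> upper_closed K \<Longrightarrow> K < norm k \<Longrightarrow> \<Phi> (1 / k) = F k \<and> \<Phi> (- 1 / k) = F k"
proof -
  define S where "S = {k::complex. K < norm k}"
  define G where "G k = (if Im k \<le> 0 then F (- k) else F k)" for k
  have opS: "open S" unfolding S_def by (intro open_Collect_less continuous_intros)
  have even': "F (- k) = F k" if "k \<in> S" "Im k = 0" for k
  proof -
    have "k = of_real (Re k)" using that by (simp add: complex_eq_iff)
    then show ?thesis using even[of "Re k"] that by (metis S_def mem_Collect_eq less_imp_le norm_of_real)
  qed
  have contG: "continuous_on S G"
    unfolding G_def
  proof (rule continuous_on_cases_le[where h = Im and a = 0])
    show "continuous_on {t \<in> S. Im t \<le> 0} (\<lambda>k. F (- k))"
      by (rule continuous_on_compose2[OF cont]) (auto simp: S_def upper_closed_def intro!: continuous_intros)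
    show "continuous_on {t \<in> S. 0 \<le> Im t} F"
      by (rule continuous_on_subset[OF cont]) (auto simp: S_def upper_closed_def)
  qed (auto simp: even' intro!: continuous_intros)
  have "G holomorphic_on S"
  \<comment> \<open>The inner product of \<open>\<i>\<close> with \<open>z\<close> is
    \<open>Im z\<close>, so the line in question is the real axis.\<close>
  proof (rule holomorphic_on_paste_across_line[OF opS, where d = \<i> and k = 0])
    show "G holomorphic_on (S \<inter> {z. \<i> \<bullet> z < 0})"
    proof (rule holomorphic_transform)
      have "(F \<circ> uminus) holomorphic_on (S \<inter> {z. \<i> \<bullet> z < 0})"
        by (rule holomorphic_on_compose_gen[OF _ hol])
           (auto simp: S_def upper_open_def inner_complex_def intro!: holomorphic_intros)
      then show "(\<lambda>k. F (- k)) holomorphic_on (S \<inter> {z. \<i> \<bullet> z < 0})" by (simp add: o_def)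
    qed (auto simp: G_def inner_complex_def)
    show "G holomorphic_on (S \<inter> {z. 0 < \<i> \<bullet> z})"
    proof (rule holomorphic_transform)
      show "F holomorphic_on (S \<inter> {z. 0 < \<i> \<bullet> z})"
        by (rule holomorphic_on_subset[OF hol]) (auto simp: S_def upper_open_def inner_complex_def)
    qed (auto simp: G_def inner_complex_def)
  qed (use contG in auto)
  then have hol0: "(G \<circ> (\<lambda>w. 1 / w)) holomorphic_on (ball 0 (1 / K) - {0})"
  proof (rule holomorphic_on_compose_gen[rotated])
    show "(\<lambda>w. 1 / w) holomorphic_on (ball 0 (1 / K) - {0})" by (intro holomorphic_intros) auto
    show "(\<lambda>w. 1 / w) ` (ball 0 (1 / K) - {0}) \<subseteq> S"
    proof (rule image_subsetI)
      fix w :: complex assume "w \<in> ball 0 (1 / K) - {0}"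
      then show "1 / w \<in> S" using \<open>0 < K\<close> by (simp add: S_def norm_divide field_simps)
    qed
  qed
  have Gb: "norm ((G \<circ> (\<lambda>w. 1 / w)) w) \<le> B" if "w \<in> ball 0 (1 / K) - {0}" for w
  proof -
    have "K < norm (1 / w)" using that \<open>0 < K\<close> by (simp add: norm_divide field_simps)
    then show ?thesis
      using bound[of "1 / w"] bound[of "- (1 / w)"] by (auto simp: G_def upper_closed_def)
  qed
  have ev: "eventually (\<lambda>w. w \<in> ball 0 (1 / K) - {0}) (at (0::complex))"
    using \<open>0 < K\<close> by (intro eventually_at_in_open) auto
  have z: "(0::complex) \<in> interior (ball 0 (1 / K))" using \<open>0 < K\<close> by simp
  have "\<exists>B. eventually (\<lambda>w. norm ((G \<circ> (\<lambda>w. 1 / w)) w) \<le> B) (at 0)"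
    by (rule exI[of _ B]) (rule eventually_mono[OF ev Gb])
  then obtain \<Phi> where \<Phi>: "\<Phi> holomorphic_on ball 0 (1 / K)"
    and \<Phi>G: "\<And>w. w \<in> ball 0 (1 / K) - {0} \<Longrightarrow> \<Phi> w = (G \<circ> (\<lambda>w. 1 / w)) w"
    using holomorphic_on_extend_bounded[OF hol0 z] by blast
  show thesis
  proof
    show "\<Phi> holomorphic_on ball 0 (1 / K)" by (rule \<Phi>)
    have "isCont \<Phi> 0"
      using holomorphic_on_imp_continuous_on[OF \<Phi>] \<open>0 < K\<close> by (simp add: continuous_on_eq_continuous_at)
    then have "((\<lambda>w. norm (\<Phi> w)) \<longlongrightarrow> norm (\<Phi> 0)) (at 0)" by (intro tendsto_norm) (simp add: isCont_def)
    moreover have "eventually (\<lambda>w. norm (\<Phi> w) \<le> B) (at 0)"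
      using ev by eventually_elim (simp add: \<Phi>G Gb del: o_apply)
    ultimately have "norm (\<Phi> 0) \<le> B" by (intro tendsto_upperbound) auto
    then show "norm (\<Phi> w) \<le> B" if "w \<in> ball 0 (1 / K)" for w
      using Gb[of w] \<Phi>G[of w] that by (cases "w = 0") auto
    fix k assume k: "k \<in> upper_closed K" "K < norm k"
    have "0 < norm k" using k \<open>0 < K\<close> by linarith
    then have "1 / norm k < 1 / K" using k \<open>0 < K\<close> by (intro divide_strict_left_mono mult_pos_pos) auto
    moreover have k0: "k \<noteq> 0" using k \<open>0 < K\<close> by auto
    ultimately have b: "1 / k \<in> ball 0 (1 / K) - {0}" "- 1 / k \<in> ball 0 (1 / K) - {0}"
      by (simp_all add: norm_divide)
    have "F (- k) = F k" if "Im k \<le> 0"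
      using even' k that by (auto simp: S_def upper_closed_def)
    then show "\<Phi> (1 / k) = F k \<and> \<Phi> (- 1 / k) = F k"
      using \<Phi>G[OF b(1)] \<Phi>G[OF b(2)] k k0 by (auto simp: G_def upper_closed_def)
  qed
qed

text \<open>Carries the equations to \<open>w = 0\<close>, to which no finite \<open>k\<close>
  corresponds.\<close>

lemma primitive_limit:
  fixes g :: "nat \<Rightarrow> real \<Rightarrow> complex"
  assumes prim: "\<And>n. primitive (g n) (G n)"
    and g: "\<And>t. (\<lambda>n. g n t) \<longlonglongrightarrow> g' t" and G: "\<And>x. (\<lambda>n. G n x) \<longlonglongrightarrow> G' x"
    and bound: "\<And>n t. norm (g n t) \<le> h t" and h: "\<And>a b. h absolutely_integrable_on {a..b}"
  shows "primitive g' G'"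
proof (rule primitiveI)
  fix a b :: real
  assume "a \<le> b"
  have hi: "h integrable_on {a..b}" using h by (simp add: absolutely_integrable_on_def)
  have gi: "g n integrable_on {a..b}" for n
    using primitive_absolutely_integrable[OF prim] by (simp add: absolutely_integrable_on_def)
  show "(g' has_integral (G' b - G' a)) {a..b}"
  proof (rule has_integral_dominated_convergence[OF primitive_has_integral[OF prim \<open>a \<le> b\<close>] hi])
    show "(\<lambda>n. G n b - G n a) \<longlonglongrightarrow> G' b - G' a" by (intro tendsto_diff G)
  qed (use bound g in auto)
  show "g' absolutely_integrable_on {a..b}"
  proof (rule absolutely_integrable_integrable_bound[OF _ _ hi])
    show "g' integrable_on {a..b}" by (rule dominated_convergence(1)[OF gi hi]) (use bound g in auto)
    show "norm (g' t) \<le> h t" for t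
      by (rule LIMSEQ_le_const2[OF tendsto_norm[OF g]]) (use bound in auto)
  qed
qed

section \<open>Taylor coefficients at 0\<close>

definition taylor_coeff :: "nat \<Rightarrow> (complex \<Rightarrow> complex) \<Rightarrow> complex" where
  "taylor_coeff n f = (deriv ^^ n) f 0 / fact n"

lemma taylor_coeff_fps:
  assumes "f has_fps_expansion F" shows "taylor_coeff n f = fps_nth F n"
  using fps_nth_fps_expansion[OF assms, of n] by (simp add: taylor_coeff_def)

lemma has_fps_expansion_taylor:
  assumes "0 < r" "f holomorphic_on ball 0 r"
  shows "f has_fps_expansion Abs_fps (\<lambda>n. taylor_coeff n f)"
proof -
  have "f has_fps_expansion fps_expansion f 0"
    by (rule has_fps_expansion_fps_expansion[of "ball 0 r"]) (use assms in auto)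
  moreover have "fps_expansion f 0 = Abs_fps (\<lambda>n. taylor_coeff n f)"
    by (simp add: fps_expansion_def taylor_coeff_def)
  ultimately show ?thesis by simp
qed

lemma taylor_coeff_0: "taylor_coeff 0 f = f 0"
  by (simp add: taylor_coeff_def)

context
  fixes r :: real and f g :: "complex \<Rightarrow> complex"
  assumes r: "0 < r" and f: "f holomorphic_on ball 0 r" and g: "g holomorphic_on ball 0 r"
begin

lemma taylor_coeff_add: "taylor_coeff n (\<lambda>w. f w + g w) = taylor_coeff n f + taylor_coeff n g"
  using taylor_coeff_fps[OF has_fps_expansion_add[OF has_fps_expansion_taylor[OF r f] has_fps_expansion_taylor[OF r g]]] by simp

lemma taylor_coeff_diff: "taylor_coeff n (\<lambda>w. f w - g w) = taylor_coeff n f - taylor_coeff n g"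
  using taylor_coeff_fps[OF has_fps_expansion_diff[OF has_fps_expansion_taylor[OF r f] has_fps_expansion_taylor[OF r g]]] by simp

lemma taylor_coeff_cmult: "taylor_coeff n (\<lambda>w. c * f w) = c * taylor_coeff n f"
  using taylor_coeff_fps[OF has_fps_expansion_cmult_left[OF has_fps_expansion_taylor[OF r f], of c]] by simp

lemma taylor_coeff_square_mult: "taylor_coeff n (\<lambda>w. w\<^sup>2 * f w) = (if n < 2 then 0 else taylor_coeff (n - 2) f)"
proof -
  have "(\<lambda>w::complex. w) has_fps_expansion fps_X" by (rule has_fps_expansion_fps_X)
  then have "(\<lambda>w. w\<^sup>2 * f w) has_fps_expansion fps_X\<^sup>2 * Abs_fps (\<lambda>n. taylor_coeff n f)"
    by (intro has_fps_expansion_mult has_fps_expansion_power has_fps_expansion_taylor[OF r f])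
  from taylor_coeff_fps[OF this] show ?thesis by (simp add: fps_X_power_mult_nth)
qed

lemma taylor_coeff_zero_imp:
  assumes "\<And>n. taylor_coeff n f = 0" "w \<in> ball 0 r" shows "f w = 0"
proof -
  have "(\<lambda>n. (deriv ^^ n) f 0 / fact n * (w - 0) ^ n) sums f w"
    by (rule holomorphic_power_series[OF f assms(2)])
  then have "(\<lambda>n. 0) sums f w" using assms(1) by (simp add: taylor_coeff_def)
  then show ?thesis using sums_unique2 sums_zero by blast
qed

end

text \<open>\<open>A\<close> bounds both integrals at once, so that the estimates for
  \<open>V\<close> and \<open>U\<close> have common constants, and \<open>1 \<le> K\<close> keeps
  the disc of radius \<open>1 / K\<close> inside the unit disc. The reflection coefficients are
  compared where the Neumann series represents the solutions.\<close>

locale jost_pair = V: jost_setup V K + U: jost_setup U K for V U K +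
  fixes A :: real
  assumes K1: "1 \<le> K" and A: "V.A \<le> A" "U.A \<le> A" "32 * A \<le> K"
    and same_reflection: "\<And>k::real. K \<le> \<bar>k\<bar> \<Longrightarrow> left_reflection U k = left_reflection V k"
begin

text \<open>
  The entries \<open>p\<close>, \<open>q\<close>, \<open>r\<close>, \<open>s\<close> of the transition matrix that carries the matrix with rows
  \<open>(T f\<^sub>l, f\<^sub>r)\<close> and \<open>(T f\<^sub>l', f\<^sub>r')\<close> for \<open>V\<close> to the one for \<open>U\<close>; recall \<open>T = 2 i k / W\<close>.
\<close>

definition "dp k x = right_jost U k x * (left_jost' V k x / jost_W V k) - left_jost U k x / jost_W U k * right_jost' V k x"
definition "dq k x = left_jost U k x / jost_W U k * right_jost V k x - right_jost U k x * (left_jost V k x / jost_W V k)"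
definition "dr k x = right_jost' U k x * (left_jost' V k x / jost_W V k) - left_jost' U k x / jost_W U k * right_jost' V k x"
definition "ds k x = left_jost' U k x / jost_W U k * right_jost V k x - right_jost' U k x * (left_jost V k x / jost_W V k)"

lemmas d_defs = dp_def dq_def dr_def ds_def

lemma V_A: "32 * V.A \<le> K" and U_A: "32 * U.A \<le> K"
  using A by linarith+

lemmas V_W = V.jost_W_nonzero[OF _ V_A] and U_W = U.jost_W_nonzero[OF _ U_A]

lemma dressing_det: "k \<in> upper_closed K \<Longrightarrow> dp k x * ds k x - dq k x * dr k x = 1"
proof -
  assume k: "k \<in> upper_closed K"
  have V1: "right_jost V k x * (left_jost' V k x / jost_W V k) - right_jost' V k x * (left_jost V k x / jost_W V k) = 1"
    using V.jost_W_eq[OF k, of x] V_W[OF k] by (simp add: wronskian_def diff_divide_distrib[symmetric])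
  have U1: "right_jost U k x * (left_jost' U k x / jost_W U k) - right_jost' U k x * (left_jost U k x / jost_W U k) = 1"
    using U.jost_W_eq[OF k, of x] U_W[OF k] by (simp add: wronskian_def diff_divide_distrib[symmetric])
  \<comment> \<open>Multiplicativity of the determinant for two by two matrices; both solution
    matrices are normalised by their Wronskians.\<close>
  have alg: "(b * d' - a * c') * (a' * c - b' * d) - (a * c - b * d) * (b' * d' - a' * c') = (c * d' - c' * d) * (b * a' - b' * a)"
    for a a' b b' c c' d d' :: complex by algebra
  show ?thesis unfolding d_defs alg V1 U1 by simp
qed

text \<open>The entries of the matrix equation, where \<open>A_V\<close> has the rows
  \<open>(0, 1)\<close> and \<open>(V - k^2, 0)\<close>.\<close>

lemma dressing_primitives:
  assumes k: "k \<in> upper_closed K"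
  shows "primitive (\<lambda>x. dr k x - (of_real (V x) - k\<^sup>2) * dq k x) (dp k)"
    and "primitive (\<lambda>x. ds k x - dp k x) (dq k)"
    and "primitive (\<lambda>x. (of_real (U x) - k\<^sup>2) * dp k x - (of_real (V x) - k\<^sup>2) * ds k x) (dr k)"
    and "primitive (\<lambda>x. (of_real (U x) - k\<^sup>2) * dq k x - dr k x) (ds k)"
proof -
  note a = solves_product_primitives[OF U.right_jost_solves[OF k] V.left_jost_solves[OF k], THEN primitive_cmult[of _ _ "1 / jost_W V k"]]
  note b = solves_product_primitives[OF U.left_jost_solves[OF k] V.right_jost_solves[OF k], THEN primitive_cmult[of _ _ "1 / jost_W U k"]]
  have W: "jost_W V k \<noteq> 0" "jost_W U k \<noteq> 0" using V_W[OF k] U_W[OF k] by auto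
  show "primitive (\<lambda>x. dr k x - (of_real (V x) - k\<^sup>2) * dq k x) (dp k)"
    by (rule primitive_cong[OF primitive_diff[OF a(2) b(2)]]) (use W in \<open>simp_all add: d_defs field_simps\<close>)
  show "primitive (\<lambda>x. ds k x - dp k x) (dq k)"
    by (rule primitive_cong[OF primitive_diff[OF b(1) a(1)]]) (use W in \<open>simp_all add: d_defs field_simps\<close>)
  show "primitive (\<lambda>x. (of_real (U x) - k\<^sup>2) * dp k x - (of_real (V x) - k\<^sup>2) * ds k x) (dr k)"
    by (rule primitive_cong[OF primitive_diff[OF a(4) b(4)]]) (use W in \<open>simp_all add: d_defs field_simps\<close>)
  show "primitive (\<lambda>x. (of_real (U x) - k\<^sup>2) * dq k x - dr k x) (ds k)"
    by (rule primitive_cong[OF primitive_diff[OF b(3) a(3)]]) (use W in \<open>simp_all add: d_defs field_simps\<close>)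
qed

text \<open>Every product pairs a right solution with a left one, so inserting
  \<open>E * E' = 1\<close> replaces all factors by normalised ones. Each resulting quotient differs
  from 1 by at most \<open>10 \<delta> = 40 A / |k|\<close>. On the diagonal two such quotients are
  averaged. Off the diagonal they are subtracted, so that the leading terms cancel: the prefactor of
  size \<open>|k| / 2\<close> then still leaves \<open>40 A\<close>, for \<open>k^2 q\<close> as
  well as for \<open>r\<close>.\<close>

lemma dressing_bounds:
  assumes k: "k \<in> upper_closed K"
  shows "norm (dp k x - 1) \<le> 40 * A / norm k" "norm (ds k x - 1) \<le> 40 * A / norm k"
    and "norm (k\<^sup>2 * dq k x) \<le> 40 * A" "norm (dr k x) \<le> 40 * A"
proof -
  have k0: "k \<noteq> 0" using V.k_nz k by blast
  have nk: "0 < norm k" "32 * A \<le> norm k" using A(3) k V.K by (auto simp: upper_closed_def)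
  define \<delta> where "\<delta> = 4 * A / norm k"
  have A0: "0 \<le> A" using A(1) V.A_nonneg by linarith
  have \<delta>: "\<delta> \<le> 1 / 8" using nk by (simp add: \<delta>_def pos_divide_le_eq)
  have le: "4 * V.A / norm k \<le> \<delta>" "4 * U.A / norm k \<le> \<delta>" "12 * V.A / norm k \<le> 3 * \<delta>" "12 * U.A / norm k \<le> 3 * \<delta>"
    using A nk by (auto simp: \<delta>_def intro!: divide_right_mono)
  define E where "E = exp (\<i> * k * of_real x)"
  define E' where "E' = exp (- (\<i> * k * of_real x))"
  have EE: "E * E' = 1" by (simp add: E_def E'_def exp_add[symmetric])
  define a1 where "a1 = E * right_jost U k x - 1"
  define b1 where "b1 = E * right_jost' U k x / (- (\<i> * k)) - 1"
  define c1 where "c1 = E' * left_jost U k x - 1"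
  define d1 where "d1 = E' * left_jost' U k x / (\<i> * k) - 1"
  define e1 where "e1 = jost_W U k / (2 * \<i> * k) - 1"
  define a2 where "a2 = E * right_jost V k x - 1"
  define b2 where "b2 = E * right_jost' V k x / (- (\<i> * k)) - 1"
  define c2 where "c2 = E' * left_jost V k x - 1"
  define d2 where "d2 = E' * left_jost' V k x / (\<i> * k) - 1"
  define e2 where "e2 = jost_W V k / (2 * \<i> * k) - 1"
  note n1 = U.right_jost_le[OF k, of x, folded E_def, folded a1_def b1_def, THEN order_trans[OF _ le(2)]]
    U.left_jost_le[OF k, of x, folded E'_def, folded c1_def d1_def, THEN order_trans[OF _ le(2)]]
    U.jost_W_estimate[OF k U_A, folded e1_def, THEN order_trans[OF _ le(4)]]
  note n2 = V.right_jost_le[OF k, of x, folded E_def, folded a2_def b2_def, THEN order_trans[OF _ le(1)]]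
    V.left_jost_le[OF k, of x, folded E'_def, folded c2_def d2_def, THEN order_trans[OF _ le(1)]]
    V.jost_W_estimate[OF k V_A, folded e2_def, THEN order_trans[OF _ le(3)]]
  define u1 where "u1 = 1 + e1"
  define u2 where "u2 = 1 + e2"
  have W: "u1 \<noteq> 0" "u2 \<noteq> 0"
    using V_W[OF k] U_W[OF k] k0 by (simp_all add: u1_def u2_def e1_def e2_def)
  have WU: "jost_W U k = 2 * \<i> * k * u1" and WV: "jost_W V k = 2 * \<i> * k * u2"
    using k0 by (simp_all add: u1_def u2_def e1_def e2_def)
  have f: "E * right_jost U k x = 1 + a1" "E * right_jost' U k x = - (\<i> * k) * (1 + b1)"
    "E' * left_jost U k x = 1 + c1" "E' * left_jost' U k x = \<i> * k * (1 + d1)"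
    "E * right_jost V k x = 1 + a2" "E * right_jost' V k x = - (\<i> * k) * (1 + b2)"
    "E' * left_jost V k x = 1 + c2" "E' * left_jost' V k x = \<i> * k * (1 + d2)"
    using k0 by (simp_all add: a1_def b1_def c1_def d1_def a2_def b2_def c2_def d2_def)
  have m1: "y * (z / w) = (E * y) * ((E' * z) / w)" and m2: "z / w * y = (E' * z) / w * (E * y)" for y z w
  proof -
    have "(E * y) * ((E' * z) / w) = (E * E') * (y * (z / w))" by (simp only: divide_inverse mult_ac)
    then show "y * (z / w) = (E * y) * ((E' * z) / w)" by (simp only: EE mult_1)
    have "(E' * z) / w * (E * y) = (E * E') * (z / w * y)" by (simp only: divide_inverse mult_ac)
    then show "z / w * y = (E' * z) / w * (E * y)" by (simp only: EE mult_1)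
  qed
  have half: "norm (k / (2 * \<i>) * X) \<le> 40 * A" if "norm X \<le> 80 * A / norm k" for X
  proof -
    have "norm (k / (2 * \<i>) * X) = norm k / 2 * norm X" by (simp add: norm_mult norm_divide)
    also have "\<dots> \<le> norm k / 2 * (80 * A / norm k)" using that by (intro mult_left_mono) auto
    finally show ?thesis using nk by simp
  qed
  note Q1 = norm_quotient_minus_1_le[OF _ _ n1(5) \<delta>, folded u1_def]
  note Q2 = norm_quotient_minus_1_le[OF _ _ n2(5) \<delta>, folded u2_def]
  have p: "dp k x - 1 = (((1 + a1) * (1 + d2) / u2 - 1) + ((1 + c1) * (1 + b2) / u1 - 1)) / 2"
    unfolding dp_def m1[of "right_jost U k x"] m2[of "left_jost U k x"] f WU WV using W k0 by (simp add: field_simps)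
  show "norm (dp k x - 1) \<le> 40 * A / norm k"
    unfolding p using norm_triangle_mono[OF Q2[OF n1(1) n2(4)] Q1[OF n1(3) n2(2)]]
    by (simp add: norm_divide \<delta>_def)
  have s: "ds k x - 1 = (((1 + d1) * (1 + a2) / u1 - 1) + ((1 + b1) * (1 + c2) / u2 - 1)) / 2"
    unfolding ds_def m1[of "right_jost' U k x"] m2[of "left_jost' U k x"] f WU WV using W k0 by (simp add: field_simps)
  show "norm (ds k x - 1) \<le> 40 * A / norm k"
    unfolding s using norm_triangle_mono[OF Q1[OF n1(4) n2(1)] Q2[OF n1(2) n2(3)]]
    by (simp add: norm_divide \<delta>_def)
  have q: "k\<^sup>2 * dq k x = k / (2 * \<i>) * (((1 + c1) * (1 + a2) / u1 - 1) - ((1 + a1) * (1 + c2) / u2 - 1))"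
    unfolding dq_def m1[of "right_jost U k x"] m2[of "left_jost U k x"] f WU WV using W k0 by (simp add: field_simps power2_eq_square)
  have "norm (((1 + c1) * (1 + a2) / u1 - 1) - ((1 + a1) * (1 + c2) / u2 - 1)) \<le> 80 * A / norm k"
    using norm_triangle_le_diff[OF add_mono[OF Q1[OF n1(3) n2(1)] Q2[OF n1(1) n2(3)]]] by (simp add: \<delta>_def)
  then show "norm (k\<^sup>2 * dq k x) \<le> 40 * A"
    unfolding q by (rule half)
  have r: "dr k x = k / (2 * \<i>) * (((1 + b1) * (1 + d2) / u2 - 1) - ((1 + d1) * (1 + b2) / u1 - 1))"
    unfolding dr_def m1[of "right_jost' U k x"] m2[of "left_jost' U k x"] f WU WV using W k0 by (simp add: field_simps)
  have "norm (((1 + b1) * (1 + d2) / u2 - 1) - ((1 + d1) * (1 + b2) / u1 - 1)) \<le> 80 * A / norm k"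
    using norm_triangle_le_diff[OF add_mono[OF Q2[OF n1(2) n2(4)] Q1[OF n1(4) n2(2)]]] by (simp add: \<delta>_def)
  then show "norm (dr k x) \<le> 40 * A"
    unfolding r by (rule half)
qed

lemma dressing_even:
  fixes k :: real
  assumes k: "K \<le> \<bar>k\<bar>"
  shows "dp (- of_real k) x = dp (of_real k) x" "dq (- of_real k) x = dq (of_real k) x"
    "dr (- of_real k) x = dr (of_real k) x" "ds (- of_real k) x = ds (of_real k) x"
proof -
  \<comment> \<open>After the expansion of the left solutions the terms with the common reflection
    coefficient cancel in each entry. The remaining numerators and the denominator are all odd in
    \<open>j\<close>.\<close>
  have *: "dp (of_real j) x = (right_jost U j x * right_jost' V (- j) x - right_jost U (- j) x * right_jost' V j x) / (2 * \<i> * j)"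
    "dq (of_real j) x = (right_jost U (- j) x * right_jost V j x - right_jost U j x * right_jost V (- j) x) / (2 * \<i> * j)"
    "dr (of_real j) x = (right_jost' U j x * right_jost' V (- j) x - right_jost' U (- j) x * right_jost' V j x) / (2 * \<i> * j)"
    "ds (of_real j) x = (right_jost' U (- j) x * right_jost V j x - right_jost' U j x * right_jost V (- j) x) / (2 * \<i> * j)"
    if j: "K \<le> \<bar>j\<bar>" for j :: real
  proof -
    have "complex_of_real j \<noteq> 0" using j V.K by auto
    then show "dp (of_real j) x = (right_jost U j x * right_jost' V (- j) x - right_jost U (- j) x * right_jost' V j x) / (2 * \<i> * j)"
      "dq (of_real j) x = (right_jost U (- j) x * right_jost V j x - right_jost U j x * right_jost V (- j) x) / (2 * \<i> * j)"
      "dr (of_real j) x = (right_jost' U j x * right_jost' V (- j) x - right_jost' U (- j) x * right_jost' V j x) / (2 * \<i> * j)"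
      "ds (of_real j) x = (right_jost' U (- j) x * right_jost V j x - right_jost' U j x * right_jost V (- j) x) / (2 * \<i> * j)"
      unfolding d_defs V.left_jost_expansion[OF j V_A] U.left_jost_expansion[OF j U_A] same_reflection[OF j]
      by (simp_all add: field_simps)
  qed
  have k': "K \<le> \<bar>- k\<bar>" using k by simp
  have sw: "(a - b) / (2 * \<i> * of_real (- k)) = (b - a) / (2 * \<i> * of_real k)" for a b :: complex
    using k V.K by (simp add: field_simps)
  show "dp (- of_real k) x = dp (of_real k) x" "dq (- of_real k) x = dq (of_real k) x"
    "dr (- of_real k) x = dr (of_real k) x" "ds (- of_real k) x = ds (of_real k) x"
    unfolding of_real_minus[symmetric] *[OF k'] sw *[OF k] by simp_all
qed

lemma jost_W_regularity:
  "continuous_on (upper_closed K) (jost_W V)" "jost_W V holomorphic_on upper_open K"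
  "continuous_on (upper_closed K) (jost_W U)" "jost_W U holomorphic_on upper_open K"
  unfolding jost_W_def[abs_def] wronskian_def
  by (intro continuous_intros holomorphic_intros V.right_jost_continuous V.left_jost_continuous
      U.right_jost_continuous U.left_jost_continuous V.right_jost_holomorphic V.left_jost_holomorphic
      U.right_jost_holomorphic U.left_jost_holomorphic)+

lemma dressing_regularity:
  "continuous_on (upper_closed K) (\<lambda>k. dp k x)" "(\<lambda>k. dp k x) holomorphic_on upper_open K"
  "continuous_on (upper_closed K) (\<lambda>k. dq k x)" "(\<lambda>k. dq k x) holomorphic_on upper_open K"
  "continuous_on (upper_closed K) (\<lambda>k. dr k x)" "(\<lambda>k. dr k x) holomorphic_on upper_open K"
  "continuous_on (upper_closed K) (\<lambda>k. ds k x)" "(\<lambda>k. ds k x) holomorphic_on upper_open K"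
  unfolding d_defs
  by (intro continuous_intros holomorphic_intros V.right_jost_continuous V.left_jost_continuous
      U.right_jost_continuous U.left_jost_continuous V.right_jost_holomorphic V.left_jost_holomorphic
      U.right_jost_holomorphic U.left_jost_holomorphic jost_W_regularity ballI V_W U_W | erule subsetD[OF upper_open_subset] | assumption)+

end

section \<open>Expansion at infinity\<close>

lemma even_extension_family:
  fixes F :: "complex \<Rightarrow> real \<Rightarrow> complex"
  assumes "0 < K" "\<And>x. continuous_on (upper_closed K) (\<lambda>k. F k x)" "\<And>x. (\<lambda>k. F k x) holomorphic_on upper_open K"
    and "\<And>k x. k \<in> upper_closed K \<Longrightarrow> norm (F k x) \<le> B"
    and "\<And>(k::real) x. K \<le> \<bar>k\<bar> \<Longrightarrow> F (- of_real k) x = F (of_real k) x"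
  obtains \<Phi> where "\<And>x. (\<lambda>w. \<Phi> w x) holomorphic_on ball 0 (1 / K)"
    "\<And>w x. w \<in> ball 0 (1 / K) \<Longrightarrow> norm (\<Phi> w x) \<le> B"
    "\<And>k x. k \<in> upper_closed K \<Longrightarrow> K < norm k \<Longrightarrow> \<Phi> (1 / k) x = F k x \<and> \<Phi> (- 1 / k) x = F k x"
proof -
  have "\<forall>x. \<exists>\<phi>. \<phi> holomorphic_on ball 0 (1 / K) \<and> (\<forall>w\<in>ball 0 (1 / K). norm (\<phi> w) \<le> B) \<and>
    (\<forall>k\<in>upper_closed K. K < norm k \<longrightarrow> \<phi> (1 / k) = F k x \<and> \<phi> (- 1 / k) = F k x)"
  proof
    fix x
    obtain \<phi> where "\<phi> holomorphic_on ball 0 (1 / K)" "\<And>w. w \<in> ball 0 (1 / K) \<Longrightarrow> norm (\<phi> w) \<le> B"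
      "\<And>k. k \<in> upper_closed K \<Longrightarrow> K < norm k \<Longrightarrow> \<phi> (1 / k) = F k x \<and> \<phi> (- 1 / k) = F k x"
      by (rule even_extension_at_infinity[of K "\<lambda>k. F k x" B]) (use assms in blast)+
    then show "\<exists>\<phi>. \<phi> holomorphic_on ball 0 (1 / K) \<and> (\<forall>w\<in>ball 0 (1 / K). norm (\<phi> w) \<le> B) \<and>
      (\<forall>k\<in>upper_closed K. K < norm k \<longrightarrow> \<phi> (1 / k) = F k x \<and> \<phi> (- 1 / k) = F k x)" by blast
  qed
  then obtain \<phi> where "\<forall>x. \<phi> x holomorphic_on ball 0 (1 / K) \<and> (\<forall>w\<in>ball 0 (1 / K). norm (\<phi> x w) \<le> B) \<and>
    (\<forall>k\<in>upper_closed K. K < norm k \<longrightarrow> \<phi> x (1 / k) = F k x \<and> \<phi> x (- 1 / k) = F k x)"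
    by (rule choice[THEN exE])
  then show thesis by (intro that[of "\<lambda>w x. \<phi> x w"]) blast+
qed

text \<open>Supplies the values of the diagonal entries at \<open>w = 0\<close>, where the estimate
  in \<open>1 / |k|\<close> is available only as a limit.\<close>

lemma holomorphic_value_at_0:
  assumes "0 < r" and f: "f holomorphic_on ball 0 r"
    and bound: "\<And>w. w \<in> ball 0 r - {0} \<Longrightarrow> norm (f w - c) \<le> C * norm w"
  shows "f 0 = c"
proof -
  have ev: "eventually (\<lambda>w. w \<in> ball 0 r - {0}) (at (0::complex))"
    using \<open>0 < r\<close> by (intro eventually_at_in_open) auto
  have "isCont f 0"
    using holomorphic_on_imp_continuous_on[OF f] \<open>0 < r\<close> by (simp add: continuous_on_eq_continuous_at)
  then have 1: "(f \<longlongrightarrow> f 0) (at 0)" by (simp add: isCont_def)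
  have "((\<lambda>w::complex. C * norm w) \<longlongrightarrow> C * norm (0::complex)) (at 0)" by (intro tendsto_intros)
  then have "((\<lambda>w::complex. C * norm w) \<longlongrightarrow> 0) (at 0)" by simp
  then have "((\<lambda>w. f w - c) \<longlongrightarrow> 0) (at 0)"
    by (rule Lim_null_comparison[rotated]) (use ev in eventually_elim, rule bound)
  then have "(f \<longlongrightarrow> c) (at 0)" by (rule LIM_zero_cancel)
  then show ?thesis using 1 tendsto_unique[OF _ 1] by auto
qed

lemma primitive_const_on:
  fixes G :: "real \<Rightarrow> 'a::euclidean_space"
  assumes G: "primitive g G" and ae: "AE x in lebesgue. x \<in> {a<..<b} \<longrightarrow> g x = 0"
    and x: "x \<in> {a<..<b}" "y \<in> {a<..<b}"
  shows "G x = G y"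
proof -
  obtain N where N: "N \<in> null_sets lebesgue" "{x \<in> space lebesgue. \<not> (x \<in> {a<..<b} \<longrightarrow> g x = 0)} \<subseteq> N"
    using ae by (auto simp: eventually_ae_filter)
  have neg: "negligible N" using N negligible_iff_null_sets by blast
  have N': "g x = 0" if "x \<in> {a<..<b}" "x \<notin> N" for x
    using N(2) that by auto
  have *: "G v = G u" if "u \<le> v" "u \<in> {a<..<b}" "v \<in> {a<..<b}" for u v
  proof -
    have "((\<lambda>_. 0) has_integral (G v - G u)) {u..v}"
      by (rule has_integral_spike[OF neg _ primitive_has_integral[OF G that(1)]]) (use that in \<open>auto simp: N'\<close>)
    then have "G v - G u = 0" using has_integral_0 has_integral_unique by blast
    then show ?thesis by simp
  qed
  show ?thesis using *[of x y] *[of y x] x by (cases "x \<le> y") auto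
qed

lemma primitive_ae_zero_on:
  assumes G: "primitive g G" and c: "\<And>x. x \<in> {a<..<b} \<Longrightarrow> G x = c"
  shows "AE x in lebesgue. x \<in> {a<..<b} \<longrightarrow> g x = 0"
  using primitive_ae_vector_derivative[OF G]
proof eventually_elim
  case (elim x)
  show ?case
  proof
    assume x: "x \<in> {a<..<b}"
    have "((\<lambda>_. c) has_vector_derivative g x) (at x)"
      by (rule has_vector_derivative_transform_within_open[OF elim _ x]) (use c in auto)
    then show "g x = 0" using vector_derivative_unique_at has_vector_derivative_const by blast
  qed
qed

lemma continuous_ae_zero_on:
  fixes f :: "real \<Rightarrow> 'a::real_normed_vector"
  assumes f: "continuous_on UNIV f" and ae: "AE x in lebesgue. x \<in> {a<..<b} \<longrightarrow> f x = 0"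
    and x: "x \<in> {a<..<b}"
  shows "f x = 0"
proof (rule ccontr)
  assume "f x \<noteq> 0"
  have "open ({y. f y \<noteq> 0} \<inter> {a<..<b})"
    by (intro open_Int open_Collect_neq f continuous_on_const) auto
  moreover have "{y. f y \<noteq> 0} \<inter> {a<..<b} \<noteq> {}" using \<open>f x \<noteq> 0\<close> x by blast
  ultimately have "\<not> negligible ({y. f y \<noteq> 0} \<inter> {a<..<b})" by (rule open_not_negligible)
  moreover have "negligible ({y. f y \<noteq> 0} \<inter> {a<..<b})"
  proof -
    obtain N where N: "N \<in> null_sets lebesgue" "{x \<in> space lebesgue. \<not> (x \<in> {a<..<b} \<longrightarrow> f x = 0)} \<subseteq> N"
      using ae by (auto simp: eventually_ae_filter)
    then have "{y. f y \<noteq> 0} \<inter> {a<..<b} \<subseteq> N" by auto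
    moreover have "negligible N" using N negligible_iff_null_sets by blast
    ultimately show ?thesis using negligible_subset by blast
  qed
  ultimately show False by blast
qed

text \<open>Serves on both sides of a base point, hence the minimum, the maximum and the absolute
  value.\<close>

lemma primitive_diff_le:
  fixes G :: "real \<Rightarrow> 'a::euclidean_space"
  assumes G: "primitive g G" and H: "primitive h H" and M: "0 \<le> M"
    and le: "\<And>t. t \<in> {min x y..max x y} \<Longrightarrow> norm (g t) \<le> M * h t"
  shows "norm (G x - G y) \<le> M * \<bar>H x - H y\<bar>"
proof -
  have *: "norm (G v - G u) \<le> M * \<bar>H v - H u\<bar>" if "u \<le> v" "{u..v} = {min x y..max x y}" for u v
  proof -
    have "norm (G v - G u) = norm (integral {u..v} g)" by (simp add: primitive_integral[OF G that(1)])
    also have "\<dots> \<le> integral {u..v} (\<lambda>t. M * h t)"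
    proof (rule integral_norm_bound_integral)
      show "g integrable_on {u..v}" using primitive_absolutely_integrable[OF G] by (simp add: absolutely_integrable_on_def)
      show "(\<lambda>t. M * h t) integrable_on {u..v}"
        using primitive_absolutely_integrable[OF primitive_cmult[OF H]] by (simp add: absolutely_integrable_on_def)
    qed (use le that in auto)
    also have "\<dots> = M * (H v - H u)"
      using primitive_integral[OF primitive_cmult[OF H, of M] that(1)] by (simp add: algebra_simps)
    also have "\<dots> \<le> M * \<bar>H v - H u\<bar>" using M by (intro mult_left_mono) auto
    finally show ?thesis .
  qed
  show ?thesis
  proof (cases "y \<le> x")
    case True
    then show ?thesis using *[of y x] by simp
  next
    case False
    then show ?thesis using *[of x y] by (simp add: norm_minus_commute abs_minus_commute)
  qed
qed

lemma integrable_abs_primitive: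
  fixes V :: "real \<Rightarrow> real"
  assumes "integrable lebesgue V"
  shows "\<exists>F. primitive (\<lambda>x. \<bar>V x\<bar>) F"
proof
  have V: "integrable lebesgue (\<lambda>x. \<bar>V x\<bar>)" using assms by simp
  show "primitive (\<lambda>x. \<bar>V x\<bar>) (\<lambda>x. LINT t:{..x}|lebesgue. \<bar>V t\<bar>)"
    by (rule primitive_integral_atMost)
       (use integrable_mult_indicator[OF _ V] in \<open>simp add: set_integrable_def\<close>)
qed

text \<open>
  In terms of \<open>w = 1 / k\<close> the entries \<open>P\<close>, \<open>Q = k\<^sup>2 q\<close>, \<open>R\<close>, \<open>S\<close> of the transition matrix are
  holomorphic near \<open>w = 0\<close>; their equations in \<open>x\<close> are written without negative powers of \<open>w\<close>.
\<close>

locale dressing =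
  fixes V U :: "real \<Rightarrow> real" and P Q R S :: "complex \<Rightarrow> real \<Rightarrow> complex" and \<rho> B :: real
  assumes V: "integrable lebesgue V" and U: "integrable lebesgue U"
    and \<rho>: "0 < \<rho>" "\<rho> \<le> 1"
    and hol: "\<And>x. (\<lambda>w. P w x) holomorphic_on ball 0 \<rho>" "\<And>x. (\<lambda>w. Q w x) holomorphic_on ball 0 \<rho>"
      "\<And>x. (\<lambda>w. R w x) holomorphic_on ball 0 \<rho>" "\<And>x. (\<lambda>w. S w x) holomorphic_on ball 0 \<rho>"
    and bound: "\<And>w x. w \<in> ball 0 \<rho> \<Longrightarrow> norm (P w x) \<le> B" "\<And>w x. w \<in> ball 0 \<rho> \<Longrightarrow> norm (Q w x) \<le> B"
      "\<And>w x. w \<in> ball 0 \<rho> \<Longrightarrow> norm (R w x) \<le> B" "\<And>w x. w \<in> ball 0 \<rho> \<Longrightarrow> norm (S w x) \<le> B"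
    and P_near_1: "\<And>w x. w \<in> ball 0 \<rho> \<Longrightarrow> norm (P w x - 1) < 2"
    and at_0: "\<And>x. P 0 x = 1" "\<And>x. S 0 x = 1"
    and det_punctured: "\<And>w x. w \<in> ball 0 \<rho> - {0} \<Longrightarrow> P w x * S w x - w\<^sup>2 * (Q w x * R w x) = 1"
    and prim_punctured: "\<And>w. w \<in> ball 0 \<rho> - {0} \<Longrightarrow> primitive (\<lambda>x. R w x + Q w x - w\<^sup>2 * (of_real (V x) * Q w x)) (P w)"
      "\<And>w. w \<in> ball 0 \<rho> - {0} \<Longrightarrow> primitive (\<lambda>x. S w x - P w x) (\<lambda>x. w\<^sup>2 * Q w x)"
      "\<And>w. w \<in> ball 0 \<rho> - {0} \<Longrightarrow> primitive (\<lambda>x. of_real (U x) * P w x - of_real (V x) * S w x) (\<lambda>x. R w x - Q w x)"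
      "\<And>w. w \<in> ball 0 \<rho> - {0} \<Longrightarrow> primitive (\<lambda>x. w\<^sup>2 * (of_real (U x) * Q w x) - (Q w x + R w x)) (S w)"
begin

lemma B_nonneg: "0 \<le> B"
  using bound(1)[of 0 0] \<rho> norm_ge_zero[of "P 0 0"] by (simp del: norm_ge_zero)

lemma norm_square_le: "w \<in> ball 0 \<rho> \<Longrightarrow> norm ((w::complex)\<^sup>2) \<le> 1"
  using \<rho> by (simp add: norm_power power_le_one)

lemma majorant_integrable: "(\<lambda>t. c + d * \<bar>V t\<bar> + e * \<bar>U t\<bar>) absolutely_integrable_on {a..b}"
proof -
  have "(\<lambda>t. \<bar>V t\<bar>) absolutely_integrable_on {a..b}" "(\<lambda>t. \<bar>U t\<bar>) absolutely_integrable_on {a..b}"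
    using integrable_abs_primitive[OF V] integrable_abs_primitive[OF U]
    by (auto intro: primitive_absolutely_integrable)
  then show ?thesis
    by (intro set_integral_add(1) set_integrable_mult_right absolutely_integrable_on_const) auto
qed

lemma det: "w \<in> ball 0 \<rho> \<Longrightarrow> P w x * S w x - w\<^sup>2 * (Q w x * R w x) = 1"
  using det_punctured[of w x] by (cases "w = 0") (simp_all add: at_0)

text \<open>The zero coefficients give all four majorants the common shape of
  \<open>majorant_integrable\<close>.\<close>

lemma integrand_bounds:
  assumes w: "w \<in> ball 0 \<rho>"
  shows "norm (R w t + Q w t - w\<^sup>2 * (of_real (V t) * Q w t)) \<le> 2 * B + B * \<bar>V t\<bar> + 0 * \<bar>U t\<bar>"
    and "norm (S w t - P w t) \<le> 2 * B + 0 * \<bar>V t\<bar> + 0 * \<bar>U t\<bar>"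
    and "norm (of_real (U t) * P w t - of_real (V t) * S w t) \<le> 0 + B * \<bar>V t\<bar> + B * \<bar>U t\<bar>"
    and "norm (w\<^sup>2 * (of_real (U t) * Q w t) - (Q w t + R w t)) \<le> 2 * B + 0 * \<bar>V t\<bar> + B * \<bar>U t\<bar>"
proof -
  note b = bound(1)[OF w, of t] bound(2)[OF w, of t] bound(3)[OF w, of t] bound(4)[OF w, of t]
  have sq: "norm (w\<^sup>2 * (of_real v * Q w t)) \<le> B * \<bar>v\<bar>" for v
    using mult_mono[OF norm_square_le[OF w] mult_left_mono[OF b(2), of "\<bar>v\<bar>"]] B_nonneg
    by (simp add: norm_mult mult.commute)
  have v: "norm (of_real v * P w t) \<le> B * \<bar>v\<bar>" "norm (of_real v * S w t) \<le> B * \<bar>v\<bar>" for v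
    using mult_left_mono[OF b(1), of "\<bar>v\<bar>"] mult_left_mono[OF b(4), of "\<bar>v\<bar>"]
    by (simp_all add: norm_mult mult.commute)
  show "norm (R w t + Q w t - w\<^sup>2 * (of_real (V t) * Q w t)) \<le> 2 * B + B * \<bar>V t\<bar> + 0 * \<bar>U t\<bar>"
    using norm_triangle_le_diff[OF add_mono[OF norm_triangle_le[OF add_mono[OF b(3) b(2)]] sq[of "V t"]]] by simp
  show "norm (S w t - P w t) \<le> 2 * B + 0 * \<bar>V t\<bar> + 0 * \<bar>U t\<bar>"
    using norm_triangle_le_diff[OF add_mono[OF b(4) b(1)]] by simp
  show "norm (of_real (U t) * P w t - of_real (V t) * S w t) \<le> 0 + B * \<bar>V t\<bar> + B * \<bar>U t\<bar>"
    using norm_triangle_le_diff[OF add_mono[OF v(1)[of "U t"] v(2)[of "V t"]]] by simp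
  show "norm (w\<^sup>2 * (of_real (U t) * Q w t) - (Q w t + R w t)) \<le> 2 * B + 0 * \<bar>V t\<bar> + B * \<bar>U t\<bar>"
    using norm_triangle_le_diff[OF add_mono[OF sq[of "U t"] norm_triangle_le[OF add_mono[OF b(2) b(3)]]]] by simp
qed

lemma prim:
  assumes w: "w \<in> ball 0 \<rho>"
  shows "primitive (\<lambda>x. R w x + Q w x - w\<^sup>2 * (of_real (V x) * Q w x)) (P w)"
    and "primitive (\<lambda>x. S w x - P w x) (\<lambda>x. w\<^sup>2 * Q w x)"
    and "primitive (\<lambda>x. of_real (U x) * P w x - of_real (V x) * S w x) (\<lambda>x. R w x - Q w x)"
    and "primitive (\<lambda>x. w\<^sup>2 * (of_real (U x) * Q w x) - (Q w x + R w x)) (S w)"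
proof -
  \<comment> \<open>A sequence in the punctured disc tending to 0, along which the four equations
    pass to the limit.\<close>
  define s where "s n = complex_of_real (\<rho> / 2 * inverse (real (Suc n)))" for n
  have s: "s n \<in> ball 0 \<rho> - {0}" for n
  proof -
    have "inverse (real (Suc n)) \<le> 1" by (rule inverse_le_1_iff[THEN iffD2]) simp
    then have "\<rho> / 2 * inverse (real (Suc n)) \<le> \<rho> / 2 * 1" using \<rho> by (intro mult_left_mono) auto
    moreover have "0 < \<rho> / 2 * inverse (real (Suc n))" using \<rho> by simp
    ultimately have "0 < \<rho> / 2 * inverse (real (Suc n))" "\<rho> / 2 * inverse (real (Suc n)) < \<rho>"
      using \<rho>(1) by linarith+
    then show ?thesis unfolding s_def by (simp del: of_nat_Suc of_real_mult of_real_inverse)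
  qed
  then have sb: "s n \<in> ball 0 \<rho>" for n by blast
  have "s \<longlonglongrightarrow> of_real (\<rho> / 2 * 0)"
    unfolding s_def by (intro tendsto_intros LIMSEQ_inverse_real_of_nat)
  then have s0: "s \<longlonglongrightarrow> 0" by simp
  have lim: "(\<lambda>n. f (s n)) \<longlonglongrightarrow> f 0" if "f holomorphic_on ball 0 \<rho>" for f
  proof (rule isCont_tendsto_compose[OF _ s0])
    show "isCont f 0"
      using holomorphic_on_imp_continuous_on[OF that] \<rho> by (simp add: continuous_on_eq_continuous_at)
  qed
  note L = lim[OF hol(1)] lim[OF hol(2)] lim[OF hol(3)] lim[OF hol(4)]
  have z1: "primitive (\<lambda>x. R 0 x + Q 0 x - 0\<^sup>2 * (of_real (V x) * Q 0 x)) (P 0)"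
    by (rule primitive_limit[where g = "\<lambda>n x. R (s n) x + Q (s n) x - (s n)\<^sup>2 * (of_real (V x) * Q (s n) x)" and G = "\<lambda>n. P (s n)",
        OF prim_punctured(1)[OF s] _ _ integrand_bounds(1)[OF sb] majorant_integrable])
       (intro tendsto_intros L s0)+
  have z2: "primitive (\<lambda>x. S 0 x - P 0 x) (\<lambda>x. 0\<^sup>2 * Q 0 x)"
    by (rule primitive_limit[where g = "\<lambda>n x. S (s n) x - P (s n) x" and G = "\<lambda>n x. (s n)\<^sup>2 * Q (s n) x",
        OF prim_punctured(2)[OF s] _ _ integrand_bounds(2)[OF sb] majorant_integrable])
       (intro tendsto_intros L s0)+
  have z3: "primitive (\<lambda>x. of_real (U x) * P 0 x - of_real (V x) * S 0 x) (\<lambda>x. R 0 x - Q 0 x)"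
    by (rule primitive_limit[where g = "\<lambda>n x. of_real (U x) * P (s n) x - of_real (V x) * S (s n) x" and G = "\<lambda>n x. R (s n) x - Q (s n) x",
        OF prim_punctured(3)[OF s] _ _ integrand_bounds(3)[OF sb] majorant_integrable])
       (intro tendsto_intros L s0)+
  have z4: "primitive (\<lambda>x. 0\<^sup>2 * (of_real (U x) * Q 0 x) - (Q 0 x + R 0 x)) (S 0)"
    by (rule primitive_limit[where g = "\<lambda>n x. (s n)\<^sup>2 * (of_real (U x) * Q (s n) x) - (Q (s n) x + R (s n) x)" and G = "\<lambda>n. S (s n)",
        OF prim_punctured(4)[OF s] _ _ integrand_bounds(4)[OF sb] majorant_integrable])
       (intro tendsto_intros L s0)+
  show "primitive (\<lambda>x. R w x + Q w x - w\<^sup>2 * (of_real (V x) * Q w x)) (P w)"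
    "primitive (\<lambda>x. S w x - P w x) (\<lambda>x. w\<^sup>2 * Q w x)"
    "primitive (\<lambda>x. of_real (U x) * P w x - of_real (V x) * S w x) (\<lambda>x. R w x - Q w x)"
    "primitive (\<lambda>x. w\<^sup>2 * (of_real (U x) * Q w x) - (Q w x + R w x)) (S w)"
    using prim_punctured[of w] z1 z2 z3 z4 w by (cases "w = 0"; simp)+
qed

definition "cP n x = taylor_coeff n (\<lambda>w. P w x)"
definition "cQ n x = taylor_coeff n (\<lambda>w. Q w x)"
definition "cR n x = taylor_coeff n (\<lambda>w. R w x)"
definition "cS n x = taylor_coeff n (\<lambda>w. S w x)"
definition "cQ2 n x = (if n < 2 then 0 else cQ (n - 2) x)"

lemma entry_combinations_holomorphic: "(\<lambda>w. of_real v * P w x) holomorphic_on ball 0 \<rho>" "(\<lambda>w. of_real v * Q w x) holomorphic_on ball 0 \<rho>"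
    "(\<lambda>w. of_real v * S w x) holomorphic_on ball 0 \<rho>" "(\<lambda>w. w\<^sup>2 * (of_real v * Q w x)) holomorphic_on ball 0 \<rho>"
    "(\<lambda>w. R w x + Q w x) holomorphic_on ball 0 \<rho>" "(\<lambda>w. Q w x + R w x) holomorphic_on ball 0 \<rho>"
  by (intro holomorphic_intros hol)+

lemma taylor_square_Q: "taylor_coeff n (\<lambda>w. w\<^sup>2 * (of_real v * Q w x)) = of_real v * cQ2 n x"
  "taylor_coeff n (\<lambda>w. w\<^sup>2 * Q w x) = cQ2 n x"
  by (simp_all add: taylor_coeff_square_mult[OF \<rho>(1) entry_combinations_holomorphic(2) entry_combinations_holomorphic(2)] taylor_coeff_square_mult[OF \<rho>(1) hol(2) hol(2)]
      taylor_coeff_cmult[OF \<rho>(1) hol(2) hol(2)] cQ2_def cQ_def)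

lemma coeff_primitives:
  "primitive (\<lambda>x. cR n x + cQ n x - of_real (V x) * cQ2 n x) (cP n)"
  "primitive (\<lambda>x. cS n x - cP n x) (cQ2 n)"
  "primitive (\<lambda>x. of_real (U x) * cP n x - of_real (V x) * cS n x) (\<lambda>x. cR n x - cQ n x)"
  "primitive (\<lambda>x. of_real (U x) * cQ2 n x - (cQ n x + cR n x)) (cS n)"
proof -
  have eq: "taylor_coeff n (\<lambda>w. R w x + Q w x - w\<^sup>2 * (of_real v * Q w x)) = cR n x + cQ n x - of_real v * cQ2 n x"
    "taylor_coeff n (\<lambda>w. S w x - P w x) = cS n x - cP n x"
    "taylor_coeff n (\<lambda>w. of_real u * P w x - of_real v * S w x) = of_real u * cP n x - of_real v * cS n x"
    "taylor_coeff n (\<lambda>w. R w x - Q w x) = cR n x - cQ n x"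
    "taylor_coeff n (\<lambda>w. w\<^sup>2 * (of_real v * Q w x) - (Q w x + R w x)) = of_real v * cQ2 n x - (cQ n x + cR n x)" for x u v
    by (simp_all only: taylor_coeff_diff[OF \<rho>(1) entry_combinations_holomorphic(5) entry_combinations_holomorphic(4)] taylor_coeff_add[OF \<rho>(1) hol(3) hol(2)]
        taylor_coeff_diff[OF \<rho>(1) hol(4) hol(1)] taylor_coeff_diff[OF \<rho>(1) entry_combinations_holomorphic(1) entry_combinations_holomorphic(3)]
        taylor_coeff_cmult[OF \<rho>(1) hol(1) hol(1)] taylor_coeff_cmult[OF \<rho>(1) hol(4) hol(4)]
        taylor_coeff_diff[OF \<rho>(1) hol(3) hol(2)] taylor_coeff_diff[OF \<rho>(1) entry_combinations_holomorphic(4) entry_combinations_holomorphic(6)]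
        taylor_coeff_add[OF \<rho>(1) hol(2) hol(3)] taylor_square_Q cP_def cQ_def cR_def cS_def)
  note T = primitive_taylor_coeff[OF \<rho>(1), where n = n, folded taylor_coeff_def]
  have "primitive (\<lambda>x. taylor_coeff n (\<lambda>w. R w x + Q w x - w\<^sup>2 * (of_real (V x) * Q w x))) (\<lambda>x. taylor_coeff n (\<lambda>w. P w x))"
    by (rule T[OF _ _ prim(1) integrand_bounds(1) majorant_integrable]) (intro holomorphic_intros hol)+
  then show "primitive (\<lambda>x. cR n x + cQ n x - of_real (V x) * cQ2 n x) (cP n)"
    by (rule primitive_cong) (simp_all add: eq cP_def)
  have "primitive (\<lambda>x. taylor_coeff n (\<lambda>w. S w x - P w x)) (\<lambda>x. taylor_coeff n (\<lambda>w. w\<^sup>2 * Q w x))"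
    by (rule T[OF _ _ prim(2) integrand_bounds(2) majorant_integrable]) (intro holomorphic_intros hol)+
  then show "primitive (\<lambda>x. cS n x - cP n x) (cQ2 n)"
    by (rule primitive_cong) (simp_all add: eq taylor_square_Q)
  have "primitive (\<lambda>x. taylor_coeff n (\<lambda>w. of_real (U x) * P w x - of_real (V x) * S w x)) (\<lambda>x. taylor_coeff n (\<lambda>w. R w x - Q w x))"
    by (rule T[OF _ _ prim(3) integrand_bounds(3) majorant_integrable]) (intro holomorphic_intros hol)+
  then show "primitive (\<lambda>x. of_real (U x) * cP n x - of_real (V x) * cS n x) (\<lambda>x. cR n x - cQ n x)"
    by (rule primitive_cong) (simp_all add: eq)
  have "primitive (\<lambda>x. taylor_coeff n (\<lambda>w. w\<^sup>2 * (of_real (U x) * Q w x) - (Q w x + R w x))) (\<lambda>x. taylor_coeff n (\<lambda>w. S w x))"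
    by (rule T[OF _ _ prim(4) integrand_bounds(4) majorant_integrable]) (intro holomorphic_intros hol)+
  then show "primitive (\<lambda>x. of_real (U x) * cQ2 n x - (cQ n x + cR n x)) (cS n)"
    by (rule primitive_cong) (simp_all add: eq cS_def)
qed

lemma coeff_continuous:
  "continuous_on X (cP n)" "continuous_on X (cS n)" "continuous_on X (cQ n)" "continuous_on X (cR n)"
proof -
  show "continuous_on X (cP n)" "continuous_on X (cS n)"
    by (rule primitive_continuous[OF coeff_primitives(1)], rule primitive_continuous[OF coeff_primitives(4)])
  show Q: "continuous_on X (cQ n)"
    using primitive_continuous[OF coeff_primitives(2)[of "n + 2"], of X] by (simp add: cQ2_def[abs_def])
  have "continuous_on X (\<lambda>x. (cR n x - cQ n x) + cQ n x)"
    by (intro continuous_intros Q primitive_continuous[OF coeff_primitives(3)])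
  then show "continuous_on X (cR n)" by simp
qed

text \<open>\<open>cQ n\<close> equals \<open>cQ2 (n + 2)\<close> and is therefore a primitive, and
  the sum is \<open>(cR n - cQ n) + 2 cQ n\<close>. Its absolute continuity is what contradicts the
  hypothesis on \<open>V\<close>.\<close>

lemma coeff_primitive_sum: "\<exists>g. primitive g (\<lambda>x. cR n x + cQ n x)"
proof -
  have "primitive (\<lambda>x. cS (n + 2) x - cP (n + 2) x) (cQ n)"
    by (rule primitive_cong[OF coeff_primitives(2)[of "n + 2"]]) (simp_all add: cQ2_def)
  from primitive_add[OF coeff_primitives(3)[of n] primitive_cmult[OF this, of 2]]
  have "primitive (\<lambda>x. (of_real (U x) * cP n x - of_real (V x) * cS n x) + 2 * (cS (n + 2) x - cP (n + 2) x)) (\<lambda>x. cR n x + cQ n x)"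
    by (rule primitive_cong) simp_all
  then show ?thesis by blast
qed

lemma vanish_on_interval:
  assumes "a < b" and UV: "AE x in lebesgue. x \<in> {a..b} \<longrightarrow> V x = U x"
    and nac: "\<not> (\<exists>g. abs_cont_on a b g \<and> (AE x in lebesgue. x \<in> {a..b} \<longrightarrow> g x = V x))"
    and x: "x \<in> {a<..<b}"
  shows "cQ n x = 0" "cR n x = 0" "cP n x = cS n x"
proof -
  define x0 where "x0 = (a + b) / 2"
  have x0: "x0 \<in> {a<..<b}" using \<open>a < b\<close> by (simp add: x0_def)
  \<comment> \<open>If \<open>cQ2 n\<close> is constant, its derivative \<open>cS n - cP n\<close>
    vanishes. The derivative of \<open>cP n + cS n\<close> is \<open>(U - V) cQ2 n = 0\<close>, so
    \<open>cP n\<close> is constant as well, and its own equation yields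
    \<open>cR n + cQ n = V \<kappa>\<close>.\<close>
  have stage: "(\<forall>x\<in>{a<..<b}. cP n x = cS n x) \<and>
      (AE x in lebesgue. x \<in> {a<..<b} \<longrightarrow> cR n x + cQ n x - of_real (V x) * \<kappa> = 0)"
    if \<kappa>: "\<And>x. x \<in> {a<..<b} \<Longrightarrow> cQ2 n x = \<kappa>" for n \<kappa>
  proof -
    have "AE x in lebesgue. x \<in> {a<..<b} \<longrightarrow> cS n x - cP n x = 0"
      by (rule primitive_ae_zero_on[OF coeff_primitives(2) \<kappa>])
    then have "cS n x - cP n x = 0" if "x \<in> {a<..<b}" for x
      by (rule continuous_ae_zero_on[rotated, OF _ that]) (intro continuous_intros coeff_continuous)
    then have SP: "cP n x = cS n x" if "x \<in> {a<..<b}" for x using that by simp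
    have "primitive (\<lambda>x. (cR n x + cQ n x - of_real (V x) * cQ2 n x) + (of_real (U x) * cQ2 n x - (cQ n x + cR n x))) (\<lambda>x. cP n x + cS n x)"
      by (rule primitive_add[OF coeff_primitives(1) coeff_primitives(4)])
    moreover have "AE x in lebesgue. x \<in> {a<..<b} \<longrightarrow>
        (cR n x + cQ n x - of_real (V x) * cQ2 n x) + (of_real (U x) * cQ2 n x - (cQ n x + cR n x)) = 0"
      using UV by eventually_elim auto
    ultimately have "cP n x + cS n x = cP n x0 + cS n x0" if "x \<in> {a<..<b}" for x
      by (rule primitive_const_on[OF _ _ that x0])
    then have "cP n x = cP n x0" if "x \<in> {a<..<b}" for x
      using SP[OF that] SP[OF x0] that by (metis mult_2 mult_cancel_left zero_neq_numeral)
    then have "AE x in lebesgue. x \<in> {a<..<b} \<longrightarrow> cR n x + cQ n x - of_real (V x) * cQ2 n x = 0"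
      by (rule primitive_ae_zero_on[OF coeff_primitives(1)])
    then have "AE x in lebesgue. x \<in> {a<..<b} \<longrightarrow> cR n x + cQ n x - of_real (V x) * \<kappa> = 0"
      by eventually_elim (use \<kappa> in auto)
    with SP show ?thesis by blast
  qed
  \<comment> \<open>For \<open>\<kappa> = 0\<close> the sum of \<open>cR n\<close> and
    \<open>cQ n\<close> vanishes, and their difference has the derivative
    \<open>U cP n - V cS n = 0\<close>; hence both are constant.\<close>
  have stage0: "(\<forall>x\<in>{a<..<b}. cP n x = cS n x \<and> cR n x + cQ n x = 0 \<and> cQ n x = cQ n x0)"
    if z: "\<And>x. x \<in> {a<..<b} \<Longrightarrow> cQ2 n x = 0" for n
  proof -
    have s: "\<forall>x\<in>{a<..<b}. cP n x = cS n x" and s2: "AE x in lebesgue. x \<in> {a<..<b} \<longrightarrow> cR n x + cQ n x = 0"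
      using stage[OF z] by simp_all
    have RQ: "cR n x + cQ n x = 0" if "x \<in> {a<..<b}" for x
      by (rule continuous_ae_zero_on[OF _ s2 that]) (intro continuous_intros coeff_continuous)
    have "AE x in lebesgue. x \<in> {a<..<b} \<longrightarrow> of_real (U x) * cP n x - of_real (V x) * cS n x = 0"
      using UV by eventually_elim (use s in auto)
    then have "cR n x - cQ n x = cR n x0 - cQ n x0" if "x \<in> {a<..<b}" for x
      by (rule primitive_const_on[OF coeff_primitives(3) _ that x0])
    moreover have "u = v" if "r - u = r' - v" "r + u = 0" "r' + v = 0" for r r' u v :: complex
      using that by algebra
    ultimately have "cQ n x = cQ n x0" if "x \<in> {a<..<b}" for x
      using RQ[OF that] RQ[OF x0] that by blast
    then show ?thesis using s RQ by blast
  qed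
  have zero: "\<forall>x\<in>{a<..<b}. cQ n x = 0" for n
  proof (induction n rule: less_induct)
    case (less n)
    \<comment> \<open>By definition for orders below 2, by induction otherwise.\<close>
    have z: "cQ2 n x = 0" if "x \<in> {a<..<b}" for x
      using less[of "n - 2"] that by (auto simp: cQ2_def)
    \<comment> \<open>The constant found at order \<open>n\<close> reappears two orders higher,
      where it multiplies \<open>V\<close>.\<close>
    have c: "cQ2 (n + 2) x = cQ n x0" if "x \<in> {a<..<b}" for x
      using stage0[OF z] that by (simp add: cQ2_def)
    have "cQ n x0 = 0"
    proof (rule ccontr)
      assume nz: "cQ n x0 \<noteq> 0"
      obtain g where g: "primitive g (\<lambda>x. cR (n + 2) x + cQ (n + 2) x)"
        using coeff_primitive_sum by blast
      \<comment> \<open>The quotient equals the real function \<open>V\<close> almost everywhere on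
        the interval; taking the real part makes the representative real-valued.\<close>
      define G where "G x = Re ((cR (n + 2) x + cQ (n + 2) x) / cQ n x0)" for x
      have "abs_cont_on a b (\<lambda>x. cR (n + 2) x + cQ (n + 2) x)"
        using primitive_locally_abs_cont[OF g] \<open>a < b\<close> by (auto simp: locally_abs_cont_def)
      then have ac: "abs_cont_on a b G"
        unfolding G_def
        by (rule abs_cont_on_bounded_linear[OF bounded_linear_compose[OF bounded_linear_Re bounded_linear_divide]])
      have "AE x in lebesgue. x \<in> {a<..<b} \<longrightarrow> cR (n + 2) x + cQ (n + 2) x - of_real (V x) * cQ n x0 = 0"
        using stage[OF c] by blast
      \<comment> \<open>The identity is known on the open interval; the two end points form a null
        set.\<close>
      then have "AE x in lebesgue. x \<in> {a..b} \<longrightarrow> G x = V x"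
        using ae_neq_lebesgue[of a] ae_neq_lebesgue[of b]
      proof eventually_elim
        case (elim x)
        show ?case
        proof
          assume "x \<in> {a..b}"
          then have "cR (n + 2) x + cQ (n + 2) x = of_real (V x) * cQ n x0" using elim by auto
          then show "G x = V x" using nz by (simp add: G_def)
        qed
      qed
      with ac nac show False by blast
    qed
    then show ?case using stage0[OF z] by auto
  qed
  have z: "cQ2 n x = 0" if "x \<in> {a<..<b}" for n x
    using zero that by (auto simp: cQ2_def)
  show "cQ n x = 0" "cR n x = 0" "cP n x = cS n x"
    using stage0[OF z, of n] zero[of n] x by auto
qed

text \<open>Order 0 of the expansion: \<open>P 0\<close> is constant, which forces
  \<open>R 0 = - Q 0\<close>, and the equation for \<open>R - Q\<close> then exhibits
  \<open>U - V\<close> as the derivative of \<open>- 2 Q 0\<close>.\<close>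

lemma Q_0_primitive:
  "primitive (\<lambda>x. of_real (U x) - of_real (V x)) (\<lambda>x. - 2 * Q 0 x)"
proof -
  have c0: "cP 0 = (\<lambda>x. 1)" "cS 0 = (\<lambda>x. 1)" "cQ 0 = Q 0" "cR 0 = R 0" "cQ2 0 = (\<lambda>x. 0)"
    by (simp_all add: fun_eq_iff cP_def cS_def cQ_def cR_def cQ2_def taylor_coeff_0 at_0)
  have RQ: "R 0 x + Q 0 x = 0" for x
  proof (rule continuous_ae_zero_on[of _ "x - 1" "x + 1"])
    show "continuous_on UNIV (\<lambda>x. R 0 x + Q 0 x)"
      using coeff_continuous(3,4)[of UNIV 0] by (auto simp: c0 intro!: continuous_intros)
    have "primitive (\<lambda>x. R 0 x + Q 0 x) (\<lambda>x. 1)"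
      using coeff_primitives(1)[of 0] by (simp add: c0)
    from primitive_ae_zero_on[OF this] show "AE y in lebesgue. y \<in> {x - 1<..<x + 1} \<longrightarrow> R 0 y + Q 0 y = 0" by simp
  qed simp
  then have "R 0 x - Q 0 x = - 2 * Q 0 x" for x
    by (simp add: add_eq_0_iff2)
  with coeff_primitives(3)[of 0] show ?thesis by (simp add: c0)
qed

end

section \<open>Propagation of the identity matrix from one point to the line\<close>

lemma nonpos_of_le_geometric:
  fixes v C :: real
  assumes "\<And>n. v \<le> C * (1 / 2) ^ n" shows "v \<le> 0"
proof (rule LIMSEQ_le_const)
  have "(\<lambda>n. C * (1 / 2) ^ n) \<longlonglongrightarrow> C * 0" by (intro tendsto_intros LIMSEQ_power_zero) simp
  then show "(\<lambda>n. C * (1 / 2) ^ n) \<longlonglongrightarrow> 0" by simp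
qed (use assms in blast)

context dressing
begin

text \<open>Connectedness of the line: the set \<open>Z\<close> of points where the matrix is
  trivial for all \<open>w\<close> on a circle is closed by continuity and open by a contraction
  estimate. Once \<open>Z\<close> is everything, \<open>Q 0\<close> vanishes, and with it its
  derivative, a multiple of \<open>U - V\<close>.\<close>

lemma ae_eq_of_trivial_at:
  assumes x0: "\<And>w. w \<in> ball 0 \<rho> \<Longrightarrow> P w x0 = 1" "\<And>w. w \<in> ball 0 \<rho> \<Longrightarrow> S w x0 = 1"
    "\<And>w. w \<in> ball 0 \<rho> \<Longrightarrow> Q w x0 = 0" "\<And>w. w \<in> ball 0 \<rho> \<Longrightarrow> R w x0 = 0"
  shows "AE x in lebesgue. V x = U x"
proof -
  define r where "r = \<rho> / 2"
  have r: "0 < r" "r < \<rho>" using \<rho> by (auto simp: r_def)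
  \<comment> \<open>Adding \<open>2 Q 0\<close> removes the inhomogeneity from the equation for
    \<open>R - Q\<close>: the derivative becomes \<open>U (P - 1) - V (S - 1)\<close>, which
    vanishes with the deviation from the identity.\<close>
  define T where "T w x = R w x - Q w x + 2 * Q 0 x" for w x
  define C where "C = (sphere 0 r :: complex set)"
  have C: "w \<in> ball 0 \<rho>" "w \<noteq> 0" "norm w = r" if "w \<in> C" for w
    using that r by (auto simp: C_def)
  have z0: "0 \<in> ball 0 \<rho>" using \<rho> by simp
  \<comment> \<open>\<open>Q 0\<close> is a value at the centre of the circle; Cauchy's inequality
    of order 0 controls it by the values on the circle, which closes the system of
    estimates.\<close>
  have Q0: "norm (Q 0 x) \<le> M" if "\<And>w. w \<in> C \<Longrightarrow> norm (Q w x) \<le> M" for x M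
  proof -
    have "norm ((deriv ^^ 0) (\<lambda>w. Q w x) 0) \<le> fact 0 * M / r ^ 0"
    proof (rule Cauchy_inequality[OF _ _ r(1)])
      have sub: "cball 0 r \<subseteq> ball (0::complex) \<rho>" using r by auto
      show "(\<lambda>w. Q w x) holomorphic_on ball 0 r"
        by (rule holomorphic_on_subset[OF hol(2)]) (use r in auto)
      show "continuous_on (cball 0 r) (\<lambda>w. Q w x)"
        by (rule continuous_on_subset[OF holomorphic_on_imp_continuous_on[OF hol(2)] sub])
      show "norm (Q w x) \<le> M" if "norm (0 - w) = r" for w
        using \<open>\<And>w. w \<in> C \<Longrightarrow> norm (Q w x) \<le> M\<close>[of w] that by (simp add: C_def)
    qed
    then show ?thesis by simp
  qed
  have pT: "primitive (\<lambda>x. of_real (U x) * (P w x - 1) - of_real (V x) * (S w x - 1)) (T w)" if "w \<in> C" for w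
    by (rule primitive_cong[OF primitive_diff[OF prim(3)[OF C(1)[OF that]] Q_0_primitive]])
       (simp_all add: T_def algebra_simps)
  have pQ: "primitive (\<lambda>x. 1 / w\<^sup>2 * (S w x - P w x)) (Q w)" if "w \<in> C" for w
    by (rule primitive_cong[OF primitive_cmult[OF prim(2)[OF C(1)[OF that]], of "1 / w\<^sup>2"]])
       (use C(2)[OF that] in simp_all)
  have pP: "primitive (\<lambda>x. T w x + 2 * Q w x - 2 * Q 0 x - w\<^sup>2 * (of_real (V x) * Q w x)) (P w)" if "w \<in> C" for w
    by (rule primitive_cong[OF prim(1)[OF C(1)[OF that]]]) (simp_all add: T_def)
  have pS: "primitive (\<lambda>x. w\<^sup>2 * (of_real (U x) * Q w x) - (T w x + 2 * Q w x - 2 * Q 0 x)) (S w)" if "w \<in> C" for w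
    by (rule primitive_cong[OF prim(4)[OF C(1)[OF that]]]) (simp_all add: T_def)
  \<comment> \<open>The 5 bounds the coefficients in \<open>T + 2 Q - 2 Q 0\<close>, and
    \<open>2 / r^2\<close> those in \<open>(S - P) / w^2\<close>; thus one majorant
    \<open>M * h\<close> serves all four equations.\<close>
  define c where "c = 5 + 2 / r\<^sup>2"
  define h where "h t = c + \<bar>V t\<bar> + \<bar>U t\<bar>" for t
  have "\<exists>H. primitive h H"
  proof -
    obtain H1 H2 where H: "primitive (\<lambda>x. \<bar>V x\<bar>) H1" "primitive (\<lambda>x. \<bar>U x\<bar>) H2"
      using integrable_abs_primitive[OF V] integrable_abs_primitive[OF U] by blast
    have "primitive (\<lambda>x. c) (\<lambda>x. c * x)"
      by (rule primitive_vector_derivative) (auto intro!: derivative_eq_intros simp flip: has_real_derivative_iff_has_vector_derivative)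
    from primitive_add[OF primitive_add[OF this H(1)] H(2)] show ?thesis unfolding h_def by blast
  qed
  then obtain H where H: "primitive h H" by blast
  define small where "small M x \<longleftrightarrow> (\<forall>w\<in>C. norm (P w x - 1) \<le> M \<and> norm (S w x - 1) \<le> M \<and> norm (Q w x) \<le> M \<and> norm (T w x) \<le> M)" for M x
  define Z where "Z = {x. small 0 x}"
  have "closed Z"
  proof -
    have eq: "Z = (\<Inter>w\<in>C. {x. P w x = 1 \<and> S w x = 1 \<and> Q w x = 0 \<and> T w x = 0})"
      by (auto simp: Z_def small_def)
    show ?thesis unfolding eq
      by (intro closed_INT ballI closed_Collect_conj closed_Collect_eq continuous_on_const
          primitive_continuous[OF pP] primitive_continuous[OF pS] primitive_continuous[OF pQ] primitive_continuous[OF pT])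
  qed
  moreover have "open Z"
    unfolding open_dist
  proof
    fix x1 assume "x1 \<in> Z"
    then have x1: "P w x1 = 1" "S w x1 = 1" "Q w x1 = 0" "T w x1 = 0" if "w \<in> C" for w
      using that by (auto simp: Z_def small_def)
    \<comment> \<open>Near \<open>x1\<close> the integral of \<open>h\<close> from \<open>x1\<close>
      is below \<open>1 / 2\<close>, so a bound \<open>M\<close> on the whole neighbourhood improves
      to \<open>M / 2\<close>; iteration drives it to 0.\<close>
    have "isCont H x1" using primitive_continuous[OF H, of UNIV] by (simp add: continuous_on_eq_continuous_at)
    then obtain \<delta> where \<delta>: "\<delta> > 0" "\<And>x. dist x x1 < \<delta> \<Longrightarrow> dist (H x) (H x1) < 1 / 2"
      unfolding continuous_at_eps_delta by (metis half_gt_zero_iff zero_less_one)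
    have halve: "small (M / 2) x" if M: "0 \<le> M" and s: "\<And>t. dist t x1 < \<delta> \<Longrightarrow> small M t" and x: "dist x x1 < \<delta>" for M x
    proof -
      have t: "dist t x1 < \<delta>" if "t \<in> {min x x1..max x x1}" for t
        using that x by (auto simp: dist_real_def)
      have fin: "norm (G x - G x1) \<le> M / 2"
        if "primitive g G" "\<And>t. t \<in> {min x x1..max x x1} \<Longrightarrow> norm (g t) \<le> M * h t" for g G :: "real \<Rightarrow> complex"
      proof -
        have "norm (G x - G x1) \<le> M * \<bar>H x - H x1\<bar>" by (rule primitive_diff_le[OF that(1) H M that(2)])
        also have "\<dots> \<le> M * (1 / 2)" using \<delta>(2)[OF x] M by (intro mult_left_mono) (auto simp: dist_real_def)
        finally show ?thesis by simp
      qed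
      show ?thesis
        unfolding small_def
      proof (intro ballI conjI)
        fix w assume w: "w \<in> C"
        have w2: "norm (w\<^sup>2) \<le> 1" by (rule norm_square_le[OF C(1)[OF w]])
        have b: "norm (P w t - 1) \<le> M" "norm (S w t - 1) \<le> M" "norm (Q w t) \<le> M" "norm (T w t) \<le> M" "norm (Q 0 t) \<le> M"
          if "t \<in> {min x x1..max x x1}" for t
          using s[OF t[OF that]] w Q0[of t M] by (auto simp: small_def)
        have c0: "0 \<le> 2 / r\<^sup>2" by simp
        have sq: "norm (w\<^sup>2 * (of_real v * Q w t)) \<le> \<bar>v\<bar> * M" if "t \<in> {min x x1..max x x1}" for v t
          using mult_mono[OF w2 mult_left_mono[OF b(3)[OF that], of "\<bar>v\<bar>"]] M by (simp add: norm_mult)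
        have TQ: "norm (T w t + 2 * Q w t - 2 * Q 0 t) \<le> 5 * M" if "t \<in> {min x x1..max x x1}" for t
          using norm_triangle_le_diff[OF add_mono[OF norm_triangle_le[OF add_mono[OF b(4)[OF that] mult_left_mono[OF b(3)[OF that], of 2, folded norm_numeral[where 'a = complex], folded norm_mult]]]
              mult_left_mono[OF b(5)[OF that], of 2, folded norm_numeral[where 'a = complex], folded norm_mult]]]
          by simp
        have "norm (P w x - P w x1) \<le> M / 2"
        proof (rule fin[OF pP[OF w]])
          fix t assume t: "t \<in> {min x x1..max x x1}"
          have "norm (T w t + 2 * Q w t - 2 * Q 0 t - w\<^sup>2 * (of_real (V t) * Q w t)) \<le> 5 * M + \<bar>V t\<bar> * M"
            by (rule norm_triangle_le_diff[OF add_mono[OF TQ[OF t] sq[OF t]]])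
          also have "\<dots> = M * (5 + \<bar>V t\<bar>)" by (simp add: algebra_simps)
          also have "\<dots> \<le> M * h t" using M c0 by (intro mult_left_mono) (auto simp: h_def c_def)
          finally show "norm (T w t + 2 * Q w t - 2 * Q 0 t - w\<^sup>2 * (of_real (V t) * Q w t)) \<le> M * h t" .
        qed
        then show "norm (P w x - 1) \<le> M / 2" by (simp add: x1[OF w])
        have "norm (S w x - S w x1) \<le> M / 2"
        proof (rule fin[OF pS[OF w]])
          fix t assume t: "t \<in> {min x x1..max x x1}"
          have "norm (w\<^sup>2 * (of_real (U t) * Q w t) - (T w t + 2 * Q w t - 2 * Q 0 t)) \<le> \<bar>U t\<bar> * M + 5 * M"
            by (rule norm_triangle_le_diff[OF add_mono[OF sq[OF t] TQ[OF t]]])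
          also have "\<dots> = M * (5 + \<bar>U t\<bar>)" by (simp add: algebra_simps)
          also have "\<dots> \<le> M * h t" using M c0 by (intro mult_left_mono) (auto simp: h_def c_def)
          finally show "norm (w\<^sup>2 * (of_real (U t) * Q w t) - (T w t + 2 * Q w t - 2 * Q 0 t)) \<le> M * h t" .
        qed
        then show "norm (S w x - 1) \<le> M / 2" by (simp add: x1[OF w])
        have "norm (Q w x - Q w x1) \<le> M / 2"
        proof (rule fin[OF pQ[OF w]])
          fix t assume t: "t \<in> {min x x1..max x x1}"
          have "norm (S w t - P w t) \<le> 2 * M"
            using norm_triangle_le_diff[OF add_mono[OF b(2)[OF t] b(1)[OF t]]] by simp
          then have "norm (1 / w\<^sup>2 * (S w t - P w t)) \<le> 1 / r\<^sup>2 * (2 * M)"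
            unfolding norm_mult norm_divide norm_power C(3)[OF w] norm_one by (intro mult_left_mono) auto
          also have "\<dots> = M * (2 / r\<^sup>2)" by simp
          also have "\<dots> \<le> M * h t" using M by (intro mult_left_mono) (auto simp: h_def c_def)
          finally show "norm (1 / w\<^sup>2 * (S w t - P w t)) \<le> M * h t" .
        qed
        then show "norm (Q w x) \<le> M / 2" by (simp add: x1[OF w])
        have "norm (T w x - T w x1) \<le> M / 2"
        proof (rule fin[OF pT[OF w]])
          fix t assume t: "t \<in> {min x x1..max x x1}"
          have "norm (of_real (U t) * (P w t - 1) - of_real (V t) * (S w t - 1)) \<le> \<bar>U t\<bar> * M + \<bar>V t\<bar> * M"
            using b[OF t] by (intro norm_triangle_le_diff add_mono) (auto simp: norm_mult intro!: mult_left_mono)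
          also have "\<dots> = M * (\<bar>V t\<bar> + \<bar>U t\<bar>)" by (simp add: algebra_simps)
          also have "\<dots> \<le> M * h t" using M c0 by (intro mult_left_mono) (auto simp: h_def c_def)
          finally show "norm (of_real (U t) * (P w t - 1) - of_real (V t) * (S w t - 1)) \<le> M * h t" .
        qed
        then show "norm (T w x) \<le> M / 2" by (simp add: x1[OF w])
      qed
    qed
    \<comment> \<open>An a priori bound valid everywhere: \<open>|P - 1|\<close> is at most
      \<open>B + 1\<close>, and \<open>|T|\<close> at most \<open>B + B + 2 B\<close>.\<close>
    define M0 where "M0 = 4 * B + 1"
    have M0: "0 \<le> M0" using B_nonneg by (simp add: M0_def)
    have geo: "\<forall>x. dist x x1 < \<delta> \<longrightarrow> small (M0 * (1 / 2) ^ n) x" for n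
    proof (induction n)
      case 0
      have "small M0 x" for x
        unfolding small_def
      proof (intro ballI conjI)
        fix w assume "w \<in> C"
        note w = C(1)[OF this]
        show "norm (P w x - 1) \<le> M0" "norm (S w x - 1) \<le> M0"
          using norm_triangle_ineq4[of "P w x" 1] norm_triangle_ineq4[of "S w x" 1] bound(1,4)[OF w, of x] B_nonneg
          by (auto simp: M0_def)
        show "norm (Q w x) \<le> M0" using bound(2)[OF w, of x] B_nonneg by (simp add: M0_def)
        have "norm (T w x) \<le> norm (R w x) + norm (Q w x) + 2 * norm (Q 0 x)"
          unfolding T_def
          by (rule order_trans[OF norm_triangle_ineq add_mono[OF norm_triangle_ineq4]]) (simp add: norm_mult)
        then show "norm (T w x) \<le> M0"
          using bound(2,3)[OF w, of x] bound(2)[OF z0, of x] by (simp add: M0_def)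
      qed
      then show ?case by simp
    next
      case (Suc n)
      show ?case
        using halve[of "M0 * (1 / 2) ^ n"] Suc M0 by simp
    qed
    have "small 0 x" if "dist x x1 < \<delta>" for x
      unfolding small_def
    proof (intro ballI conjI)
      fix w assume w: "w \<in> C"
      have g: "norm (P w x - 1) \<le> M0 * (1 / 2) ^ n" "norm (S w x - 1) \<le> M0 * (1 / 2) ^ n"
        "norm (Q w x) \<le> M0 * (1 / 2) ^ n" "norm (T w x) \<le> M0 * (1 / 2) ^ n" for n
        using geo[of n] that w unfolding small_def by blast+
      show "norm (P w x - 1) \<le> 0" "norm (S w x - 1) \<le> 0" "norm (Q w x) \<le> 0" "norm (T w x) \<le> 0"
        by (rule nonpos_of_le_geometric[OF g(1)], rule nonpos_of_le_geometric[OF g(2)],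
            rule nonpos_of_le_geometric[OF g(3)], rule nonpos_of_le_geometric[OF g(4)])
    qed
    then show "\<exists>e>0. \<forall>y. dist y x1 < e \<longrightarrow> y \<in> Z"
      using \<delta>(1) by (auto simp: Z_def)
  qed
  moreover have "x0 \<in> Z"
    using x0 C(1) z0 by (auto simp: Z_def small_def T_def)
  ultimately have "Z = UNIV" using clopen[of Z] by blast
  then have "Q 0 x = 0" for x
    using Q0[of x 0] by (auto simp: Z_def small_def)
  then have "primitive (\<lambda>x. of_real (U x) - of_real (V x)) (\<lambda>x. 0 :: complex)"
    using Q_0_primitive by simp
  from primitive_unique[OF this primitive_const]
  show ?thesis by eventually_elim simp
qed

lemma ae_eq_of_ae_eq_on_interval:
  assumes "a < b" and UV: "AE x in lebesgue. x \<in> {a..b} \<longrightarrow> V x = U x"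
    and nac: "\<not> (\<exists>g. abs_cont_on a b g \<and> (AE x in lebesgue. x \<in> {a..b} \<longrightarrow> g x = V x))"
  shows "AE x in lebesgue. V x = U x"
proof -
  define x0 where "x0 = (a + b) / 2"
  have x0: "x0 \<in> {a<..<b}" using \<open>a < b\<close> by (simp add: x0_def)
  note van = vanish_on_interval[OF assms x0]
  have Q: "Q w x0 = 0" if "w \<in> ball 0 \<rho>" for w
    by (rule taylor_coeff_zero_imp[OF \<rho>(1) hol(2) hol(2) _ that]) (use van(1) in \<open>simp add: cQ_def\<close>)
  have R: "R w x0 = 0" if "w \<in> ball 0 \<rho>" for w
    by (rule taylor_coeff_zero_imp[OF \<rho>(1) hol(3) hol(3) _ that]) (use van(2) in \<open>simp add: cR_def\<close>)
  have h: "(\<lambda>w. P w x0 - S w x0) holomorphic_on ball 0 \<rho>" by (intro holomorphic_intros hol)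
  have "P w x0 - S w x0 = 0" if "w \<in> ball 0 \<rho>" for w
    by (rule taylor_coeff_zero_imp[OF \<rho>(1) h h _ that])
       (use van(3) in \<open>simp add: taylor_coeff_diff[OF \<rho>(1) hol(1) hol(4)] cP_def cS_def\<close>)
  then have PS: "P w x0 = S w x0" if "w \<in> ball 0 \<rho>" for w using that by simp
  have P: "P w x0 = 1" if w: "w \<in> ball 0 \<rho>" for w
  proof -
    \<comment> \<open>The determinant leaves the alternatives 1 and \<open>- 1\<close> for the
      scalar matrix; \<open>norm (P w x0 - 1) < 2\<close> excludes the second.\<close>
    have "P w x0 * P w x0 = 1" using det[OF w, of x0] Q[OF w] PS[OF w] by simp
    then have "(P w x0 - 1) * (P w x0 + 1) = 0" by (simp add: algebra_simps)
    moreover have "P w x0 \<noteq> - 1" using P_near_1[OF w, of x0] by auto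
    ultimately show ?thesis by (simp add: add_eq_0_iff2)
  qed
  show ?thesis by (rule ae_eq_of_trivial_at[of x0]) (use P PS Q R in auto)
qed

end

section \<open>From two potentials with equal reflection coefficients to the expansion at
  infinity\<close>

context jost_pair
begin

lemma dressing_exists: "\<exists>P Q R S B. dressing V U P Q R S (1 / K) B"
proof -
  have K0: "0 < K" by (rule V.K)
  have A0: "0 \<le> A" using A(1) V.A_nonneg by linarith
  have uK: "K \<le> norm k" "k \<noteq> 0" if "k \<in> upper_closed K" for k using that K0 by (auto simp: upper_closed_def)
  \<comment> \<open>From \<open>40 / 32 = 5 / 4\<close>; being below 2, this gives the closeness of
    \<open>P\<close> to 1 that decides the sign in the determinant equation.\<close>
  have AK: "40 * A / norm k \<le> 5 / 4" if "k \<in> upper_closed K" for k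
  proof -
    have "0 < norm k" "32 * A \<le> norm k" using uK[OF that] A(3) by auto
    then show ?thesis by (simp add: pos_divide_le_eq)
  qed
  define B where "B = 3 + 40 * A"
  have bP: "norm (dp k x) \<le> B" "norm (ds k x) \<le> B" "norm (k\<^sup>2 * dq k x) \<le> B" "norm (dr k x) \<le> B"
    if k: "k \<in> upper_closed K" for k x
    using norm_triangle_sub[of "dp k x" 1] norm_triangle_sub[of "ds k x" 1] dressing_bounds[OF k, of x] AK[OF k] A0
    by (auto simp: B_def)
  obtain P where P: "\<And>x. (\<lambda>w. P w x) holomorphic_on ball 0 (1 / K)"
    "\<And>w x. w \<in> ball 0 (1 / K) \<Longrightarrow> norm (P w x) \<le> B"
    "\<And>k x. k \<in> upper_closed K \<Longrightarrow> K < norm k \<Longrightarrow> P (1 / k) x = dp k x \<and> P (- 1 / k) x = dp k x"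
    using even_extension_family[of K dp B, OF K0 dressing_regularity(1) dressing_regularity(2) bP(1) dressing_even(1)] by metis
  obtain Q where Q: "\<And>x. (\<lambda>w. Q w x) holomorphic_on ball 0 (1 / K)"
    "\<And>w x. w \<in> ball 0 (1 / K) \<Longrightarrow> norm (Q w x) \<le> B"
    "\<And>k x. k \<in> upper_closed K \<Longrightarrow> K < norm k \<Longrightarrow> Q (1 / k) x = k\<^sup>2 * dq k x \<and> Q (- 1 / k) x = k\<^sup>2 * dq k x"
  proof (rule even_extension_family[of K "\<lambda>k x. k\<^sup>2 * dq k x" B])
    show "continuous_on (upper_closed K) (\<lambda>k. k\<^sup>2 * dq k x)" for x by (intro continuous_intros dressing_regularity)
    show "(\<lambda>k. k\<^sup>2 * dq k x) holomorphic_on upper_open K" for x by (intro holomorphic_intros dressing_regularity)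
    show "(- complex_of_real k)\<^sup>2 * dq (- complex_of_real k) x = (complex_of_real k)\<^sup>2 * dq (complex_of_real k) x" if "K \<le> \<bar>k\<bar>" for k x
      by (simp add: dressing_even[OF that])
  qed (use K0 bP in auto)
  obtain R where R: "\<And>x. (\<lambda>w. R w x) holomorphic_on ball 0 (1 / K)"
    "\<And>w x. w \<in> ball 0 (1 / K) \<Longrightarrow> norm (R w x) \<le> B"
    "\<And>k x. k \<in> upper_closed K \<Longrightarrow> K < norm k \<Longrightarrow> R (1 / k) x = dr k x \<and> R (- 1 / k) x = dr k x"
    using even_extension_family[of K dr B, OF K0 dressing_regularity(5) dressing_regularity(6) bP(4) dressing_even(3)] by metis
  obtain S where S: "\<And>x. (\<lambda>w. S w x) holomorphic_on ball 0 (1 / K)"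
    "\<And>w x. w \<in> ball 0 (1 / K) \<Longrightarrow> norm (S w x) \<le> B"
    "\<And>k x. k \<in> upper_closed K \<Longrightarrow> K < norm k \<Longrightarrow> S (1 / k) x = ds k x \<and> S (- 1 / k) x = ds k x"
    using even_extension_family[of K ds B, OF K0 dressing_regularity(7) dressing_regularity(8) bP(2) dressing_even(4)] by metis
  \<comment> \<open>One of \<open>1 / w\<close> and \<open>- 1 / w\<close> lies in the closed upper
    half plane; the extensions take the same value at \<open>1 / k\<close> and
    \<open>- 1 / k\<close>, so either serves.\<close>
  have rep: "\<exists>k\<in>upper_closed K. norm w = 1 / norm k \<and> w\<^sup>2 * k\<^sup>2 = 1 \<and>
      P w = dp k \<and> Q w = (\<lambda>x. k\<^sup>2 * dq k x) \<and> R w = dr k \<and> S w = ds k"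
    if w: "w \<in> ball 0 (1 / K) - {0}" for w
  proof -
    have n: "K < norm (1 / w)" using w K0 by (simp add: norm_divide field_simps)
    have main: ?thesis if k: "k \<in> upper_closed K" "K < norm k" "w = 1 / k \<or> w = - 1 / k" for k
    proof (rule bexI[OF _ k(1)], intro conjI)
      show "norm w = 1 / norm k" "w\<^sup>2 * k\<^sup>2 = 1" using k uK[OF k(1)] by (auto simp: norm_divide power_divide)
      show "P w = dp k" "Q w = (\<lambda>x. k\<^sup>2 * dq k x)" "R w = dr k" "S w = ds k"
        using P(3)[OF k(1,2)] Q(3)[OF k(1,2)] R(3)[OF k(1,2)] S(3)[OF k(1,2)] k(3) by auto
    qed
    show ?thesis
    proof (cases "0 \<le> Im (1 / w)")
      case True
      then show ?thesis using main[of "1 / w"] n w by (auto simp: upper_closed_def)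
    next
      case False
      then show ?thesis using main[of "- 1 / w"] n w by (auto simp: upper_closed_def)
    qed
  qed
  have est: "norm (P w x - 1) \<le> 40 * A * norm w" "norm (S w x - 1) \<le> 40 * A * norm w"
    if "w \<in> ball 0 (1 / K) - {0}" for w x
    using rep[OF that] dressing_bounds by fastforce+
  have P0: "P 0 x = 1" and S0: "S 0 x = 1" for x
    using holomorphic_value_at_0[OF _ P(1) est(1)] holomorphic_value_at_0[OF _ S(1) est(2)] K0 by auto
  have prim: "primitive (\<lambda>x. R w x + Q w x - w\<^sup>2 * (of_real (V x) * Q w x)) (P w)"
      "primitive (\<lambda>x. S w x - P w x) (\<lambda>x. w\<^sup>2 * Q w x)"
      "primitive (\<lambda>x. of_real (U x) * P w x - of_real (V x) * S w x) (\<lambda>x. R w x - Q w x)"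
      "primitive (\<lambda>x. w\<^sup>2 * (of_real (U x) * Q w x) - (Q w x + R w x)) (S w)"
    if w: "w \<in> ball 0 (1 / K) - {0}" for w
  proof -
    obtain k where k: "k \<in> upper_closed K" "w\<^sup>2 * k\<^sup>2 = 1"
      and e: "P w = dp k" "Q w = (\<lambda>x. k\<^sup>2 * dq k x)" "R w = dr k" "S w = ds k"
      using rep[OF w] by blast
    have wk: "w\<^sup>2 * (k\<^sup>2 * z) = z" "w\<^sup>2 * (v * (k\<^sup>2 * z)) = v * z" for v z
    proof -
      have "w\<^sup>2 * (k\<^sup>2 * z) = (w\<^sup>2 * k\<^sup>2) * z" "w\<^sup>2 * (v * (k\<^sup>2 * z)) = (w\<^sup>2 * k\<^sup>2) * (v * z)"
        by (simp_all only: mult_ac)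
      then show "w\<^sup>2 * (k\<^sup>2 * z) = z" "w\<^sup>2 * (v * (k\<^sup>2 * z)) = v * z" by (simp_all add: k(2))
    qed
    note d = dressing_primitives[OF k(1)]
    show "primitive (\<lambda>x. R w x + Q w x - w\<^sup>2 * (of_real (V x) * Q w x)) (P w)"
      by (rule primitive_cong[OF d(1)]; simp only: e wk; simp add: algebra_simps)
    show "primitive (\<lambda>x. S w x - P w x) (\<lambda>x. w\<^sup>2 * Q w x)"
      by (rule primitive_cong[OF d(2)]) (simp_all add: e wk)
    \<comment> \<open>Subtracting \<open>k^2\<close> times the equation of \<open>dq\<close> removes
      the terms of order \<open>k^2\<close> from that of \<open>dr\<close>; this is the origin of
      the combination \<open>R - Q\<close>.\<close>
    show "primitive (\<lambda>x. of_real (U x) * P w x - of_real (V x) * S w x) (\<lambda>x. R w x - Q w x)"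
      by (rule primitive_cong[OF primitive_diff[OF d(3) primitive_cmult[OF d(2), of "k\<^sup>2"]]]) (simp_all add: e algebra_simps)
    show "primitive (\<lambda>x. w\<^sup>2 * (of_real (U x) * Q w x) - (Q w x + R w x)) (S w)"
      by (rule primitive_cong[OF d(4)]; simp only: e wk; simp add: algebra_simps)
  qed
  have det: "P w x * S w x - w\<^sup>2 * (Q w x * R w x) = 1" if w: "w \<in> ball 0 (1 / K) - {0}" for w x
  proof -
    obtain k where k: "k \<in> upper_closed K" "w\<^sup>2 * k\<^sup>2 = 1"
      and e: "P w = dp k" "Q w = (\<lambda>x. k\<^sup>2 * dq k x)" "R w = dr k" "S w = ds k"
      using rep[OF w] by blast
    have "w\<^sup>2 * (Q w x * R w x) = (w\<^sup>2 * k\<^sup>2) * (dq k x * dr k x)" unfolding e by (simp only: mult_ac)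
    also have "\<dots> = dq k x * dr k x" by (simp only: k(2) mult_1)
    finally have eq: "w\<^sup>2 * (Q w x * R w x) = dq k x * dr k x" .
    show ?thesis unfolding eq using dressing_det[OF k(1), of x] by (simp add: e)
  qed
  have "dressing V U P Q R S (1 / K) B"
  proof
    show "norm (P w x - 1) < 2" if w: "w \<in> ball 0 (1 / K)" for w x
    proof (cases "w = 0")
      case False
      then obtain k where k: "k \<in> upper_closed K" "P w = dp k" using rep[of w] w by blast
      show ?thesis using dressing_bounds(1)[OF k(1), of x] AK[OF k(1)] by (simp add: k(2))
    qed (simp add: P0)
  qed (use V.V U.V K0 K1 P(1,2) Q(1,2) R(1,2) S(1,2) P0 S0 prim det in auto)
  then show ?thesis by blast
qed

end

section \<open>Reflection of the line and conclusion\<close>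

lemma abs_cont_on_reflect:
  fixes g :: "real \<Rightarrow> 'a::real_normed_vector"
  assumes g: "abs_cont_on (- b) (- a) g" shows "abs_cont_on a b (\<lambda>x. g (- x))"
  unfolding abs_cont_on_def
proof (intro allI impI)
  fix e :: real assume "e > 0"
  obtain d where d: "d > 0" "\<And>D. finite D \<Longrightarrow> \<forall>(u, v)\<in>D. - b \<le> u \<and> u < v \<and> v \<le> - a \<Longrightarrow>
        pairwise (\<lambda>I J. {fst I<..<snd I} \<inter> {fst J<..<snd J} = {}) D \<Longrightarrow>
        (\<Sum>(u, v)\<in>D. v - u) < d \<Longrightarrow> (\<Sum>(u, v)\<in>D. norm (g v - g u)) < e"
    by (rule abs_cont_onE[OF g \<open>e > 0\<close>]) (rule that)
  define \<phi> where "\<phi> I = (- snd I, - fst I)" for I :: "real \<times> real"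
  have inj: "inj_on \<phi> D" for D by (auto simp: inj_on_def \<phi>_def prod_eq_iff)
  show "\<exists>d>0. \<forall>D. finite D \<longrightarrow> (\<forall>(u, v)\<in>D. a \<le> u \<and> u < v \<and> v \<le> b) \<longrightarrow>
        pairwise (\<lambda>I J. {fst I<..<snd I} \<inter> {fst J<..<snd J} = {}) D \<longrightarrow>
        (\<Sum>(u, v)\<in>D. v - u) < d \<longrightarrow> (\<Sum>(u, v)\<in>D. norm (g (- v) - g (- u))) < e"
  proof (intro exI[of _ d] conjI allI impI)
    fix D :: "(real \<times> real) set"
    assume D: "finite D" "\<forall>(u, v)\<in>D. a \<le> u \<and> u < v \<and> v \<le> b"
      "pairwise (\<lambda>I J. {fst I<..<snd I} \<inter> {fst J<..<snd J} = {}) D" "(\<Sum>(u, v)\<in>D. v - u) < d"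
    have "(\<Sum>(u, v)\<in>\<phi> ` D. norm (g v - g u)) < e"
    proof (rule d(2))
      show "finite (\<phi> ` D)" using D(1) by simp
      show "\<forall>(u, v)\<in>\<phi> ` D. - b \<le> u \<and> u < v \<and> v \<le> - a" using D(2) by (force simp: \<phi>_def)
      have "{fst (\<phi> I)<..<snd (\<phi> I)} \<inter> {fst (\<phi> J)<..<snd (\<phi> J)} = {}" if "I \<in> D" "J \<in> D" "I \<noteq> J" for I J
      proof (rule ccontr)
        assume "{fst (\<phi> I)<..<snd (\<phi> I)} \<inter> {fst (\<phi> J)<..<snd (\<phi> J)} \<noteq> {}"
        then obtain y where "y \<in> {fst (\<phi> I)<..<snd (\<phi> I)}" "y \<in> {fst (\<phi> J)<..<snd (\<phi> J)}" by blast
        then have "- y \<in> {fst I<..<snd I} \<inter> {fst J<..<snd J}" by (auto simp: \<phi>_def)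
        then show False using pairwiseD[OF D(3) that] by blast
      qed
      then show "pairwise (\<lambda>I J. {fst I<..<snd I} \<inter> {fst J<..<snd J} = {}) (\<phi> ` D)"
        unfolding pairwise_def by blast
      show "(\<Sum>(u, v)\<in>\<phi> ` D. v - u) < d"
        using D(4) unfolding sum.reindex[OF inj] o_def by (simp add: \<phi>_def split_def)
    qed
    then show "(\<Sum>(u, v)\<in>D. norm (g (- v) - g (- u))) < e"
      unfolding sum.reindex[OF inj] o_def by (simp add: \<phi>_def split_def norm_minus_commute)
  qed (rule d(1))
qed

lemma ae_lebesgue_reflect:
  assumes "AE x in lebesgue. P (x :: real)" shows "AE x in lebesgue. P (- x)"
proof -
  obtain N where N: "N \<in> null_sets lebesgue" "{x \<in> space lebesgue. \<not> P x} \<subseteq> N"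
    using assms by (auto simp: eventually_ae_filter)
  have "negligible (uminus ` N)"
    using N(1) by (intro negligible_differentiable_image_negligible)
      (auto simp: negligible_iff_null_sets intro!: derivative_intros)
  then have "uminus ` N \<in> null_sets lebesgue" using negligible_iff_null_sets by blast
  moreover have "{x \<in> space lebesgue. \<not> P (- x)} \<subseteq> uminus ` N"
  proof
    fix x assume "x \<in> {x \<in> space lebesgue. \<not> P (- x)}"
    then have "- x \<in> N" using N(2) by auto
    then show "x \<in> uminus ` N" by (metis imageI minus_minus)
  qed
  ultimately show ?thesis by (rule AE_I')
qed

lemma ae_eq_of_left_reflection_eq:
  fixes V W :: "real \<Rightarrow> real" and A K :: real
  assumes "a < b" and V: "integrable lebesgue V" and W: "integrable lebesgue W"
    and K: "1 \<le> K" "32 * A \<le> K" and A: "(\<integral>t. \<bar>V t\<bar> \<partial>lebesgue) \<le> A" "(\<integral>t. \<bar>W t\<bar> \<partial>lebesgue) \<le> A"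
    and L: "\<And>k::real. K \<le> \<bar>k\<bar> \<Longrightarrow> left_reflection W k = left_reflection V k"
    and "AE x in lebesgue. x \<in> {a..b} \<longrightarrow> V x = W x"
    and "\<not> (\<exists>g. abs_cont_on a b g \<and> (AE x in lebesgue. x \<in> {a..b} \<longrightarrow> g x = V x))"
  shows "AE x in lebesgue. V x = W x"
proof -
  have A0: "0 \<le> A" using order_trans[OF _ A(1)] by simp
  interpret jost_pair V W K A
    by unfold_locales (use V W K A A0 L in auto)
  obtain P Q R S B where "dressing V W P Q R S (1 / K) B" using dressing_exists by blast
  then show ?thesis by (rule dressing.ae_eq_of_ae_eq_on_interval[OF _ assms(1,9,10)])
qed

lemma L11_integrable:
  assumes "V \<in> L11" shows "integrable lebesgue V"
proof (rule Bochner_Integration.integrable_bound)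
  show "integrable lebesgue (\<lambda>x. (1 + \<bar>x\<bar>) * \<bar>V x\<bar>)" "V \<in> borel_measurable lebesgue"
    using assms by (auto simp: L11_def)
  show "AE x in lebesgue. norm (V x) \<le> norm ((1 + \<bar>x\<bar>) * \<bar>V x\<bar>)"
    by (intro AE_I2) (simp add: abs_mult distrib_right)
qed

theorem theorem1p1:
  fixes a b :: real and V W :: "real \<Rightarrow> real"
  assumes "a < b"
    and "V \<in> L11" and "W \<in> L11"
    and "AE x\<in>{a..b} in lebesgue. V x = W x"
    and "\<not> (\<exists>g :: real \<Rightarrow> real. abs_cont_on a b g \<and> (AE x\<in>{a..b} in lebesgue. g x = V x))"
    and "(\<forall>k. left_reflection V k = left_reflection W k) \<or>
         (\<forall>k. right_reflection V k = right_reflection W k)"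
  shows "AE x in lebesgue. V x = W x"
proof -
  note V = L11_integrable[OF assms(2)] and W = L11_integrable[OF assms(3)]
  define A where "A = (\<integral>t. \<bar>V t\<bar> \<partial>lebesgue) + (\<integral>t. \<bar>W t\<bar> \<partial>lebesgue)"
  define K where "K = max 1 (32 * A)"
  have A: "(\<integral>t. \<bar>V t\<bar> \<partial>lebesgue) \<le> A" "(\<integral>t. \<bar>W t\<bar> \<partial>lebesgue) \<le> A"
    by (simp_all add: A_def)
  have K: "1 \<le> K" "32 * A \<le> K" by (simp_all add: K_def)
  show ?thesis
    using assms(6)
  proof
    assume "\<forall>k. left_reflection V k = left_reflection W k"
    then show ?thesis
      by (intro ae_eq_of_left_reflection_eq[OF assms(1) V W K A _ assms(4,5)]) simp
  next
    assume R: "\<forall>k. right_reflection V k = right_reflection W k"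
    have A0: "0 \<le> A" using order_trans[OF _ A(1)] by simp
    interpret V: jost_setup V K by unfold_locales (use V K A A0 in auto)
    interpret W: jost_setup W K by unfold_locales (use W K A A0 in auto)
    interpret V': jost_setup "\<lambda>x. V (- x)" K by (rule V.reflect)
    interpret W': jost_setup "\<lambda>x. W (- x)" K by (rule W.reflect)
    have "AE x in lebesgue. V (- x) = W (- x)"
    proof (rule ae_eq_of_left_reflection_eq[OF _ V'.V W'.V K])
      show "- b < - a" using assms(1) by simp
      show "(\<integral>t. \<bar>V (- t)\<bar> \<partial>lebesgue) \<le> A" "(\<integral>t. \<bar>W (- t)\<bar> \<partial>lebesgue) \<le> A"
        using A by (simp_all add: V.A_reflect W.A_reflect)
      show "left_reflection (\<lambda>x. W (- x)) k = left_reflection (\<lambda>x. V (- x)) k" if k: "K \<le> \<bar>k\<bar>" for k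
        using R K A by (subst V.left_reflection_reflect[OF k], linarith) (subst W.left_reflection_reflect[OF k], auto)
      show "AE x in lebesgue. x \<in> {- b..- a} \<longrightarrow> V (- x) = W (- x)"
        using ae_lebesgue_reflect[OF assms(4)] by eventually_elim auto
      \<comment> \<open>An absolutely continuous representative of the reflected potential on the
        reflected interval would reflect back to one of \<open>V\<close>.\<close>
      show "\<not> (\<exists>g. abs_cont_on (- b) (- a) g \<and> (AE x in lebesgue. x \<in> {- b..- a} \<longrightarrow> g x = V (- x)))"
      proof
        assume "\<exists>g. abs_cont_on (- b) (- a) g \<and> (AE x in lebesgue. x \<in> {- b..- a} \<longrightarrow> g x = V (- x))"
        then obtain g where g: "abs_cont_on (- b) (- a) g" "AE x in lebesgue. x \<in> {- b..- a} \<longrightarrow> g x = V (- x)" by blast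
        have "AE x in lebesgue. x \<in> {a..b} \<longrightarrow> g (- x) = V x"
          using ae_lebesgue_reflect[OF g(2)] by eventually_elim auto
        with abs_cont_on_reflect[OF g(1)] assms(5) show False by blast
      qed
    qed
    from ae_lebesgue_reflect[OF this] show ?thesis by simp
  qed
qed

end
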